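(* Let $\Omega=B_R\subset\mathbb{R}^N$, $q\in(0,1)$, and let $a\in L^\infty(\Omega)$ be a radial function with $\int_\Omega a<0$. Assume there exists $R_0\in(0,R)$ such that $a\ge0$ in $A_{R_0,R}$ and $$\frac{1-q}{2q+N(1-q)}\,\omega_{N-1}R_0^N\,\|a^-\|_{L^\infty(B_{R_0})}<\int_{A_{R_0,R}}a^+.$$ Then $(P_{a,q})$ has a unique solution $u\in\mathcal{P}^\circ$.
   Context: $B_{\rho}:=\{x\in\mathbb{R}^N:|x|<\rho\}$, $A_{R_0,R}:=\{x:R_0<|x|<R\}$, $\omega_{N-1}$ is the surface area of the unit sphere in $\mathbb{R}^N$, $a^\pm:=\max(\pm a,0)$. $(P_{a,q})$ denotes $-\Delta u=a(x)u^q$ in $\Omega$, $\partial u/\partial\nu=0$ on $\partial\Omega$; solutions are taken in $W^{2,r}(\Omega)$, $r>N$. $\mathcal{P}^\circ:=\{u\in\mathcal{C}^1(\overline\Omega):u>0\text{ on }\overline\Omega\}$. *)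

theory Defs
  imports "HOL-Analysis.Analysis"
begin

definition annulus :: "real \<Rightarrow> real \<Rightarrow> 'a::euclidean_space set" where
  "annulus R0 R = {x. R0 < norm x \<and> norm x < R}"

text \<open>Surface area of the unit sphere in R^N: N times the volume of the unit ball.\<close>
definition omega_sphere :: "'a::euclidean_space itself \<Rightarrow> real" where
  "omega_sphere _ = real DIM('a) * measure lebesgue (ball (0::'a) 1)"

definition Lp_on :: "real \<Rightarrow> 'a::euclidean_space set \<Rightarrow> ('a \<Rightarrow> real) \<Rightarrow> bool" where
  "Lp_on p S f \<longleftrightarrow> f \<in> borel_measurable (lebesgue_on S) \<and>
     integrable (lebesgue_on S) (\<lambda>x. \<bar>f x\<bar> powr p)"

definition Linf_on :: "'a::euclidean_space set \<Rightarrow> ('a \<Rightarrow> real) \<Rightarrow> bool" where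
  "Linf_on S f \<longleftrightarrow> f \<in> borel_measurable (lebesgue_on S) \<and>
     (\<exists>M. AE x in lebesgue_on S. \<bar>f x\<bar> \<le> M)"

definition Linf_norm :: "'a::euclidean_space set \<Rightarrow> ('a \<Rightarrow> real) \<Rightarrow> real" where
  "Linf_norm S f = Inf {M. 0 \<le> M \<and> (AE x in lebesgue_on S. \<bar>f x\<bar> \<le> M)}"

definition radial_on :: "'a::euclidean_space set \<Rightarrow> ('a \<Rightarrow> real) \<Rightarrow> bool" where
  "radial_on S f \<longleftrightarrow> (\<exists>g. AE x in lebesgue_on S. f x = g (norm x))"

definition partial :: "'a::euclidean_space \<Rightarrow> ('a \<Rightarrow> real) \<Rightarrow> 'a \<Rightarrow> real" where
  "partial i f x = frechet_derivative f (at x) i"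

fun Ck :: "nat \<Rightarrow> ('a::euclidean_space \<Rightarrow> real) \<Rightarrow> bool" where
  "Ck 0 f = continuous_on UNIV f"
| "Ck (Suc k) f = (continuous_on UNIV f \<and> (\<forall>x. f differentiable (at x)) \<and>
                   (\<forall>i\<in>Basis. Ck k (partial i f)))"

definition smooth :: "('a::euclidean_space \<Rightarrow> real) \<Rightarrow> bool" where
  "smooth f \<longleftrightarrow> (\<forall>k. Ck k f)"

definition test_fun :: "'a::euclidean_space set \<Rightarrow> ('a \<Rightarrow> real) \<Rightarrow> bool" where
  "test_fun S \<phi> \<longleftrightarrow> smooth \<phi> \<and> compact (closure {x. \<phi> x \<noteq> 0}) \<and>
     closure {x. \<phi> x \<noteq> 0} \<subseteq> S"

definition weak_partial :: "'a::euclidean_space set \<Rightarrow> 'a \<Rightarrow> ('a \<Rightarrow> real) \<Rightarrow> ('a \<Rightarrow> real) \<Rightarrow> bool" where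
  "weak_partial S i u g \<longleftrightarrow> (\<forall>\<phi>. test_fun S \<phi> \<longrightarrow>
     integral\<^sup>L (lebesgue_on S) (\<lambda>x. u x * partial i \<phi> x) =
     - integral\<^sup>L (lebesgue_on S) (\<lambda>x. g x * \<phi> x))"

text \<open>Solution of (P_{a,q}) on Omega = B_R: u in W^{2,r}(Omega) for some r > N,
  -Delta u = a u^q a.e. in Omega, and zero normal derivative on the boundary
  (the derivative of t \<mapsto> u(t x) at t = 1 from the left, for |x| = R).\<close>
definition is_solution :: "real \<Rightarrow> ('a::euclidean_space \<Rightarrow> real) \<Rightarrow> real \<Rightarrow> ('a \<Rightarrow> real) \<Rightarrow> bool" where
  "is_solution R a q u \<longleftrightarrow>
     (\<exists>r::real. r > real DIM('a) \<and> (\<exists>D1 D2.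
        Lp_on r (ball 0 R) u \<and>
        (\<forall>i\<in>Basis. Lp_on r (ball 0 R) (D1 i) \<and> weak_partial (ball 0 R) i u (D1 i)) \<and>
        (\<forall>i\<in>Basis. \<forall>j\<in>Basis. Lp_on r (ball 0 R) (D2 i j) \<and>
                              weak_partial (ball 0 R) j (D1 i) (D2 i j)) \<and>
        (AE x in lebesgue_on (ball 0 R). - (\<Sum>i\<in>Basis. D2 i i x) = a x * u x powr q))) \<and>
     (\<forall>x\<in>sphere 0 R. ((\<lambda>t. u (t *\<^sub>R x)) has_real_derivative 0) (at_left 1))"

definition Pcirc :: "real \<Rightarrow> ('a::euclidean_space \<Rightarrow> real) set" where
  "Pcirc R = {u. continuous_on (cball 0 R) u \<and>
     (\<exists>G::'a \<Rightarrow> 'a. continuous_on (cball 0 R) G \<and>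
        (\<forall>x\<in>ball 0 R. (u has_derivative (\<lambda>h. G x \<bullet> h)) (at x))) \<and>
     (\<forall>x\<in>cball 0 R. 0 < u x)}"

end

theory Submission
  imports Defs
begin

text \<open>
  Existence. Write \<open>a x = \<alpha> (norm x)\<close> with a bounded Borel profile \<open>\<alpha>\<close> and shoot from \<open>u(0) = c\<close> in
  \<open>(r\<^sup>N\<^sup>-\<^sup>1 u')' = - r\<^sup>N\<^sup>-\<^sup>1 \<alpha> u\<^sup>q\<close>. For large \<open>c\<close> the solution is almost constant, so \<open>u'(R) > 0\<close> because
  \<open>\<integral>a < 0\<close>. Decrease \<open>c\<close>. As long as \<open>u > 0\<close> and \<open>u'(R) \<ge> 0\<close>, the minimum of \<open>u\<close> lies in \<open>{0..R0}\<close>, and it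
  cannot be small: comparing \<open>u\<^sup>1\<^sup>-\<^sup>q\<close> after the minimum with a multiple of \<open>(r + s)\<^sup>2\<close>, a supersolution for
  the weight \<open>- M\<close>, bounds \<open>u' / u\<^sup>q\<close> at \<open>R0\<close> by a quantity which, for small \<open>s\<close>, the positive mass of \<open>a\<close>
  in the annulus exceeds, and this forces \<open>u'(R) < 0\<close>. Hence \<open>u'(R)\<close> reaches \<open>0\<close> before positivity is lost.

  Uniqueness. For two solutions \<open>u, v\<close> put \<open>z = u\<^sup>1\<^sup>-\<^sup>q - v\<^sup>1\<^sup>-\<^sup>q\<close> and test the two equations with
  \<open>(z\<^sup>+)\<^sup>m / u\<^sup>q\<close> and \<open>(z\<^sup>+)\<^sup>m / v\<^sup>q\<close>. The right-hand sides agree, and convexity of \<open>\<bar>A\<bar>\<^sup>2 / t\<close> shows that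
  \<open>z\<^sup>+\<close> is constant; a positive constant would make \<open>v\<close> constant, contradicting \<open>\<integral>a < 0\<close>.
\<close>

subsection \<open>The radial initial value problem\<close>

text \<open>The threshold constant is the one for which the comparison function is exact. Put B = M
  (1 - q) / (2 q + N (1 - q)). If u^(1-q) = (1-q) B (r + s)^2 / 2, then u' = B (r + s) u^q and the
  radial Laplacian of u is at least B (N + 2 q / (1 - q)) u^q = M u^q, with equality for s = 0. The
  case s = 0 starts from the value 0 and reaches R0 with u' / u^q = B R0; the strict inequality in
  the hypothesis leaves room for some s > 0, hence for a positive lower bound on u. The obstacle to
  shooting is that t^q is not Lipschitz at 0. The lower bound is therefore proved first, for
  positive profiles; the problem is then truncated strictly below that bound, which makes the
  shooting map Lipschitz and changes nothing at the critical initial value. The weight is only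
  bounded and measurable: fluxes are handled as integrals, second derivatives weakly, and the
  boundary condition, a radial limit, enters the weak formulation through cutoffs. Uniqueness is
  proved against all solutions in the class, radial or not.\<close>

locale radial_weight =
  fixes N :: nat and R K :: real and \<alpha> :: "real \<Rightarrow> real"
  assumes N_pos: "1 \<le> N" and R_pos: "0 < R"
    and weight_borel [measurable]: "\<alpha> \<in> borel_measurable borel"
    and weight_bound: "\<And>s. \<bar>\<alpha> s\<bar> \<le> K"
begin

text \<open>For a solution with \<open>g = u powr q\<close> this is - t^(N-1) u'(t). With this sign,
  \<open>flux g R \<le> 0\<close> means u'(R) >= 0.\<close>

definition flux :: "(real \<Rightarrow> real) \<Rightarrow> real \<Rightarrow> real" where
  "flux g t = integral {0..t} (\<lambda>s. s ^ (N - 1) * \<alpha> s * g s)"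

text \<open>This is - u', not u'. The quotient has the value 0 at t = 0, which is the correct limit
  for continuous \<open>g\<close>, so u'(0) = 0 is built in.\<close>

definition slope :: "(real \<Rightarrow> real) \<Rightarrow> real \<Rightarrow> real" where
  "slope g t = flux g t / t ^ (N - 1)"

lemma K_nonneg: "0 \<le> K"
  using weight_bound[of 0] by simp

lemma flux_absolutely_integrable:
  assumes "continuous_on {a..b} g"
  shows "(\<lambda>s. s ^ (N - 1) * \<alpha> s * g s) absolutely_integrable_on {a..b}"
proof (rule measurable_bounded_by_integrable_imp_absolutely_integrable)
  have 1: "\<alpha> \<in> borel_measurable (lebesgue_on {a..b})"
    by (intro measurable_restrict_space1 measurable_completion) simp
  have 2: "g \<in> borel_measurable (lebesgue_on {a..b})"
    using assms by (intro continuous_imp_measurable_on_sets_lebesgue) auto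
  have 3: "(\<lambda>s::real. s ^ (N - 1)) \<in> borel_measurable (lebesgue_on {a..b})"
    by (intro continuous_imp_measurable_on_sets_lebesgue continuous_intros) auto
  show "(\<lambda>s. s ^ (N - 1) * \<alpha> s * g s) \<in> borel_measurable (lebesgue_on {a..b})"
    using 1 2 3 by measurable
  show "(\<lambda>s. \<bar>s\<bar> ^ (N - 1) * K * \<bar>g s\<bar>) integrable_on {a..b}"
    using assms by (intro integrable_continuous_interval continuous_intros)
  show "norm (s ^ (N - 1) * \<alpha> s * g s) \<le> \<bar>s\<bar> ^ (N - 1) * K * \<bar>g s\<bar>" if "s \<in> {a..b}" for s
    unfolding real_norm_def abs_mult power_abs
    by (intro mult_mono weight_bound) (use K_nonneg in auto)
qed auto

lemma flux_integrable:
  assumes "continuous_on {a..b} g"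
  shows "(\<lambda>s. s ^ (N - 1) * \<alpha> s * g s) integrable_on {a..b}"
  using flux_absolutely_integrable[OF assms] by (rule set_lebesgue_integral_eq_integral(1))

lemma flux_diff:
  assumes "continuous_on {0..b} g" "0 \<le> a" "a \<le> b"
  shows "flux g b - flux g a = integral {a..b} (\<lambda>s. s ^ (N - 1) * \<alpha> s * g s)"
  unfolding flux_def
  using Henstock_Kurzweil_Integration.integral_combine[OF assms(2,3) flux_integrable[OF assms(1)]] by simp

lemma slope_0 [simp]: "slope g 0 = 0"
  by (simp add: slope_def flux_def)

lemma flux_eq: "0 \<le> t \<Longrightarrow> flux g t = t ^ (N - 1) * slope g t"
  by (cases "t = 0") (auto simp: slope_def flux_def)

lemma flux_bound:
  assumes "continuous_on {0..t} g" "0 \<le> t" "\<And>s. s \<in> {0..t} \<Longrightarrow> \<bar>g s\<bar> \<le> B"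
  shows "\<bar>flux g t\<bar> \<le> K * B * t * t ^ (N - 1)"
proof -
  have B: "0 \<le> B" using assms(3)[of 0] assms(2) by fastforce
  have "norm (integral {0..t} (\<lambda>s. s ^ (N - 1) * \<alpha> s * g s)) \<le> integral {0..t} (\<lambda>s. t ^ (N - 1) * K * B)"
  proof (rule Henstock_Kurzweil_Integration.integral_norm_bound_integral[OF flux_integrable[OF assms(1)]])
    fix s assume s: "s \<in> {0..t}"
    show "norm (s ^ (N - 1) * \<alpha> s * g s) \<le> t ^ (N - 1) * K * B"
      unfolding real_norm_def abs_mult
      by (intro mult_mono weight_bound assms(3) s) (use s B K_nonneg in \<open>auto intro: power_mono\<close>)
  qed auto
  then show ?thesis using assms(2) by (simp add: flux_def mult_ac)
qed

text \<open>The factor \<open>t\<close> survives the division because s^(N-1) is at most t^(N-1) on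
  \<open>{0..t}\<close>. It yields continuity of the slope at the origin, where the quotient is
  singular.\<close>

lemma slope_bound:
  assumes "continuous_on {0..t} g" "0 \<le> t" "\<And>s. s \<in> {0..t} \<Longrightarrow> \<bar>g s\<bar> \<le> B"
  shows "\<bar>slope g t\<bar> \<le> K * B * t"
proof (cases "t = 0")
  case False
  with assms(2) have t: "t > 0" by simp
  then show ?thesis using flux_bound[OF assms]
    by (simp add: slope_def abs_mult divide_le_eq)
qed simp

lemma slope_minus:
  assumes "continuous_on {0..t} g" "continuous_on {0..t} h"
  shows "slope g t - slope h t = slope (\<lambda>s. g s - h s) t"
proof -
  have "flux (\<lambda>s. g s - h s) t = integral {0..t} (\<lambda>s. s ^ (N - 1) * \<alpha> s * g s - s ^ (N - 1) * \<alpha> s * h s)"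
    by (simp add: flux_def algebra_simps)
  also have "\<dots> = flux g t - flux h t"
    unfolding flux_def by (rule integral_diff[OF flux_integrable[OF assms(1)] flux_integrable[OF assms(2)]])
  finally show ?thesis by (simp add: slope_def diff_divide_distrib)
qed

lemma flux_continuous_on:
  assumes "continuous_on {0..b} g"
  shows "continuous_on {0..b} (flux g)"
  unfolding flux_def
  by (rule indefinite_integral_continuous_1[OF flux_integrable[OF assms]])

lemma slope_continuous_on:
  assumes g: "continuous_on {0..b} g"
  shows "continuous_on {0..b} (slope g)"
  unfolding continuous_on_eq_continuous_within
proof
  fix t assume t: "t \<in> {0..b}"
  show "continuous (at t within {0..b}) (slope g)"
  proof (cases "t = 0")
    case False
    have "continuous (at t within {0..b}) (\<lambda>t. flux g t / t ^ (N - 1))"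
      using flux_continuous_on[OF g] t False
      by (intro continuous_intros) (auto simp: continuous_on_eq_continuous_within)
    then show ?thesis by (simp add: slope_def[abs_def])
  next
    case True
    obtain B where B: "\<And>s. s \<in> {0..b} \<Longrightarrow> \<bar>g s\<bar> \<le> B"
      using compact_imp_bounded[OF compact_continuous_image[OF g]]
      by (metis bounded_real compact_Icc imageI)
    have "((slope g) \<longlongrightarrow> 0) (at 0 within {0..b})"
    proof (rule Lim_null_comparison)
      show "\<forall>\<^sub>F s in at 0 within {0..b}. norm (slope g s) \<le> K * B * s"
        unfolding eventually_at_filter real_norm_def
        by (rule always_eventually) (auto intro!: slope_bound B intro: continuous_on_subset[OF g])
      show "((\<lambda>s. K * B * s) \<longlongrightarrow> 0) (at 0 within {0..b})"
        by (auto intro!: tendsto_eq_intros)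
    qed
    then show ?thesis using True by (simp add: continuous_within)
  qed
qed

lemma flux_mono_pos:
  assumes g: "continuous_on {0..b} g" and ab: "0 \<le> a" "a \<le> b"
    and h: "\<And>s. s \<in> {a..b} \<Longrightarrow> 0 \<le> \<alpha> s * g s"
  shows "flux g a \<le> flux g b"
proof -
  have "0 \<le> integral {a..b} (\<lambda>s. s ^ (N - 1) * \<alpha> s * g s)"
    using h ab by (intro integral_nonneg flux_integrable continuous_on_subset[OF g])
       (auto simp: mult.assoc intro!: mult_nonneg_nonneg)
  then show ?thesis using flux_diff[OF g ab] by simp
qed

text \<open>The exponential weight turns integration into division by \<open>l\<close>: the integral
  of exp (l t) is at most exp (l r) / l. Hence the Picard operator contracts in the norm weighted by
  exp (- l r) once \<open>l\<close> is large, on all of \<open>{0..R}\<close> and not just on a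
  short interval.\<close>

lemma picard_estimate:
  assumes g: "continuous_on {0..R} g" and h: "continuous_on {0..R} h" and "0 < l" "0 \<le> D"
    and d: "\<And>s. s \<in> {0..R} \<Longrightarrow> \<bar>g s - h s\<bar> \<le> D * exp (l * s)" and r: "r \<in> {0..R}"
  shows "\<bar>integral {0..r} (slope g) - integral {0..r} (slope h)\<bar> \<le> K * R * D / l * exp (l * r)"
proof -
  have cg: "continuous_on {0..r} g" and ch: "continuous_on {0..r} h"
    using g h r by (auto intro: continuous_on_subset)
  have b: "\<bar>slope g t - slope h t\<bar> \<le> K * R * D * exp (l * t)" if t: "t \<in> {0..r}" for t
  proof -
    have c: "continuous_on {0..t} g" "continuous_on {0..t} h"
      using t r g h by (auto intro: continuous_on_subset)
    have "\<bar>slope (\<lambda>s. g s - h s) t\<bar> \<le> K * (D * exp (l * t)) * t"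
    proof (rule slope_bound)
      fix s assume s: "s \<in> {0..t}"
      have "\<bar>g s - h s\<bar> \<le> D * exp (l * s)" using d s t r by auto
      also have "\<dots> \<le> D * exp (l * t)"
        using s assms by (intro mult_left_mono) auto
      finally show "\<bar>g s - h s\<bar> \<le> D * exp (l * t)" .
    qed (use c t in \<open>auto intro!: continuous_intros\<close>)
    also have "\<dots> \<le> K * (D * exp (l * t)) * R"
      using t r assms K_nonneg by (intro mult_left_mono) auto
    finally show ?thesis by (simp add: slope_minus[OF c] mult_ac)
  qed
  have hi: "((\<lambda>t. K * R * D * exp (l * t)) has_integral
      (K * R * D / l * exp (l * r) - K * R * D / l * exp (l * 0))) {0..r}"
  proof (rule fundamental_theorem_of_calculus)
    show "((\<lambda>t. K * R * D / l * exp (l * t)) has_vector_derivative K * R * D * exp (l * x)) (at x within {0..r})" for x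
      unfolding has_real_derivative_iff_has_vector_derivative[symmetric]
      using \<open>0 < l\<close> by (auto intro!: derivative_eq_intros)
  qed (use r in auto)
  have ci: "slope g integrable_on {0..r}" "slope h integrable_on {0..r}"
    by (auto intro!: integrable_continuous_interval slope_continuous_on cg ch)
  have "norm (integral {0..r} (\<lambda>t. slope g t - slope h t)) \<le> integral {0..r} (\<lambda>t. K * R * D * exp (l * t))"
    by (rule Henstock_Kurzweil_Integration.integral_norm_bound_integral)
       (use ci hi b in \<open>auto intro!: integrable_diff\<close>)
  also have "\<dots> \<le> K * R * D / l * exp (l * r)"
    using integral_unique[OF hi] K_nonneg R_pos assms by simp
  finally show ?thesis by (simp add: integral_diff[OF ci])
qed

text \<open>A fixed point of the Picard operator exists for every initial value \<open>c\<close>.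
  The contraction estimate, applied with two different values of \<open>c\<close>, also yields the
  Lipschitz dependence on which the shooting argument rests.\<close>

theorem initial_value_problem:
  assumes L: "0 \<le> L" and lip: "\<And>x y. \<bar>f x - f y\<bar> \<le> L * \<bar>x - y\<bar>"
  obtains u :: "real \<Rightarrow> real \<Rightarrow> real" and C where
    "0 < C"
    "\<And>c. continuous_on {0..R} (u c)"
    "\<And>c r. r \<in> {0..R} \<Longrightarrow> u c r = c - integral {0..r} (slope (\<lambda>s. f (u c s)))"
    "\<And>c c' r. r \<in> {0..R} \<Longrightarrow> \<bar>u c r - u c' r\<bar> \<le> C * \<bar>c - c'\<bar>"
proof -
  have contf: "continuous_on S f" for S
  proof (rule lipschitz_on_continuous_on)
    show "L-lipschitz_on S f" using L lip by (intro lipschitz_onI) (auto simp: dist_real_def)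
  qed
  \<comment> \<open>This makes the contraction factor K R L / l at most 1/2; the summand 1 keeps
    \<open>l\<close> positive when K or L is 0.\<close>
  define l where "l = 2 * K * R * L + 1"
  have l: "0 < l" "1 \<le> l" using K_nonneg R_pos L by (auto simp: l_def intro!: add_nonneg_pos)
  \<comment> \<open>The complete space used below consists of bounded continuous functions on the
    whole line; functions on \<open>{0..R}\<close> are placed in it by composing with this
    clamp.\<close>
  define \<rho> where "\<rho> x = max 0 (min R x)" for x :: real
  have rho: "\<rho> x \<in> {0..R}" for x using R_pos by (auto simp: \<rho>_def)
  have rho_id: "\<rho> x = x" if "x \<in> {0..R}" for x using that by (auto simp: \<rho>_def)
  have rho_cont: "continuous_on UNIV \<rho>" unfolding \<rho>_def by (intro continuous_intros)
  \<comment> \<open>The unknown is v = exp (- l r) u, for which the weighted norm becomes the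
    supremum norm. \<open>G v\<close> is f(u), and \<open>E\<close> is the Picard operator written
    for v.\<close>
  define G where "G v = (\<lambda>s. f (exp (l * s) * v s))" for v :: "real \<Rightarrow> real"
  define E where "E c v r = exp (- l * r) * (c - integral {0..r} (slope (G v)))" for c r and v :: "real \<Rightarrow> real"
  have contG: "continuous_on S (G v)" if "continuous_on S v" for v S
    unfolding G_def by (intro continuous_on_compose2[OF contf[of UNIV]] continuous_intros that) auto
  have E_cont: "continuous_on {0..R} (E c v)" if "continuous_on {0..R} v" for c v
    unfolding E_def
    by (intro continuous_intros indefinite_integral_continuous_1 integrable_continuous_interval
        slope_continuous_on contG that)
  have E_bcont: "(\<lambda>x. E c v (\<rho> x)) \<in> bcontfun" if v: "continuous_on {0..R} v" for c v
    unfolding bcontfun_def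
  proof safe
    show "continuous_on UNIV (\<lambda>x. E c v (\<rho> x))"
      by (rule continuous_on_compose2[OF E_cont[OF v] rho_cont]) (use rho in auto)
    have "bounded (E c v ` {0..R})"
      by (intro compact_imp_bounded compact_continuous_image E_cont[OF v]) auto
    then show "bounded (range (\<lambda>x. E c v (\<rho> x)))"
      by (rule bounded_subset) (use rho in auto)
  qed
  have E_diff: "\<bar>E c v r - E c' w r\<bar> \<le> \<bar>c - c'\<bar> + D / 2"
    if v: "continuous_on {0..R} v" and w: "continuous_on {0..R} w" and "0 \<le> D"
      and vw: "\<And>s. s \<in> {0..R} \<Longrightarrow> \<bar>v s - w s\<bar> \<le> D" and r: "r \<in> {0..R}" for c c' v w D r
  proof -
    have "\<bar>integral {0..r} (slope (G v)) - integral {0..r} (slope (G w))\<bar> \<le> K * R * (L * D) / l * exp (l * r)"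
    proof (rule picard_estimate[OF contG[OF v] contG[OF w] l(1) _ _ r])
      fix s assume s: "s \<in> {0..R}"
      have "\<bar>G v s - G w s\<bar> \<le> L * \<bar>exp (l * s) * v s - exp (l * s) * w s\<bar>"
        unfolding G_def by (rule lip)
      also have "\<dots> = L * (exp (l * s) * \<bar>v s - w s\<bar>)"
        by (simp add: abs_mult right_diff_distrib[symmetric])
      also have "\<dots> \<le> L * (exp (l * s) * D)"
        using vw[OF s] L by (intro mult_left_mono) auto
      finally show "\<bar>G v s - G w s\<bar> \<le> L * D * exp (l * s)" by (simp add: mult_ac)
    qed (use L \<open>0 \<le> D\<close> in auto)
    moreover have "K * R * (L * D) / l \<le> D / 2"
      using \<open>0 \<le> D\<close> l by (simp add: l_def field_simps)
    ultimately have *: "\<bar>integral {0..r} (slope (G v)) - integral {0..r} (slope (G w))\<bar> \<le> D / 2 * exp (l * r)"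
      by (smt (verit) exp_ge_zero mult_right_mono)
    have "E c v r - E c' w r = exp (- l * r) * ((c - c') - (integral {0..r} (slope (G v)) - integral {0..r} (slope (G w))))"
      by (simp add: E_def algebra_simps)
    then have "\<bar>E c v r - E c' w r\<bar> = exp (- l * r) * \<bar>(c - c') - (integral {0..r} (slope (G v)) - integral {0..r} (slope (G w)))\<bar>"
      by (simp add: abs_mult)
    also have "\<dots> \<le> exp (- l * r) * (\<bar>c - c'\<bar> + D / 2 * exp (l * r))"
      using * by (intro mult_left_mono order_trans[OF abs_triangle_ineq4]) auto
    also have "\<dots> = exp (- l * r) * \<bar>c - c'\<bar> + D / 2"
      by (simp add: algebra_simps exp_minus)
    also have "\<dots> \<le> 1 * \<bar>c - c'\<bar> + D / 2"
      using l r by (intro add_mono mult_right_mono) auto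
    finally show ?thesis by simp
  qed
  define T where "T c v = Bcontfun (\<lambda>x. E c (apply_bcontfun v) (\<rho> x))" for c and v :: "real \<Rightarrow>\<^sub>C real"
  have T: "apply_bcontfun (T c v) x = E c (apply_bcontfun v) (\<rho> x)" for c v x
    unfolding T_def by (subst Bcontfun_inverse[OF E_bcont]) auto
  have TT: "dist (T c v) (T c' w) \<le> \<bar>c - c'\<bar> + dist v w / 2" for c c' v w
  proof (rule dist_bound)
    fix x
    show "dist (T c v x) (T c' w x) \<le> \<bar>c - c'\<bar> + dist v w / 2"
      unfolding T dist_real_def
      by (rule E_diff) (use rho dist_bounded[of v _ w] in \<open>auto simp: dist_real_def\<close>)
  qed
  have "\<exists>!v. T c v = v" for c
    using TT[of c _ c] by (intro banach_fix_type[of "1/2"]) auto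
  then have "\<exists>v. T c v = v" for c by blast
  then obtain V where V: "\<And>c. T c (V c) = V c" by metis
  \<comment> \<open>The distance of two fixed points is at most |c - c'| plus half of
    itself.\<close>
  have Vdist: "dist (V c) (V c') \<le> 2 * \<bar>c - c'\<bar>" for c c'
    using TT[of c "V c" c' "V c'"] unfolding V by simp
  define u where "u c r = exp (l * r) * V c r" for c r
  show thesis
  proof (rule that[of "2 * exp (l * R)" u])
    show "continuous_on {0..R} (u c)" for c
      unfolding u_def by (intro continuous_intros) auto
    show "u c r = c - integral {0..r} (slope (\<lambda>s. f (u c s)))" if r: "r \<in> {0..R}" for c r
    proof -
      have "V c r = E c (V c) r" using T[of c "V c" r] unfolding V rho_id[OF r] .
      then have "u c r = exp (l * r) * E c (V c) r" by (simp add: u_def)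
      also have "\<dots> = c - integral {0..r} (slope (G (V c)))"
        by (simp add: E_def exp_minus)
      finally show ?thesis by (simp add: G_def u_def)
    qed
    show "\<bar>u c r - u c' r\<bar> \<le> 2 * exp (l * R) * \<bar>c - c'\<bar>" if r: "r \<in> {0..R}" for c c' r
    proof -
      have "\<bar>u c r - u c' r\<bar> = exp (l * r) * \<bar>V c r - V c' r\<bar>"
        by (simp add: u_def abs_mult right_diff_distrib[symmetric])
      also have "\<dots> \<le> exp (l * R) * (2 * \<bar>c - c'\<bar>)"
        using r l order_trans[OF dist_bounded[of "V c" r "V c'"] Vdist]
        by (intro mult_mono) (auto simp: dist_real_def)
      finally show ?thesis by simp
    qed
  qed auto
qed

end

subsection \<open>A priori lower bound\<close>

text \<open>A continuity argument for two coupled inequalities. While X >= 0, the quantity Y is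
  strictly positive, and the strictness lets Y >= 0 persist a little beyond the first time X turns
  negative; there assumption \<open>ii\<close> prevents X from dropping below its last nonnegative
  value.\<close>

lemma barrier_continuation:
  fixes X Y :: "real \<Rightarrow> real"
  assumes cX: "continuous_on {a..b} X" and cY: "continuous_on {a..b} Y" and Xa: "0 \<le> X a"
    and i: "\<And>t. t \<in> {a..b} \<Longrightarrow> (\<And>r. r \<in> {a..t} \<Longrightarrow> 0 \<le> X r) \<Longrightarrow> 0 < Y t"
    and ii: "\<And>t1 t. a \<le> t1 \<Longrightarrow> t1 \<le> t \<Longrightarrow> t \<le> b \<Longrightarrow>
       (\<And>r. t1 < r \<Longrightarrow> r \<le> t \<Longrightarrow> X r < 0 \<and> 0 \<le> Y r) \<Longrightarrow> X t1 \<le> X t"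
    and t: "t \<in> {a..b}"
  shows "0 \<le> X t"
proof (rule ccontr)
  assume neg: "\<not> 0 \<le> X t"
  define S where "S = {r \<in> {a..b}. X r < 0}"
  have tS: "t \<in> S" using neg t by (auto simp: S_def)
  have bdd: "bdd_below S" by (auto simp: S_def bdd_below_def)
  define t0 where "t0 = Inf S"
  have t0: "a \<le> t0" "t0 \<le> t"
    unfolding t0_def using tS bdd by (auto simp: S_def intro!: cInf_greatest cInf_lower)
  have before: "0 \<le> X r" if "a \<le> r" "r < t0" for r
  proof (rule ccontr)
    assume "\<not> 0 \<le> X r"
    then have "r \<in> S" using that t0 t by (auto simp: S_def)
    then have "t0 \<le> r" unfolding t0_def by (rule cInf_lower[OF _ bdd])
    with that show False by simp
  qed
  have Xt0: "0 \<le> X t0"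
  proof (rule ccontr)
    assume n: "\<not> 0 \<le> X t0"
    then have "a < t0" using Xa t0 by (cases "a = t0") auto
    obtain e where e: "e > 0" "\<And>r. r \<in> {a..b} \<Longrightarrow> dist r t0 < e \<Longrightarrow> dist (X r) (X t0) < - X t0"
      using cX[unfolded continuous_on_iff, rule_format, of t0 "- X t0"] n t0 t by auto
    define r where "r = max a (t0 - e / 2)"
    have "dist (X r) (X t0) < - X t0"
      by (rule e) (use t0 t e \<open>a < t0\<close> in \<open>auto simp: r_def dist_real_def max_def\<close>)
    then have "X r < 0" by (auto simp: dist_real_def)
    moreover have "0 \<le> X r" by (rule before) (use e \<open>a < t0\<close> in \<open>auto simp: r_def\<close>)
    ultimately show False by simp
  qed
  have Yt0: "0 < Y t0"
    by (rule i) (use t0 t before Xt0 in \<open>auto simp: order_le_less\<close>)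
  obtain e where e: "e > 0" "\<And>r. r \<in> {a..b} \<Longrightarrow> dist r t0 < e \<Longrightarrow> dist (Y r) (Y t0) < Y t0"
    using cY[unfolded continuous_on_iff, rule_format, of t0 "Y t0"] Yt0 t0 t by auto
  \<comment> \<open>A time with X < 0 so close to \<open>t0\<close> that Y is still positive all the
    way up to it.\<close>
  obtain t2 where t2: "t2 \<in> S" "t2 < t0 + e"
    using cInf_lessD[of S "t0 + e"] tS e unfolding t0_def by auto
  have "t0 \<le> t2" unfolding t0_def by (rule cInf_lower[OF t2(1) bdd])
  \<comment> \<open>The largest element \<open>t1\<close> of \<open>P\<close> is the last time up to
    \<open>t2\<close> with X >= 0, so X is negative on all of (t1, t2] and \<open>ii\<close> applies
    there.\<close>
  define P where "P = {t0..t2} \<inter> X -` {0..}"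
  have "closed P"
    unfolding P_def using t0 t2
    by (intro continuous_closed_preimage continuous_on_subset[OF cX]) (auto simp: S_def)
  then have "compact P"
    by (auto simp: compact_eq_bounded_closed P_def intro: bounded_subset[of "{t0..t2}"])
  moreover have "t0 \<in> P" using Xt0 \<open>t0 \<le> t2\<close> by (auto simp: P_def)
  ultimately obtain t1 where t1: "t1 \<in> P" "\<And>r. r \<in> P \<Longrightarrow> r \<le> t1"
    using compact_attains_sup[of P] by auto
  have "X t1 \<le> X t2"
  proof (rule ii)
    fix r assume r: "t1 < r" "r \<le> t2"
    have r': "r \<in> {t0..t2}" "r \<in> {a..b}" using r t1 t0 t2 by (auto simp: P_def S_def)
    have "r \<notin> P" using t1(2)[of r] r by auto
    then have "X r < 0" using r' by (auto simp: P_def)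
    moreover have "dist (Y r) (Y t0) < Y t0"
      by (rule e) (use r' t2 in \<open>auto simp: dist_real_def\<close>)
    ultimately show "X r < 0 \<and> 0 \<le> Y r" by (auto simp: dist_real_def)
  qed (use t1 t0 t2 in \<open>auto simp: P_def S_def\<close>)
  then show False using t1 t2 by (auto simp: P_def S_def)
qed

text \<open>\<open>outer_mass\<close> is the hypothesis of the theorem divided by the surface area
  of the sphere, with \<open>M\<close> in place of the norm of the negative part. \<open>M\<close>
  can be taken slightly above that norm, since the inequality is strict.\<close>

locale indefinite_weight = radial_weight +
  fixes q R0 M :: real
  assumes q: "0 < q" "q < 1" and R0: "0 < R0" "R0 < R" and M_pos: "0 < M"
    and weight_lower: "\<And>s. s \<in> {0..R0} \<Longrightarrow> - M \<le> \<alpha> s"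
    and weight_outer: "\<And>s. s \<in> {R0..R} \<Longrightarrow> 0 \<le> \<alpha> s"
    and mean_neg: "integral {0..R} (\<lambda>s. s ^ (N - 1) * \<alpha> s) < 0"
    and outer_mass: "(1 - q) / (2 * q + real N * (1 - q)) * M * R0 ^ N
        < integral {R0..R} (\<lambda>s. s ^ (N - 1) * \<alpha> s)"
begin

text \<open>The derivative is taken within \<open>{0..R}\<close>, hence one-sided at the end points.
  The radial equation and u'(0) = 0 are both contained in the definition of
  \<open>slope\<close>.\<close>

definition positive_profile :: "(real \<Rightarrow> real) \<Rightarrow> bool" where
  "positive_profile u \<longleftrightarrow> (\<forall>r\<in>{0..R}. 0 < u r \<and>
     (u has_real_derivative - slope (\<lambda>s. u s powr q) r) (at r within {0..R}))"

text \<open>The function \<open>(r + s)\<^sup>2\<close> is, up to a constant, a supersolution of the equation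
  satisfied by \<open>u powr (1 - q)\<close> on \<open>{0..R0}\<close> with weight \<open>- M\<close>; comparison with it bounds
  \<open>u' / u powr q\<close> at \<open>R0\<close>.\<close>

lemma slope_comparison:
  fixes u :: "real \<Rightarrow> real"
  defines "B \<equiv> (1 - q) / (2 * q + real N * (1 - q)) * M"
  assumes u: "positive_profile u" and "0 < s" and \<rho>: "\<rho> \<in> {0..R0}"
    and start: "slope (\<lambda>s. u s powr q) \<rho> \<ge> 0" "u \<rho> powr (1 - q) < (1 - q) * B / 2 * s\<^sup>2"
  shows "0 \<le> B * (R0 + s) * R0 ^ (N - 1) * u R0 powr q + flux (\<lambda>s. u s powr q) R0"
proof -
  define g where "g = (\<lambda>s. u s powr q)"
  define k where "k = N - 1"
  have B: "0 < B" unfolding B_def using q M_pos by (intro mult_pos_pos divide_pos_pos add_pos_nonneg) auto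
  \<comment> \<open>N + 2 q / (1 - q) is the ratio of the radial Laplacian of u to B u^q when
    u^(1-q) = (1-q) B r^2 / 2. \<open>M\<close> is split along this sum at the end of the barrier
    argument.\<close>
  have M_eq: "M = B * (real N + 2 * q / (1 - q))"
  proof -
    have "2 * q + real N * (1 - q) > 0" using q by (intro add_pos_nonneg) auto
    moreover have "real N + 2 * q / (1 - q) = (2 * q + real N * (1 - q)) / (1 - q)"
      using q by (simp add: field_simps)
    ultimately show ?thesis unfolding B_def using q by simp
  qed
  have pos: "0 < u r" if "r \<in> {0..R}" for r using u that by (auto simp: positive_profile_def)
  have du: "(u has_real_derivative - slope g r) (at r)" if "0 < r" "r < R" for r
    using u that unfolding positive_profile_def g_def
    by (auto simp: at_within_Icc_at dest: bspec[of _ _ r])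
  have cu: "continuous_on {0..R} u"
    using u unfolding positive_profile_def by (intro DERIV_continuous_on) auto
  have cg: "continuous_on {0..R} g"
    unfolding g_def using pos by (intro continuous_intros cu) (auto simp: less_imp_neq[symmetric])
  have fl: "flux g r = r ^ k * slope g r" if "0 \<le> r" for r
    using flux_eq[OF that] by (simp add: k_def)
  \<comment> \<open>For r > 0, X >= 0 says u' <= B (r + s) u^q, and Y > 0 says that u^(1-q) lies
    below the parabola whose derivative is (1-q) B (r + s). The first makes Y grow; Y >= 0 in turn
    drives X upward whenever X is negative.\<close>
  define X where "X r = B * (r + s) * r ^ k * u r powr q + flux g r" for r
  define Y where "Y r = (1 - q) * B / 2 * (r + s)\<^sup>2 - u r powr (1 - q)" for r
  have sub: "{\<rho>..R0} \<subseteq> {0..R}" using \<rho> R0 by auto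
  have ne: "u r \<noteq> 0" if "r \<in> {0..R}" for r using pos[OF that] by simp
  have cX: "continuous_on {0..R} X"
    unfolding X_def by (intro continuous_intros cu flux_continuous_on cg) (auto simp: ne)
  have cY: "continuous_on {0..R} Y"
    unfolding Y_def by (intro continuous_intros cu) (auto simp: ne)
  have X_iff: "0 \<le> X r \<longleftrightarrow> - slope g r \<le> B * (r + s) * u r powr q" if "0 < r" for r
  proof -
    have "X r = r ^ k * (B * (r + s) * u r powr q + slope g r)"
      using that fl[of r] by (simp add: X_def algebra_simps)
    moreover have "0 < r ^ k" using that by simp
    ultimately show ?thesis by (simp add: zero_le_mult_iff) linarith
  qed
  have "0 \<le> X R0"
  proof (rule barrier_continuation[where a = \<rho> and b = R0 and X = X and Y = Y and t = R0])
    show "continuous_on {\<rho>..R0} X" "continuous_on {\<rho>..R0} Y"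
      using cX cY sub by (auto intro: continuous_on_subset)
    show "0 \<le> X \<rho>"
    proof -
      have "0 \<le> flux g \<rho>" using \<rho> start fl[of \<rho>] by (auto simp: g_def)
      moreover have "0 \<le> B * (\<rho> + s) * \<rho> ^ k * u \<rho> powr q" using B \<rho> \<open>0 < s\<close> by auto
      ultimately show ?thesis by (simp add: X_def)
    qed
    show "0 < Y t" if t: "t \<in> {\<rho>..R0}" and X: "\<And>r. r \<in> {\<rho>..t} \<Longrightarrow> 0 \<le> X r" for t
    proof -
      have "Y \<rho> \<le> Y t"
      proof (rule DERIV_nonneg_imp_increasing_open[where f = Y])
        fix r assume r: "\<rho> < r" "r < t"
        then have r': "0 < r" "r < R" using \<rho> t R0 by auto
        have ur: "0 < u r" using pos r' by auto
        have "(Y has_real_derivative (1 - q) * B * (r + s) - (1 - q) * u r powr (- q) * (- slope g r)) (at r)"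
          unfolding Y_def using ur du[OF r'] \<open>0 < s\<close> r'
          by (auto intro!: derivative_eq_intros simp: field_simps)
        moreover have "u r powr (- q) * (- slope g r) \<le> u r powr (- q) * (B * (r + s) * u r powr q)"
          using X[of r] r X_iff[OF r'(1)] by (intro mult_left_mono) auto
        then have "(1 - q) * (u r powr (- q) * (- slope g r)) \<le> (1 - q) * (B * (r + s))"
          using ur q by (intro mult_left_mono) (auto simp: powr_minus field_simps)
        then have "0 \<le> (1 - q) * B * (r + s) - (1 - q) * u r powr (- q) * (- slope g r)"
          by (simp add: mult.assoc)
        ultimately show "\<exists>y. (Y has_real_derivative y) (at r) \<and> 0 \<le> y" by blast
      qed (use t cY sub in \<open>auto intro: continuous_on_subset\<close>)
      moreover have "0 < Y \<rho>"
      proof -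
        have "s\<^sup>2 \<le> (\<rho> + s)\<^sup>2" using \<rho> \<open>0 < s\<close> by (intro power_mono) auto
        then have "(1 - q) * B / 2 * s\<^sup>2 \<le> (1 - q) * B / 2 * (\<rho> + s)\<^sup>2"
          using B q by (intro mult_left_mono) auto
        then show ?thesis using start by (simp add: Y_def)
      qed
      ultimately show ?thesis by simp
    qed
    show "X t1 \<le> X t" if t: "\<rho> \<le> t1" "t1 \<le> t" "t \<le> R0"
      and neg: "\<And>r. t1 < r \<Longrightarrow> r \<le> t \<Longrightarrow> X r < 0 \<and> 0 \<le> Y r" for t1 t
    proof -
      \<comment> \<open>\<open>flux g\<close> is an integral of a merely measurable function.
        Replacing \<alpha> by - M after \<open>t1\<close> bounds it from below and turns X into the
        differentiable Z, with Z t - Z t1 <= X t - X t1.\<close>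
      define J where "J r = integral {t1..r} (\<lambda>s. M * s ^ k * g s)" for r
      define Z where "Z r = B * (r + s) * r ^ k * u r powr q - J r" for r
      have sub1: "{t1..t} \<subseteq> {0..R}" using t \<rho> R0 by auto
      have cMg: "continuous_on {t1..t} (\<lambda>s. M * s ^ k * g s)"
        by (intro continuous_intros continuous_on_subset[OF cg sub1])
      have "Z t1 \<le> Z t"
      proof (rule DERIV_nonneg_imp_increasing_open[where f = Z, OF t(2)])
        show "continuous_on {t1..t} Z"
          unfolding Z_def J_def using sub1
          by (intro continuous_intros indefinite_integral_continuous_1 integrable_continuous_interval
              cMg continuous_on_subset[OF cu sub1]) (auto simp: ne)
        fix r assume r: "t1 < r" "r < t"
        then have r': "0 < r" "r < R" using \<rho> t R0 by auto
        have ur: "0 < u r" using pos r' by auto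
        define v where "v = - slope g r"
        have dI: "(J has_real_derivative M * r ^ k * g r) (at r)"
          using integral_has_real_derivative[OF cMg, of r] r unfolding J_def by (simp add: at_within_Icc_at)
        have dZ: "(Z has_real_derivative B * r ^ k * u r powr q + B * (r + s) * (real k * r ^ (k - 1)) * u r powr q
            + B * (r + s) * r ^ k * (q * u r powr (q - 1) * v) - M * r ^ k * g r) (at r)"
          unfolding Z_def v_def using ur
          by (auto intro!: derivative_eq_intros du[OF r'] dI simp: algebra_simps)
        have v: "v > B * (r + s) * u r powr q"
          using neg[of r] r X_iff[OF r'(1)] by (auto simp: v_def)
        have Y: "u r powr (1 - q) \<le> (1 - q) * B / 2 * (r + s)\<^sup>2"
          using neg[of r] r by (auto simp: Y_def)
        \<comment> \<open>One factor r is enlarged to r + s. Dimension one, k = 0, is separate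
          because \<open>k - 1\<close> is truncated; both sides are then 0.\<close>
        have 1: "B * (r + s) * (real k * r ^ (k - 1)) * u r powr q \<ge> B * real k * r ^ k * u r powr q"
        proof (cases k)
          case (Suc j)
          have "r * (B * real k * r ^ j * u r powr q) \<le> (r + s) * (B * real k * r ^ j * u r powr q)"
            using \<open>0 < s\<close> B r' by (intro mult_right_mono) auto
          then show ?thesis by (simp add: Suc algebra_simps)
        qed simp
        have inv: "u r powr (q - 1) * u r powr (1 - q) = 1"
          using ur by (simp flip: powr_add)
        \<comment> \<open>Both barrier conditions enter. \<open>inv\<close> inserts a factor
          u^(1-q), which Y >= 0 bounds by (1-q) B (r + s)^2 / 2; then X < 0 allows one factor B (r +
          s) u^q to be replaced by the larger v = u'.\<close>
        have "2 * q / (1 - q) * B * u r powr q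
            = 2 * q / (1 - q) * B * u r powr q * (u r powr (q - 1) * u r powr (1 - q))"
          unfolding inv by simp
        also have "\<dots> = q * u r powr (q - 1) * u r powr q * B * (2 / (1 - q) * u r powr (1 - q))"
          by (simp only: divide_inverse mult_ac)
        also have "\<dots> \<le> q * u r powr (q - 1) * u r powr q * B * (B * (r + s)\<^sup>2)"
          using Y q B by (intro mult_left_mono) (auto simp: field_simps)
        also have "\<dots> = q * u r powr (q - 1) * (B * (r + s) * (B * (r + s) * u r powr q))"
          by (simp only: power2_eq_square mult_ac)
        also have "\<dots> \<le> q * u r powr (q - 1) * (B * (r + s) * v)"
          using v B \<open>0 < s\<close> r' q by (intro mult_left_mono) auto
        finally have 2: "2 * q / (1 - q) * B * u r powr q \<le> B * (r + s) * (q * u r powr (q - 1) * v)"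
          by (simp only: mult_ac)
        have "r ^ k * (2 * q / (1 - q) * B * u r powr q) \<le> r ^ k * (B * (r + s) * (q * u r powr (q - 1) * v))"
          using r' by (intro mult_left_mono[OF 2]) auto
        \<comment> \<open>The parts 1, N - 1 and 2 q / (1 - q) of M / B match the three terms that
          come from differentiating the product.\<close>
        moreover have "M * r ^ k * g r = B * r ^ k * u r powr q + B * real k * r ^ k * u r powr q
            + r ^ k * (2 * q / (1 - q) * B * u r powr q)"
        proof -
          have "real N = 1 + real k" using N_pos by (simp add: k_def)
          then show ?thesis unfolding M_eq g_def by (simp add: distrib_left distrib_right mult_ac)
        qed
        ultimately have "0 \<le> B * r ^ k * u r powr q + B * (r + s) * (real k * r ^ (k - 1)) * u r powr q
            + B * (r + s) * r ^ k * (q * u r powr (q - 1) * v) - M * r ^ k * g r"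
          using 1 by (simp add: mult_ac)
        with dZ show "\<exists>y. (Z has_real_derivative y) (at r) \<and> 0 \<le> y" by blast
      qed
      moreover have "- integral {t1..t} (\<lambda>s. M * s ^ k * g s) \<le> flux g t - flux g t1"
      proof -
        have c: "continuous_on {0..t} g" using t \<rho> R0 by (auto intro: continuous_on_subset[OF cg])
        have "integral {t1..t} (\<lambda>s. - (M * s ^ k * g s)) \<le> integral {t1..t} (\<lambda>s. s ^ (N - 1) * \<alpha> s * g s)"
        proof (rule integral_le)
          show "(\<lambda>s. s ^ (N - 1) * \<alpha> s * g s) integrable_on {t1..t}"
            by (intro flux_integrable continuous_on_subset[OF cg sub1])
          show "(\<lambda>s. - (M * s ^ k * g s)) integrable_on {t1..t}"
            by (intro integrable_neg integrable_continuous_interval cMg)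
          fix x assume x: "x \<in> {t1..t}"
          then have "x ^ k * g x * (- M) \<le> x ^ k * g x * \<alpha> x"
            using t \<rho> by (intro mult_left_mono weight_lower) (auto simp: g_def)
          then show "- (M * x ^ k * g x) \<le> x ^ (N - 1) * \<alpha> x * g x"
            by (simp add: k_def mult_ac)
        qed
        then show ?thesis using flux_diff[OF c, of t1] t \<rho> by simp
      qed
      ultimately show ?thesis by (simp add: X_def Z_def J_def)
    qed
  qed (use \<rho> in auto)
  then show ?thesis by (simp add: X_def g_def k_def)
qed

text \<open>The bound is uniform over all positive profiles with u'(R) >= 0. If the minimum were
  below \<open>d\<close>, then u would grow so slowly after it that u' at R0 is too small to offset
  the outer mass, and the flux at R would be positive.\<close>

lemma a_priori_lower_bound:
  obtains d where "0 < d"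
    "\<And>u r. positive_profile u \<Longrightarrow> flux (\<lambda>s. u s powr q) R \<le> 0 \<Longrightarrow> r \<in> {0..R} \<Longrightarrow> d \<le> u r"
proof -
  define B where "B = (1 - q) / (2 * q + real N * (1 - q)) * M"
  define I where "I = integral {R0..R} (\<lambda>s. s ^ (N - 1) * \<alpha> s)"
  have B: "0 < B" unfolding B_def using q M_pos by (intro mult_pos_pos divide_pos_pos add_pos_nonneg) auto
  have R0N: "R0 ^ N = R0 * R0 ^ (N - 1)" using N_pos by (cases N) auto
  \<comment> \<open>Chosen so that B (R0 + s) R0^(N-1) is the midpoint of B R0^N and I.\<close>
  define s where "s = (I - B * R0 ^ N) / (2 * B * R0 ^ (N - 1))"
  have gap: "0 < I - B * R0 ^ N" using outer_mass by (simp add: B_def I_def)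
  have s: "0 < s" unfolding s_def using gap B R0 by (intro divide_pos_pos) auto
  have "B * (R0 + s) * R0 ^ (N - 1) = B * R0 ^ N + (I - B * R0 ^ N) / 2"
    using B R0 by (simp add: s_def R0N field_simps)
  then have sI: "B * (R0 + s) * R0 ^ (N - 1) < I" using gap by (simp only:) (simp add: field_simps)
  define e where "e = (1 - q) * B / 2 * s\<^sup>2"
  have e: "0 < e" using q B s by (simp add: e_def)
  \<comment> \<open>With this value, u < d at the minimum is exactly the starting condition of
    \<open>slope_comparison\<close>.\<close>
  define d where "d = e powr (1 / (1 - q))"
  show thesis
  proof (rule that)
    show "0 < d" using e by (simp add: d_def)
    fix u r assume u: "positive_profile u" and fR: "flux (\<lambda>s. u s powr q) R \<le> 0" and r: "r \<in> {0..R}"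
    define g where "g = (\<lambda>s. u s powr q)"
    have pos: "0 < u r" if "r \<in> {0..R}" for r using u that by (auto simp: positive_profile_def)
    have du: "(u has_real_derivative - slope g r) (at r within {0..R})" if "r \<in> {0..R}" for r
      using u that unfolding positive_profile_def g_def by auto
    have cu: "continuous_on {0..R} u"
      using du by (intro DERIV_continuous_on) auto
    have cg: "continuous_on {0..R} g"
      unfolding g_def using pos by (intro continuous_intros cu) (auto simp: less_imp_neq[symmetric])
    have gn: "0 \<le> g r" for r by (simp add: g_def)
    \<comment> \<open>As \<alpha> >= 0 on the annulus, the flux increases there to its value at R,
      which is at most 0; so u' >= 0 on \<open>{R0..R}\<close>.\<close>
    have incr: "u R0 \<le> u t" if t: "t \<in> {R0..R}" for t
    proof (rule DERIV_nonneg_imp_increasing_open[where f = u])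
      fix x assume x: "R0 < x" "x < t"
      have "flux g x \<le> flux g R"
        by (rule flux_mono_pos[OF cg]) (use x t R0 weight_outer gn in \<open>auto intro!: mult_nonneg_nonneg\<close>)
      then have "x ^ (N - 1) * slope g x \<le> 0" using fR x R0 flux_eq[of x g] by (simp add: g_def)
      moreover have "0 < x ^ (N - 1)" using x R0 by simp
      ultimately have "0 \<le> - slope g x" by (simp add: mult_le_0_iff)
      moreover have "(u has_real_derivative - slope g x) (at x)"
        using du[of x] x t R0 by (simp add: at_within_Icc_at)
      ultimately show "\<exists>y. (u has_real_derivative y) (at x) \<and> 0 \<le> y" by blast
    qed (use t R0 in \<open>auto intro: continuous_on_subset[OF cu]\<close>)
    obtain \<rho> where \<rho>: "\<rho> \<in> {0..R0}" "\<And>t. t \<in> {0..R0} \<Longrightarrow> u \<rho> \<le> u t"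
      using continuous_attains_inf[of "{0..R0}" u] R0 continuous_on_subset[OF cu, of "{0..R0}"] by auto
    have min: "u \<rho> \<le> u t" if "t \<in> {0..R}" for t
      using \<rho>(2)[of t] \<rho>(2)[of R0] incr[of t] that R0 by (cases "t \<le> R0") auto
    \<comment> \<open>At radius 0 this is the built-in value of \<open>slope\<close>. Elsewhere u' >
      0 at the minimum would produce smaller values just to the left.\<close>
    have start: "0 \<le> slope g \<rho>"
    proof (rule ccontr)
      assume n: "\<not> 0 \<le> slope g \<rho>"
      then have "\<rho> \<noteq> 0" by (intro notI) simp
      then have "0 < \<rho>" using \<rho> by simp
      have "(u has_real_derivative - slope g \<rho>) (at \<rho> within {0..R})" using du \<rho> R0 by auto
      then obtain h where h: "h > 0" "\<And>x. x > 0 \<Longrightarrow> \<rho> - x \<in> {0..R} \<Longrightarrow> x < h \<Longrightarrow> u (\<rho> - x) < u \<rho>"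
        using has_real_derivative_pos_inc_left[of u "- slope g \<rho>" \<rho> "{0..R}"] n by auto
      define x where "x = min (\<rho> / 2) (h / 2)"
      have "u (\<rho> - x) < u \<rho>" by (rule h) (use h \<open>0 < \<rho>\<close> \<rho> R0 in \<open>auto simp: x_def min_def\<close>)
      moreover have "u \<rho> \<le> u (\<rho> - x)" by (rule min) (use h \<open>0 < \<rho>\<close> \<rho> R0 in \<open>auto simp: x_def min_def\<close>)
      ultimately show False by simp
    qed
    have "d \<le> u \<rho>"
    proof (rule ccontr)
      assume "\<not> d \<le> u \<rho>"
      moreover have up: "0 < u \<rho>" using pos \<rho> R0 by auto
      ultimately have "u \<rho> powr (1 - q) < d powr (1 - q)" using q by (intro powr_less_mono2) auto
      also have "d powr (1 - q) = e" using e q by (simp add: d_def powr_powr)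
      finally have lt: "u \<rho> powr (1 - q) < (1 - q) * B / 2 * s\<^sup>2" by (simp add: e_def)
      have *: "0 \<le> B * (R0 + s) * R0 ^ (N - 1) * u R0 powr q + flux g R0"
        unfolding g_def B_def
        by (rule slope_comparison[OF u s \<rho>(1)]) (use start lt in \<open>auto simp: g_def B_def\<close>)
      have uR0: "0 < u R0 powr q" using pos[of R0] R0 by simp
      \<comment> \<open>On the annulus u^q >= u(R0)^q, so the outer mass adds at least u(R0)^q I to
        the flux. By the choice of \<open>s\<close> this exceeds u(R0)^q B (R0 + s) R0^(N-1), the
        most by which the flux at R0 can be negative.\<close>
      have "integral {R0..R} (\<lambda>s. u R0 powr q * (s ^ (N - 1) * \<alpha> s)) \<le> integral {R0..R} (\<lambda>s. s ^ (N - 1) * \<alpha> s * g s)"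
      proof (rule integral_le)
        show "(\<lambda>s. s ^ (N - 1) * \<alpha> s * g s) integrable_on {R0..R}"
          using R0 by (intro flux_integrable continuous_on_subset[OF cg]) auto
        show "(\<lambda>s. u R0 powr q * (s ^ (N - 1) * \<alpha> s)) integrable_on {R0..R}"
          using flux_integrable[of R0 R "\<lambda>_. 1"] by (intro integrable_on_mult_right) auto
        fix x assume x: "x \<in> {R0..R}"
        have "u R0 powr q \<le> g x" unfolding g_def
          using incr[OF x] pos[of R0] R0 q by (intro powr_mono2) auto
        then have "u R0 powr q * (x ^ (N - 1) * \<alpha> x) \<le> g x * (x ^ (N - 1) * \<alpha> x)"
          using x R0 weight_outer[OF x] by (intro mult_right_mono) auto
        then show "u R0 powr q * (x ^ (N - 1) * \<alpha> x) \<le> x ^ (N - 1) * \<alpha> x * g x" by (simp add: mult_ac)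
      qed
      also have "integral {R0..R} (\<lambda>s. u R0 powr q * (s ^ (N - 1) * \<alpha> s)) = u R0 powr q * I"
        by (simp add: I_def)
      finally have "u R0 powr q * I \<le> flux g R - flux g R0"
        using flux_diff[OF cg, of R0] R0 by simp
      moreover have "u R0 powr q * (B * (R0 + s) * R0 ^ (N - 1)) < u R0 powr q * I"
        using sI uR0 by (intro mult_strict_left_mono) auto
      ultimately have "0 < flux g R" using * by (simp add: mult_ac)
      with fR show False by (simp add: g_def)
    qed
    with min[OF r] show "d \<le> u r" by simp
  qed
qed

end

subsection \<open>Shooting\<close>

text \<open>The truncation keeps away from 0, where the derivative of t^q blows up; on [d, infinity)
  that derivative is largest at d.\<close>

lemma truncated_powr_lipschitz:
  fixes q d :: real
  assumes q: "0 < q" "q < 1" and d: "0 < d"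
  shows "\<bar>max x d powr q - max y d powr q\<bar> \<le> q * d powr (q - 1) * \<bar>x - y\<bar>"
proof -
  have *: "b powr q - a powr q \<le> q * d powr (q - 1) * (b - a)" if ab: "d \<le> a" "a < b" for a b
  proof -
    obtain z where z: "a < z" "z < b" "b powr q - a powr q = (b - a) * (q * z powr (q - 1))"
      using MVT2[of a b "\<lambda>x. x powr q" "\<lambda>x. q * x powr (q - 1)"] ab d
      by (force intro!: derivative_eq_intros)
    have "z powr (q - 1) \<le> d powr (q - 1)" using z ab d q by (intro powr_mono2') auto
    then have "(b - a) * (q * z powr (q - 1)) \<le> (b - a) * (q * d powr (q - 1))"
      using ab q by (intro mult_left_mono) auto
    with z show ?thesis by (simp add: mult_ac)
  qed
  define a where "a = max x d"
  define b where "b = max y d"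
  have L: "0 \<le> q * d powr (q - 1)" using q by simp
  have ab: "d \<le> a" "d \<le> b" "\<bar>a - b\<bar> \<le> \<bar>x - y\<bar>" by (auto simp: a_def b_def)
  have "\<bar>a powr q - b powr q\<bar> \<le> q * d powr (q - 1) * \<bar>a - b\<bar>"
  proof (cases a b rule: linorder_cases)
    case less
    moreover have "a powr q \<le> b powr q" using less ab d q by (intro powr_mono2) auto
    ultimately show ?thesis using *[of a b] ab by auto
  next
    case greater
    moreover have "b powr q \<le> a powr q" using greater ab d q by (intro powr_mono2) auto
    ultimately show ?thesis using *[of b a] ab by auto
  qed simp
  also have "\<dots> \<le> q * d powr (q - 1) * \<bar>x - y\<bar>" using L ab(3) by (rule mult_left_mono[rotated])
  finally show ?thesis by (simp add: a_def b_def)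
qed

text \<open>Applied to u / c, it carries a relative deviation of u from c over to u^q and
  c^q.\<close>

lemma abs_powr_minus_one_le:
  fixes y q :: real
  assumes "0 < y" "0 < q" "q < 1"
  shows "\<bar>y powr q - 1\<bar> \<le> \<bar>y - 1\<bar>"
proof (cases "y \<le> 1")
  case True
  then have "y powr 1 \<le> y powr q" "y powr q \<le> 1"
    using assms powr_mono'[of q 1 y] by (auto intro!: powr_le1)
  with True assms show ?thesis by auto
next
  case False
  then have "y powr q \<le> y powr 1" "1 \<le> y powr q"
    using assms powr_mono[of q 1 y] by (auto intro!: ge_one_powr_ge_zero)
  with False assms show ?thesis by auto
qed

text \<open>A single increment that is small against both Lipschitz constants of the shooting
  argument. The summand 1 keeps the second inequality strict when H = 0.\<close>

lemma small_step:
  fixes H C e :: real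
  assumes "0 \<le> H" "0 < C" "0 < e"
  shows "H * (e / (H + C + 1)) < e" "C * (e / (H + C + 1)) < e"
proof -
  have p: "0 < H + C + 1" using assms by simp
  have "H * e < e * (H + C + 1)" "C * e < e * (H + C + 1)"
    using assms by (auto simp: algebra_simps add_pos_nonneg add_nonneg_pos)
  then show "H * (e / (H + C + 1)) < e" "C * (e / (H + C + 1)) < e"
    using p by (auto simp: pos_divide_less_eq)
qed

context indefinite_weight
begin

text \<open>The slope is of order c^q, so the relative deviation of u from c is of order c^(q-1) and
  tends to 0 because q < 1. The flux at R is then c^q times the integral of s^(N-1) \<alpha>, up to
  a small relative error, and that integral is negative.\<close>

lemma large_data_flux_neg:
  assumes d: "0 < d"
    and cu: "\<And>c. continuous_on {0..R} (u c)"
    and u: "\<And>c r. r \<in> {0..R} \<Longrightarrow> u c r = c - integral {0..r} (slope (\<lambda>s. max (u c s) d powr q))"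
  obtains c1 :: real where "\<And>c. c1 \<le> c \<Longrightarrow> flux (\<lambda>s. max (u c s) d powr q) R < 0"
    "\<And>c r. c1 \<le> c \<Longrightarrow> r \<in> {0..R} \<Longrightarrow> d < u c r"
proof -
  define J where "J = - integral {0..R} (\<lambda>s. s ^ (N - 1) * \<alpha> s)"
  have J: "0 < J" using mean_neg by (simp add: J_def)
  \<comment> \<open>The bound 1/2 keeps u above c / 2 > d; the other bound makes the error K e R
    R^(N-1) smaller than J.\<close>
  define e where "e = min (1/2) (J / (2 * (K * R * R ^ (N - 1) + 1)))"
  have KR: "0 \<le> K * R * R ^ (N - 1)" using K_nonneg R_pos by auto
  have e: "0 < e" "e \<le> 1/2"
    using J KR by (simp add: e_def, unfold e_def, intro min.cobounded1)
  have eJ: "K * e * R * R ^ (N - 1) < J"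
  proof -
    have "e * (K * R * R ^ (N - 1)) \<le> J / (2 * (K * R * R ^ (N - 1) + 1)) * (K * R * R ^ (N - 1))"
      using KR by (intro mult_right_mono) (auto simp: e_def)
    also have "\<dots> = J * (K * R * R ^ (N - 1) / (2 * (K * R * R ^ (N - 1) + 1)))" by simp
    also have "\<dots> < J * 1"
      using KR J by (intro mult_strict_left_mono) (auto simp: divide_less_eq)
    finally show ?thesis by (simp add: mult_ac)
  qed
  have "((\<lambda>c. K * R * R * c powr (q - 1)) \<longlongrightarrow> K * R * R * 0) at_top"
    using q by (intro tendsto_mult tendsto_const tendsto_neg_powr filterlim_ident) auto
  then have "eventually (\<lambda>c. K * R * R * c powr (q - 1) < e / 2) at_top"
    using e by (intro order_tendstoD) auto
  moreover have "eventually (\<lambda>c. 2 * d < c) at_top" by (rule eventually_gt_at_top)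
  ultimately have "eventually (\<lambda>c. K * R * R * c powr (q - 1) < e / 2 \<and> 2 * d < c) at_top"
    by (rule eventually_conj)
  then obtain c1 where c1: "\<And>c. c1 \<le> c \<Longrightarrow> K * R * R * c powr (q - 1) < e / 2" "\<And>c. c1 \<le> c \<Longrightarrow> 2 * d < c"
    by (auto simp: eventually_at_top_linorder)
  have close: "\<bar>u c r - c\<bar> \<le> e * c" if c: "c1 \<le> c" and r: "r \<in> {0..R}" for c r
  proof -
    have c0: "0 < c" "d < c" using c1(2)[OF c] d by auto
    define \<theta> where "\<theta> = K * R * R * c powr (q - 1)"
    have th: "0 \<le> \<theta>" "\<theta> < e / 2" using c1(1)[OF c] K_nonneg R_pos by (auto simp: \<theta>_def)
    have "continuous_on {0..R} (\<lambda>r. \<bar>u c r - c\<bar>)" by (intro continuous_intros cu)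
    then obtain r0 where r0: "r0 \<in> {0..R}" "\<And>r. r \<in> {0..R} \<Longrightarrow> \<bar>u c r - c\<bar> \<le> \<bar>u c r0 - c\<bar>"
      using continuous_attains_sup[of "{0..R}" "\<lambda>r. \<bar>u c r - c\<bar>"] R_pos by auto
    define D where "D = \<bar>u c r0 - c\<bar>"
    have D: "0 \<le> D" by (simp add: D_def)
    define g where "g = (\<lambda>s. max (u c s) d powr q)"
    have cg: "continuous_on {0..R} g" unfolding g_def using d by (intro continuous_intros cu) auto
    \<comment> \<open>A bound linear in D replaces (c + D)^q, so that the term with D can be
      absorbed on the left with the small factor \<theta>.\<close>
    have gb: "\<bar>g s\<bar> \<le> (c + D) * c powr (q - 1)" if s: "s \<in> {0..R}" for s
    proof -
      have "max (u c s) d \<le> c + D" using r0(2)[OF s] c0 by (auto simp: D_def)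
      then have "g s \<le> (c + D) powr q" unfolding g_def using d q by (intro powr_mono2) auto
      also have "\<dots> = (c + D) * (c + D) powr (q - 1)"
        using c0 D by (simp add: powr_mult_base)
      also have "\<dots> \<le> (c + D) * c powr (q - 1)"
        using c0 D q by (intro mult_left_mono powr_mono2') auto
      finally show ?thesis by (simp add: g_def)
    qed
    have "D = \<bar>integral {0..r0} (slope g)\<bar>" unfolding D_def using u[OF r0(1), of c] by (simp add: g_def)
    also have "\<dots> \<le> integral {0..r0} (\<lambda>_. K * ((c + D) * c powr (q - 1)) * R)"
      unfolding real_norm_def[symmetric]
    proof (rule Henstock_Kurzweil_Integration.integral_norm_bound_integral)
      show "slope g integrable_on {0..r0}" using r0
        by (intro integrable_continuous_interval slope_continuous_on continuous_on_subset[OF cg]) auto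
      fix x assume x: "x \<in> {0..r0}"
      have "\<bar>slope g x\<bar> \<le> K * ((c + D) * c powr (q - 1)) * x"
        by (rule slope_bound) (use x r0 gb in \<open>auto intro: continuous_on_subset[OF cg]\<close>)
      also have "\<dots> \<le> K * ((c + D) * c powr (q - 1)) * R"
        using x r0 K_nonneg c0 D by (intro mult_left_mono) auto
      finally show "norm (slope g x) \<le> K * ((c + D) * c powr (q - 1)) * R" by simp
    qed auto
    also have "\<dots> = r0 * (K * ((c + D) * c powr (q - 1)) * R)" using r0 by simp
    also have "\<dots> \<le> R * (K * ((c + D) * c powr (q - 1)) * R)"
      using r0 K_nonneg c0 D R_pos by (intro mult_right_mono) auto
    also have "\<dots> = \<theta> * (c + D)" by (simp add: \<theta>_def mult_ac)
    finally have "D \<le> \<theta> * c + \<theta> * D" by (simp add: algebra_simps)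
    also have "\<dots> \<le> e / 2 * c + 1 / 2 * D"
      using th e c0 D by (intro add_mono mult_right_mono) auto
    finally have "D \<le> e * c" by simp
    with r0(2)[OF r] show ?thesis by (simp add: D_def)
  qed
  have low: "d < u c r" if c: "c1 \<le> c" and r: "r \<in> {0..R}" for c r
  proof -
    have "2 * d < c" by (rule c1(2)[OF c])
    moreover have "e * c \<le> 1/2 * c" using e c1(2)[OF c] d by (intro mult_right_mono) auto
    ultimately show ?thesis using close[OF c r] by auto
  qed
  show thesis
  proof (rule that[OF _ low])
    fix c assume c: "c1 \<le> c"
    have c0: "0 < c" using c1(2)[OF c] d by auto
    define g where "g = (\<lambda>s. max (u c s) d powr q)"
    have cg: "continuous_on {0..R} g" unfolding g_def using d by (intro continuous_intros cu) auto
    have gd: "\<bar>g s - c powr q\<bar> \<le> c powr q * e" if s: "s \<in> {0..R}" for s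
    proof -
      have us: "0 < u c s" and g: "g s = u c s powr q" using low[OF c s] d by (auto simp: g_def max_def)
      have "u c s powr q = c powr q * (u c s / c) powr q"
        using us c0 powr_mult[of c "u c s / c" q] by simp
      then have "g s - c powr q = c powr q * ((u c s / c) powr q - 1)"
        by (simp add: g right_diff_distrib)
      then have "\<bar>g s - c powr q\<bar> = c powr q * \<bar>(u c s / c) powr q - 1\<bar>"
        by (simp add: abs_mult)
      also have "\<dots> \<le> c powr q * \<bar>u c s / c - 1\<bar>"
        using us c0 q by (intro mult_left_mono abs_powr_minus_one_le) auto
      also have "u c s / c - 1 = (u c s - c) / c" using c0 by (simp add: field_simps)
      also have "\<bar>(u c s - c) / c\<bar> \<le> e" using close[OF c s] c0 by (simp add: abs_divide divide_le_eq)
      finally show ?thesis by (simp add: mult_left_mono)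
    qed
    have "\<bar>flux (\<lambda>s. g s - c powr q) R\<bar> \<le> K * (c powr q * e) * R * R ^ (N - 1)"
      by (rule flux_bound) (use R_pos gd in \<open>auto intro!: continuous_intros cg\<close>)
    also have "\<dots> = c powr q * (K * e * R * R ^ (N - 1))" by (simp add: mult_ac)
    also have "\<dots> < c powr q * J" using c0 eJ by (intro mult_strict_left_mono) auto
    finally have *: "\<bar>flux (\<lambda>s. g s - c powr q) R\<bar> < c powr q * J" .
    have "flux (\<lambda>_. c powr q) R = - (c powr q * J)"
    proof -
      have "flux (\<lambda>_. c powr q) R = integral {0..R} (\<lambda>s. s ^ (N - 1) * \<alpha> s) * c powr q"
        unfolding flux_def by (rule integral_mult_left)
      then show ?thesis by (simp add: J_def)
    qed
    moreover have "flux g R - flux (\<lambda>_. c powr q) R = flux (\<lambda>s. g s - c powr q) R"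
      using slope_minus[OF cg continuous_on_const, of "c powr q"] R_pos
      by (simp add: slope_def flip: diff_divide_distrib)
    ultimately show "flux (\<lambda>s. max (u c s) d powr q) R < 0" using * by (simp add: g_def)
  qed
qed

text \<open>The \<open>good\<close> initial values are followed down to an infimum. In the limit
  only the weak inequalities survive; the a priori bound makes the positivity condition strict
  again, so the flux condition is the one that has to become an equality.\<close>

theorem neumann_profile:
  obtains u where "positive_profile u" "slope (\<lambda>s. u s powr q) R = 0"
proof -
  obtain d0 where d0: "0 < d0"
    "\<And>u r. positive_profile u \<Longrightarrow> flux (\<lambda>s. u s powr q) R \<le> 0 \<Longrightarrow> r \<in> {0..R} \<Longrightarrow> d0 \<le> u r"
    using a_priori_lower_bound by blast
  \<comment> \<open>Truncation at half of the a priori bound leaves a margin d0 - d between the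
    bound and the truncation level, which is spent on perturbing \<open>c\<close>.\<close>
  define d where "d = d0 / 2"
  have d: "0 < d" "d < d0" using d0 by (auto simp: d_def)
  define L where "L = q * d powr (q - 1)"
  have L: "0 \<le> L" using q by (simp add: L_def)
  obtain u C where C: "0 < C" and cu: "\<And>c. continuous_on {0..R} (u c)"
    and u: "\<And>c r. r \<in> {0..R} \<Longrightarrow> u c r = c - integral {0..r} (slope (\<lambda>s. max (u c s) d powr q))"
    and lip: "\<And>c c' r. r \<in> {0..R} \<Longrightarrow> \<bar>u c r - u c' r\<bar> \<le> C * \<bar>c - c'\<bar>"
    by (rule initial_value_problem[OF L truncated_powr_lipschitz[OF q d(1), folded L_def]]) (rule that)
  define g where "g c = (\<lambda>s. max (u c s) d powr q)" for c
  have cg: "continuous_on {0..R} (g c)" for c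
    unfolding g_def using d by (intro continuous_intros cu) auto
  define \<Phi> where "\<Phi> c = flux (g c) R" for c
  have u0: "u c 0 = c" for c using u[of 0 c] R_pos by simp
  define H where "H = K * (L * C) * R * R ^ (N - 1)"
  have H: "0 \<le> H" using K_nonneg L C R_pos by (simp add: H_def)
  have Phi_lip: "\<bar>\<Phi> c - \<Phi> c'\<bar> \<le> H * \<bar>c - c'\<bar>" for c c'
  proof -
    have "\<Phi> c - \<Phi> c' = flux (\<lambda>s. g c s - g c' s) R"
      using slope_minus[OF cg cg, of c c'] R_pos
      by (simp add: \<Phi>_def slope_def flip: diff_divide_distrib)
    also have "\<bar>\<dots>\<bar> \<le> K * (L * (C * \<bar>c - c'\<bar>)) * R * R ^ (N - 1)"
    proof (rule flux_bound)
      fix s assume s: "s \<in> {0..R}"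
      have "\<bar>g c s - g c' s\<bar> \<le> L * \<bar>u c s - u c' s\<bar>"
        unfolding g_def L_def by (rule truncated_powr_lipschitz[OF q d(1)])
      also have "\<dots> \<le> L * (C * \<bar>c - c'\<bar>)" using lip[OF s] L by (rule mult_left_mono)
      finally show "\<bar>g c s - g c' s\<bar> \<le> L * (C * \<bar>c - c'\<bar>)" .
    qed (use R_pos in \<open>auto intro!: continuous_intros cg\<close>)
    finally show ?thesis by (simp add: H_def mult_ac)
  qed
  define good where "good c \<longleftrightarrow> \<Phi> c < 0 \<and> (\<forall>r\<in>{0..R}. d < u c r)" for c
  obtain c1 where c1: "\<And>c. c1 \<le> c \<Longrightarrow> good c"
    by (rule large_data_flux_neg[OF d(1) cu u]) (assumption, rule that, auto simp: good_def \<Phi>_def g_def)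
  \<comment> \<open>Asking for all larger values as well makes \<open>S\<close> upward closed, so
    every value above its infimum is good. It is bounded below by \<open>d\<close>, since u starts
    at \<open>c\<close>.\<close>
  define S where "S = {c. \<forall>c'\<ge>c. good c'}"
  have c1S: "c1 \<in> S" using c1 by (auto simp: S_def)
  have lowS: "d \<le> c" if "c \<in> S" for c
  proof -
    have "d < u c 0" using that R_pos by (auto simp: S_def good_def)
    then show ?thesis by (simp add: u0)
  qed
  have bdd: "bdd_below S" using lowS by (auto simp: bdd_below_def)
  define c where "c = Inf S"
  have above: "good c'" if less: "c < c'" for c'
  proof -
    obtain x where "x \<in> S" "x < c'" using cInf_lessD[of S c'] less c1S unfolding c_def by auto
    then show ?thesis by (auto simp: S_def)
  qed
  have near: "\<exists>c'>c. H * \<bar>c' - c\<bar> < e \<and> C * \<bar>c' - c\<bar> < e" if "0 < e" for e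
  proof (intro exI conjI)
    have p: "e / (H + C + 1) > 0" using that H C by simp
    then have "\<bar>c + e / (H + C + 1) - c\<bar> = e / (H + C + 1)"
      by (simp only: add_diff_cancel_left' abs_of_pos)
    then show "H * \<bar>c + e / (H + C + 1) - c\<bar> < e" "C * \<bar>c + e / (H + C + 1) - c\<bar> < e"
      using small_step[OF H C that] by simp_all
    show "c < c + e / (H + C + 1)" using p by simp
  qed
  have Phi_c: "\<Phi> c \<le> 0"
  proof (rule ccontr)
    assume "\<not> \<Phi> c \<le> 0"
    then obtain c' where "c < c'" "H * \<bar>c' - c\<bar> < \<Phi> c" using near[of "\<Phi> c"] by auto
    then show False using above[of c'] Phi_lip[of c' c] by (auto simp: good_def)
  qed
  have uc: "d \<le> u c r" if r: "r \<in> {0..R}" for r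
  proof (rule ccontr)
    assume "\<not> d \<le> u c r"
    then obtain c' where "c < c'" "C * \<bar>c' - c\<bar> < d - u c r" using near[of "d - u c r"] by auto
    then show False using above[of c'] lip[OF r, of c' c] r by (auto simp: good_def dest!: bspec[of _ _ r])
  qed
  have g_eq: "g c s = u c s powr q" if "s \<in> {0..R}" for s
    using uc[OF that] by (simp add: g_def max_def)
  have slope_eq: "slope (g c) t = slope (\<lambda>s. u c s powr q) t" if "t \<in> {0..R}" for t
    unfolding slope_def flux_def using that g_eq by (auto intro!: arg_cong2[where f="(/)"] Henstock_Kurzweil_Integration.integral_cong)
  have prof: "positive_profile (u c)"
    unfolding positive_profile_def
  proof (intro ballI conjI)
    fix r assume r: "r \<in> {0..R}"
    show "0 < u c r" using uc[OF r] d by simp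
    have "((\<lambda>r. c - integral {0..r} (slope (g c))) has_real_derivative - slope (g c) r) (at r within {0..R})"
      using integral_has_real_derivative[OF slope_continuous_on[OF cg] r, of c]
      by (auto intro!: derivative_eq_intros)
    then have "(u c has_real_derivative - slope (g c) r) (at r within {0..R})"
      by (rule has_field_derivative_transform_within[OF _ zero_less_one r]) (use u in \<open>auto simp: g_def\<close>)
    then show "(u c has_real_derivative - slope (\<lambda>s. u c s powr q) r) (at r within {0..R})"
      by (simp add: slope_eq[OF r])
  qed
  have Phi_eq: "\<Phi> c = flux (\<lambda>s. u c s powr q) R"
    using flux_eq[of R "g c"] flux_eq[of R "\<lambda>s. u c s powr q"] slope_eq[of R] R_pos by (simp add: \<Phi>_def)
  \<comment> \<open>Since u >= d, the truncation is inactive and u is a genuine profile, so the a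
    priori bound improves d to d0 = 2 d.\<close>
  have strong: "d0 \<le> u c r" if "r \<in> {0..R}" for r
    using d0(2)[OF prof _ that] Phi_c Phi_eq by simp
  have "\<Phi> c = 0"
  proof (rule ccontr)
    assume "\<Phi> c \<noteq> 0"
    then have neg: "\<Phi> c < 0" using Phi_c by simp
    \<comment> \<open>With a negative flux both conditions hold at \<open>c\<close> with margin
      \<open>e\<close>, hence also on an interval below \<open>c\<close>, which contradicts the
      choice of \<open>c\<close> as an infimum.\<close>
    define e where "e = min (- \<Phi> c) (d0 - d)"
    have e: "0 < e" using neg d by (simp add: e_def)
    define h where "h = e / (H + C + 1)"
    have h: "0 < h" using e H C by (simp add: h_def)
    have hb: "H * x < e" "C * x < e" if "0 \<le> x" "x \<le> h" for x
    proof -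
      have "H * x \<le> H * h" "C * x \<le> C * h" using that H C by (auto intro: mult_left_mono)
      moreover have "H * h < e" "C * h < e" using small_step[OF H C e] by (auto simp: h_def)
      ultimately show "H * x < e" "C * x < e" by auto
    qed
    have "good c'" if c': "c - h \<le> c'" for c'
    proof (cases "c < c'")
      case False
      then have x: "0 \<le> \<bar>c' - c\<bar>" "\<bar>c' - c\<bar> \<le> h" using c' by auto
      have "\<Phi> c' < 0" using Phi_lip[of c' c] hb(1)[OF x] by (auto simp: e_def)
      moreover have "d < u c' r" if r: "r \<in> {0..R}" for r
        using lip[OF r, of c' c] hb(2)[OF x] strong[OF r] by (auto simp: e_def)
      ultimately show ?thesis by (simp add: good_def)
    qed (rule above)
    then have "c - h \<in> S" by (simp add: S_def)
    then have "c \<le> c - h" unfolding c_def by (rule cInf_lower[OF _ bdd])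
    with h show False by simp
  qed
  then have "slope (\<lambda>s. u c s powr q) R = 0" using Phi_eq by (simp add: slope_def)
  with prof show thesis by (rule that)
qed

end

subsection \<open>Radial functions on balls\<close>

lemma omega_sphere_pos: "0 < omega_sphere TYPE('a::euclidean_space)"
  by (simp add: omega_sphere_def content_ball_pos)

text \<open>Polar coordinates as a density on the line: the law of the norm of a point under
  Lebesgue measure on the ball.\<close>

definition radial_density :: "'a::euclidean_space itself \<Rightarrow> real \<Rightarrow> real \<Rightarrow> real" where
  "radial_density T R r = omega_sphere T * r ^ (DIM('a) - 1) * indicator {0..R} r"

lemma radial_density_measurable [measurable]:
  "radial_density TYPE('a::euclidean_space) R \<in> borel_measurable borel"
  unfolding radial_density_def by measurable

lemma radial_density_nonneg: "0 \<le> radial_density TYPE('a::euclidean_space) R r"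
  using omega_sphere_pos[where 'a='a] by (auto simp: radial_density_def indicator_def)

text \<open>Both measures are finite and equal on every half-line \<open>{x<..}\<close>: on the left
  this is the volume of a shell, known from the scaling of balls, on the right the integral of N V
  r^(N-1). Null sets and integrals of radial functions are reduced to one variable through this
  identity.\<close>

theorem distr_norm_ball:
  fixes R :: real
  assumes R: "0 < R"
  shows "distr (density lborel (indicator (ball (0::'a::euclidean_space) R))) borel norm
      = density lborel (\<lambda>r. ennreal (radial_density TYPE('a) R r))" (is "?M = ?D")
proof (rule measure_eqI_lessThan)
  define N where "N = DIM('a)"
  define V where "V = measure lborel (ball (0::'a) 1)"
  have N: "0 < N" by (simp add: N_def)
  have om: "omega_sphere TYPE('a) = real N * V" by (simp add: omega_sphere_def N_def V_def)
  have V: "0 \<le> V" by (simp add: V_def)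
  have eb: "emeasure lborel (ball (0::'a) r) = ennreal (V * r ^ N)" if "0 \<le> r" for r
    using content_ball_conv_unit_ball[OF that, of "0::'a"] emeasure_lborel_ball_finite[of "0::'a" r]
    by (subst emeasure_eq_ennreal_measure) (auto simp: V_def N_def mult.commute)
  have ecb: "emeasure lborel (cball (0::'a) r) = ennreal (V * r ^ N)" if "0 \<le> r" for r
  proof -
    have "sphere (0::'a) r \<in> null_sets lborel"
      using negligible_sphere[of "0::'a" r] by (auto simp: null_sets_completion_iff negligible_iff_null_sets)
    then have "emeasure lborel (ball 0 r \<union> sphere 0 r :: 'a set) = emeasure lborel (ball (0::'a) r)"
      by (intro emeasure_Un_null_set) auto
    also have "ball 0 r \<union> sphere 0 r = (cball 0 r :: 'a set)" by auto
    finally show ?thesis using eb[OF that] by simp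
  qed
  have M: "emeasure ?M {x<..} = emeasure lborel (ball (0::'a) R \<inter> {y. x < norm y})" for x
  proof -
    have "emeasure ?M {x<..} = emeasure (density lborel (indicator (ball (0::'a) R))) {y. x < norm y}"
      by (subst emeasure_distr) (auto simp: vimage_def)
    also have "\<dots> = (\<integral>\<^sup>+ y. indicator (ball (0::'a) R) y * indicator {y. x < norm y} y \<partial>lborel)"
      by (rule emeasure_density[OF borel_measurable_indicator]) auto
    also have "\<dots> = (\<integral>\<^sup>+ y. indicator (ball (0::'a) R \<inter> {y. x < norm y}) y \<partial>lborel)"
      by (simp add: indicator_inter_arith)
    also have "\<dots> = emeasure lborel (ball (0::'a) R \<inter> {y. x < norm y})"
      by (rule nn_integral_indicator) auto
    finally show ?thesis .
  qed
  show "emeasure ?M {x<..} < \<infinity>" for x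
    unfolding M by (rule le_less_trans[OF emeasure_mono[of _ "ball (0::'a) R"]]) (use R in \<open>auto simp: eb\<close>)
  show "emeasure ?M {x<..} = emeasure ?D {x<..}" for x
  proof (cases "x < R")
    case False
    then have "ball (0::'a) R \<inter> {y. x < norm y} = {}" by auto
    moreover have "emeasure ?D {x<..} = 0"
      using False by (subst emeasure_density) (auto simp: radial_density_def indicator_def nn_integral_0_iff_AE)
    ultimately show ?thesis unfolding M by simp
  next
    case True
    \<comment> \<open>For x < 0 the condition on the norm is void, so the shell starts at radius
      0.\<close>
    define y where "y = max x 0"
    have y: "0 \<le> y" "y < R" using True R by (auto simp: y_def)
    have "emeasure lborel (ball (0::'a) R \<inter> {z. x < norm z}) = ennreal (V * R ^ N - V * y ^ N)"
    proof (cases "0 \<le> x")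
      case True
      then have eq: "ball (0::'a) R \<inter> {z. x < norm z} = ball 0 R - cball 0 y" by (auto simp: y_def)
      have "emeasure lborel (ball (0::'a) R - cball 0 y) = emeasure lborel (ball (0::'a) R) - emeasure lborel (cball (0::'a) y)"
        using y by (intro emeasure_Diff) (auto simp: ecb)
      then show ?thesis unfolding eq using y V by (simp add: eb ecb ennreal_minus)
    next
      case False
      then have eq: "ball (0::'a) R \<inter> {z. x < norm z} = ball 0 R" by (auto intro: less_le_trans[OF _ norm_ge_zero])
      show ?thesis unfolding eq using False R N by (simp add: eb y_def zero_power)
    qed
    also have "\<dots> = emeasure ?D {x<..}"
    proof -
      have "emeasure ?D {x<..} = (\<integral>\<^sup>+ r. ennreal (radial_density TYPE('a) R r) * indicator {x<..} r \<partial>lborel)"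
        by (rule emeasure_density) auto
      also have "\<dots> = (\<integral>\<^sup>+ r. ennreal (real N * V * r ^ (N - 1)) * indicator {y..R} r \<partial>lborel)"
      proof (rule nn_integral_cong_AE)
        show "AE r in lborel. ennreal (radial_density TYPE('a) R r) * indicator {x<..} r =
            ennreal (real N * V * r ^ (N - 1)) * indicator {y..R} r"
          using AE_lborel_singleton[of y]
          by eventually_elim (use y in \<open>auto simp: radial_density_def om N_def indicator_def y_def max_def split: if_splits\<close>)
      qed
      also have "\<dots> = ennreal (V * R ^ N - V * y ^ N)"
      proof (rule nn_integral_has_integral_lebesgue')
        show "((\<lambda>r. real N * V * r ^ (N - 1)) has_integral V * R ^ N - V * y ^ N) {y..R}"
          using y by (intro fundamental_theorem_of_calculus)
            (auto intro!: derivative_eq_intros simp flip: has_real_derivative_iff_has_vector_derivative)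
      qed (use y V in auto)
      finally show ?thesis by simp
    qed
    finally show ?thesis unfolding M .
  qed
qed auto

text \<open>The density is positive on \<open>{0..R}\<close> except possibly at 0, a null set, so
  null sets of radii and null radial sets of points correspond.\<close>

lemma AE_ball_norm_iff:
  fixes P :: "real \<Rightarrow> bool"
  assumes R: "0 < R" and P: "{r. P r} \<in> sets borel"
  shows "(AE x in lebesgue_on (ball (0::'a::euclidean_space) R). P (norm x)) \<longleftrightarrow> (AE r in lborel. r \<in> {0..R} \<longrightarrow> P r)"
proof -
  have "(AE x in lebesgue_on (ball (0::'a) R). P (norm x)) \<longleftrightarrow> (AE x in lborel. x \<in> ball (0::'a) R \<longrightarrow> P (norm x))"
    by (simp add: AE_restrict_space_iff AE_completion_iff)
  also have "\<dots> \<longleftrightarrow> (AE x in density lborel (indicator (ball (0::'a) R)). P (norm x))"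
    by (subst AE_density[OF borel_measurable_indicator]) (auto simp: indicator_def)
  also have "\<dots> \<longleftrightarrow> (AE r in distr (density lborel (indicator (ball (0::'a) R))) borel norm. P r)"
    using P by (subst AE_distr_iff) auto
  also have "\<dots> \<longleftrightarrow> (AE r in lborel. 0 < ennreal (radial_density TYPE('a) R r) \<longrightarrow> P r)"
    unfolding distr_norm_ball[OF R] by (subst AE_density) auto
  also have "\<dots> \<longleftrightarrow> (AE r in lborel. r \<in> {0..R} \<longrightarrow> P r)"
  proof
    assume "AE r in lborel. 0 < ennreal (radial_density TYPE('a) R r) \<longrightarrow> P r"
    with AE_lborel_singleton[of 0] show "AE r in lborel. r \<in> {0..R} \<longrightarrow> P r"
      by eventually_elim (use omega_sphere_pos[where 'a='a] in \<open>auto simp: radial_density_def indicator_def\<close>)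
  next
    assume "AE r in lborel. r \<in> {0..R} \<longrightarrow> P r"
    then show "AE r in lborel. 0 < ennreal (radial_density TYPE('a) R r) \<longrightarrow> P r"
      by eventually_elim (auto simp: radial_density_def indicator_def split: if_splits)
  qed
  finally show ?thesis .
qed

lemma integral_ball_norm:
  fixes h :: "real \<Rightarrow> real"
  assumes R: "0 < R" and h [measurable]: "h \<in> borel_measurable borel" and b: "\<And>r. \<bar>h r\<bar> \<le> B"
  shows "integral\<^sup>L (lebesgue_on (ball (0::'a::euclidean_space) R)) (\<lambda>x. h (norm x))
    = omega_sphere TYPE('a) * integral {0..R} (\<lambda>r. r ^ (DIM('a) - 1) * h r)"
proof -
  have [measurable]: "ball (0::'a) R \<in> sets borel" by simp
  have "integral\<^sup>L (lebesgue_on (ball (0::'a) R)) (\<lambda>x. h (norm x))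
      = integral\<^sup>L lborel (\<lambda>x. indicator (ball (0::'a) R) x *\<^sub>R h (norm x))"
    by (subst integral_restrict_space) (auto intro!: integral_completion)
  also have "\<dots> = integral\<^sup>L (density lborel (\<lambda>x. ennreal (indicator (ball (0::'a) R) x))) (\<lambda>x. h (norm x))"
    by (subst integral_density) auto
  also have "(\<lambda>x. ennreal (indicator (ball (0::'a) R) x)) = indicator (ball (0::'a) R)"
    by (simp add: ennreal_indicator fun_eq_iff)
  also have "integral\<^sup>L (density lborel (indicator (ball (0::'a) R))) (\<lambda>x. h (norm x))
      = integral\<^sup>L (distr (density lborel (indicator (ball (0::'a) R))) borel norm) h"
    by (subst integral_distr) auto
  also have "\<dots> = integral\<^sup>L lborel (\<lambda>r. radial_density TYPE('a) R r *\<^sub>R h r)"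
    unfolding distr_norm_ball[OF R] by (subst integral_density) (auto simp: radial_density_nonneg)
  also have "\<dots> = (LINT r : {0..R} | lborel. omega_sphere TYPE('a) * (r ^ (DIM('a) - 1) * h r))"
    by (auto simp: set_lebesgue_integral_def radial_density_def mult_ac intro!: Bochner_Integration.integral_cong)
  also have "\<dots> = integral {0..R} (\<lambda>r. omega_sphere TYPE('a) * (r ^ (DIM('a) - 1) * h r))"
  proof (rule set_borel_integral_eq_integral)
    have "set_integrable lborel {0..R} (\<lambda>r. omega_sphere TYPE('a) * R ^ (DIM('a) - 1) * B)"
      by (intro borel_integrable_atLeastAtMost') auto
    then show "set_integrable lborel {0..R} (\<lambda>r. omega_sphere TYPE('a) * (r ^ (DIM('a) - 1) * h r))"
    proof (rule set_integrable_bound)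
      show "set_borel_measurable lborel {0..R} (\<lambda>r. omega_sphere TYPE('a) * (r ^ (DIM('a) - 1) * h r))"
        by (simp add: set_borel_measurable_def)
      show "AE r in lborel. r \<in> {0..R} \<longrightarrow> norm (omega_sphere TYPE('a) * (r ^ (DIM('a) - 1) * h r))
          \<le> norm (omega_sphere TYPE('a) * R ^ (DIM('a) - 1) * B)"
      proof (intro AE_I2 impI)
        fix r assume r: "r \<in> {0..R}"
        have B: "0 \<le> B" using b[of 0] by simp
        have "\<bar>r ^ (DIM('a) - 1)\<bar> * \<bar>h r\<bar> \<le> R ^ (DIM('a) - 1) * B"
          using r b[of r] R by (intro mult_mono) (auto intro: power_mono)
        then show "norm (omega_sphere TYPE('a) * (r ^ (DIM('a) - 1) * h r))
          \<le> norm (omega_sphere TYPE('a) * R ^ (DIM('a) - 1) * B)"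
          using omega_sphere_pos[where 'a='a] R B by (simp add: abs_mult mult.assoc)
      qed
    qed
  qed
  finally show ?thesis by simp
qed

text \<open>Continuous images of Borel sets need not be Borel, but an \<open>fsigma\<close> set is a
  countable union of compact sets, whose images are compact.\<close>

lemma borel_norm_image_fsigma:
  fixes C :: "'a::euclidean_space set"
  assumes "fsigma C"
  shows "norm ` C \<in> sets borel"
proof -
  obtain F :: "nat \<Rightarrow> 'a set" where F: "range F \<subseteq> Collect compact" "C = \<Union>(F ` UNIV)"
    using assms fsigma_Union_compact by metis
  have "norm ` F n \<in> sets borel" for n
    using F by (intro borel_closed compact_imp_closed compact_continuous_image continuous_intros) auto
  moreover have "norm ` C = (\<Union>n. norm ` F n)" using F by auto
  ultimately show ?thesis by auto
qed

text \<open>The profile in \<^const>\<open>radial_on\<close> need not be measurable.  A superlevel set of \<open>f\<close> contains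
  an \<open>F\<^sub>\<sigma>\<close> set of full measure, whose image under the norm is Borel; these images are the superlevel
  sets of a Borel profile.\<close>

lemma radial_borel_profile:
  fixes f :: "'a::euclidean_space \<Rightarrow> real"
  assumes f: "f \<in> borel_measurable (lebesgue_on (ball 0 R))" and rad: "radial_on (ball 0 R) f"
  obtains \<alpha> where "\<alpha> \<in> borel_measurable borel" "AE x in lebesgue_on (ball 0 R). f x = \<alpha> (norm x)"
proof -
  let ?B = "ball (0::'a) R"
  obtain g where g: "AE x in lebesgue_on ?B. f x = g (norm x)" using rad by (auto simp: radial_on_def)
  then have "AE x in lebesgue. x \<in> ?B \<longrightarrow> f x = g (norm x)" by (simp add: AE_restrict_space_iff)
  then obtain Z where Z: "Z \<in> null_sets lebesgue" "{x. \<not> (x \<in> ?B \<longrightarrow> f x = g (norm x))} \<subseteq> Z"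
    by (auto simp: eventually_ae_filter)
  have fg: "f x = g (norm x)" if "x \<in> ?B" "x \<notin> Z" for x using Z that by auto
  define S where "S c = {x \<in> ?B. real_of_rat c < f x} - Z" for c
  have "S c \<in> sets lebesgue" for c
  proof -
    have "{x \<in> space (lebesgue_on ?B). real_of_rat c < f x} \<in> sets (lebesgue_on ?B)"
      using f by measurable
    then have "{x \<in> ?B. real_of_rat c < f x} \<in> sets lebesgue"
      by (simp add: sets_restrict_space_iff)
    then show ?thesis using Z by (auto simp: S_def)
  qed
  then have "\<exists>C T. fsigma C \<and> T \<in> null_sets lebesgue \<and> C \<union> T = S c" for c
    by (metis lebesgue_set_almost_fsigma)
  then obtain C T where C: "\<And>c. fsigma (C c)" and T: "\<And>c. T c \<in> null_sets lebesgue" and CT: "\<And>c. C c \<union> T c = S c"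
    by metis
  define E where "E c = norm ` C c" for c
  have E [measurable]: "E c \<in> sets borel" for c unfolding E_def by (rule borel_norm_image_fsigma[OF C])
  \<comment> \<open>The profile is recovered from its superlevel sets at rational heights. The
    extended reals give the supremum a value also at radii that belong to none of the sets.\<close>
  define \<alpha> where "\<alpha> r = real_of_ereal (SUP c. if r \<in> E c then ereal (real_of_rat c) else - \<infinity>)" for r
  have eq: "f x = \<alpha> (norm x)" if x: "x \<in> ?B" "x \<notin> Z" "x \<notin> (\<Union>c. T c)" for x
  proof -
    \<comment> \<open>Radiality enters here: off the exceptional set, points of equal norm have
      equal values, so any witness y in \<open>C c\<close> decides for x.\<close>
    have iff: "norm x \<in> E c \<longleftrightarrow> real_of_rat c < f x" for c
    proof
      assume "norm x \<in> E c"
      then obtain y where y: "y \<in> C c" "norm y = norm x" by (auto simp: E_def)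
      then have "y \<in> S c" using CT by auto
      then have "real_of_rat c < f y" "f y = g (norm y)" using fg by (auto simp: S_def)
      then show "real_of_rat c < f x" using y fg[OF x(1,2)] by simp
    next
      assume "real_of_rat c < f x"
      then have "x \<in> S c" using x by (auto simp: S_def)
      then have "x \<in> C c" using CT[of c] x by auto
      then show "norm x \<in> E c" by (auto simp: E_def)
    qed
    have "(SUP c. if norm x \<in> E c then ereal (real_of_rat c) else - \<infinity>) = ereal (f x)"
    proof (rule SUP_eqI)
      show "(if norm x \<in> E c then ereal (real_of_rat c) else - \<infinity>) \<le> ereal (f x)" for c
        by (auto simp: iff)
      fix y assume y: "\<And>c. c \<in> UNIV \<Longrightarrow> (if norm x \<in> E c then ereal (real_of_rat c) else - \<infinity>) \<le> y"
      show "ereal (f x) \<le> y"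
      proof (rule ccontr)
        assume "\<not> ereal (f x) \<le> y"
        then obtain z where z: "y < ereal z" "z < f x"
          using ereal_dense2[of y "ereal (f x)"] by (auto simp: not_le)
        obtain c where c: "z < real_of_rat c" "real_of_rat c < f x" using of_rat_dense[OF z(2)] by auto
        have "ereal (real_of_rat c) \<le> y" using y[of c] c by (auto simp: iff)
        then show False using z c by (metis ereal_less_eq(3) leD less_imp_le order_trans)
      qed
    qed
    then show ?thesis by (simp add: \<alpha>_def)
  qed
  show thesis
  proof (rule that)
    show "\<alpha> \<in> borel_measurable borel" unfolding \<alpha>_def by measurable
    have "Z \<union> (\<Union>c. T c) \<in> null_sets lebesgue" using Z T by auto
    then have "AE x in lebesgue. x \<notin> Z \<union> (\<Union>c. T c)" by (rule AE_not_in)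
    then have "AE x in lebesgue. x \<in> ?B \<longrightarrow> f x = \<alpha> (norm x)"
      by eventually_elim (use eq in auto)
    then show "AE x in lebesgue_on ?B. f x = \<alpha> (norm x)" by (simp add: AE_restrict_space_iff)
  qed
qed

subsection \<open>Integration by parts\<close>

lemma integrable_continuous_compact_support:
  fixes g :: "'a::euclidean_space \<Rightarrow> real"
  assumes "continuous_on UNIV g" "compact K" "\<And>x. x \<notin> K \<Longrightarrow> g x = 0"
  shows "integrable lborel g"
proof -
  have "integrable lborel (\<lambda>x. indicator K x *\<^sub>R g x)"
    using assms by (intro borel_integrable_compact) (auto intro: continuous_on_subset)
  also have "(\<lambda>x. indicator K x *\<^sub>R g x) = g" using assms(3) by (auto simp: indicator_def fun_eq_iff)
  finally show ?thesis .
qed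

lemma bounded_continuous_compact_support:
  fixes g :: "'a::euclidean_space \<Rightarrow> real"
  assumes "continuous_on UNIV g" "compact K" "\<And>x. x \<notin> K \<Longrightarrow> g x = 0"
  obtains B where "0 \<le> B" "\<And>x. \<bar>g x\<bar> \<le> B"
proof -
  have "bounded (g ` K)"
    using assms by (intro compact_imp_bounded compact_continuous_image) (auto intro: continuous_on_subset)
  then obtain B where B: "\<And>x. x \<in> K \<Longrightarrow> \<bar>g x\<bar> \<le> B" by (auto simp: bounded_real)
  show thesis
  proof (rule that)
    show "\<bar>g x\<bar> \<le> \<bar>B\<bar>" for x using B[of x] assms(3)[of x] by (cases "x \<in> K") auto
  qed simp
qed

text \<open>By translation invariance every difference quotient of F integrates to 0. The quotients
  are bounded by a bound for F' and vanish outside one fixed ball, so the limit passes under the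
  integral.\<close>

lemma integral_directional_derivative_zero:
  fixes F F' :: "'a::euclidean_space \<Rightarrow> real"
  assumes d: "\<And>x. ((\<lambda>t. F (x + t *\<^sub>R i)) has_real_derivative F' x) (at 0)"
    and cF: "continuous_on UNIV F" and cF': "continuous_on UNIV F'" and K: "compact K"
    and F0: "\<And>x. x \<notin> K \<Longrightarrow> F x = 0" and F'0: "\<And>x. x \<notin> K \<Longrightarrow> F' x = 0"
  shows "integral\<^sup>L lborel F' = 0"
proof -
  obtain B where B: "0 \<le> B" "\<And>x. \<bar>F' x\<bar> \<le> B"
    using bounded_continuous_compact_support[OF cF' K F'0] by blast
  have d': "((\<lambda>t. F (x + t *\<^sub>R i)) has_real_derivative F' (x + s *\<^sub>R i)) (at s)" for x s
  proof -
    have "((\<lambda>t. F ((x + s *\<^sub>R i) + t *\<^sub>R i)) has_real_derivative F' (x + s *\<^sub>R i)) (at (s + - s))"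
      using d[of "x + s *\<^sub>R i"] by simp
    then have "((\<lambda>t. F ((x + s *\<^sub>R i) + (t + - s) *\<^sub>R i)) has_real_derivative F' (x + s *\<^sub>R i)) (at s)"
      by (subst (asm) DERIV_shift) simp
    then show ?thesis by (simp add: algebra_simps)
  qed
  define h where "h n = 1 / real (Suc n)" for n
  have h: "0 < h n" "h n \<le> 1" for n by (auto simp: h_def)
  define s where "s n x = (F (x + h n *\<^sub>R i) - F x) / h n" for n x
  obtain \<rho> where \<rho>: "K \<subseteq> ball 0 \<rho>" using K bounded_subset_ballD[OF compact_imp_bounded[OF K], of 0] by auto
  \<comment> \<open>Large enough to contain the supports of all difference quotients, since
    \<open>h n \<le> 1\<close>.\<close>
  define C where "C = cball (0::'a) (\<rho> + norm i)"
  have sb: "\<bar>s n x\<bar> \<le> B * indicator C x" for n x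
  proof (cases "x \<in> C")
    case True
    obtain z where "F (x + h n *\<^sub>R i) - F (x + 0 *\<^sub>R i) = (h n - 0) * F' (x + z *\<^sub>R i)"
      using MVT2[of 0 "h n" "\<lambda>t. F (x + t *\<^sub>R i)" "\<lambda>t. F' (x + t *\<^sub>R i)"] d' h by blast
    then have "s n x = F' (x + z *\<^sub>R i)" using h[of n] by (simp add: s_def)
    then show ?thesis using B True by simp
  next
    case False
    have "norm (h n *\<^sub>R i) \<le> norm i" using h[of n] by (simp add: mult_left_le_one_le)
    then have "\<not> norm (x + h n *\<^sub>R i) < \<rho>" using False norm_triangle_ineq4[of "x + h n *\<^sub>R i" "h n *\<^sub>R i"]
      by (auto simp: C_def)
    then have "x + h n *\<^sub>R i \<notin> K" using \<rho> by auto
    moreover have "x \<notin> K" 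
    proof
      assume "x \<in> K"
      then have "norm x < \<rho>" using \<rho> by auto
      then show False using False norm_ge_zero[of i] by (simp add: C_def)
    qed
    ultimately show ?thesis using False F0 by (simp add: s_def)
  qed
  have cs: "continuous_on UNIV (s n)" for n
    unfolding s_def using h[of n]
    by (intro continuous_intros continuous_on_compose2[OF cF]) auto
  have "(\<lambda>n. integral\<^sup>L lborel (s n)) \<longlonglongrightarrow> integral\<^sup>L lborel F'"
  proof (rule integral_dominated_convergence)
    show "F' \<in> borel_measurable lborel" using cF' by (simp add: borel_measurable_continuous_onI)
    show "s n \<in> borel_measurable lborel" for n using cs by (simp add: borel_measurable_continuous_onI)
    show "integrable lborel (\<lambda>x. B * indicator C x)"
      using borel_integrable_compact[of C "\<lambda>_. B"] by (simp add: C_def mult.commute)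
    show "AE x in lborel. (\<lambda>n. s n x) \<longlonglongrightarrow> F' x"
    proof (intro AE_I2)
      fix x
      have "((\<lambda>k. (F (x + (0 + k) *\<^sub>R i) - F (x + 0 *\<^sub>R i)) / k) \<longlongrightarrow> F' x) (at 0)"
        using d[of x] unfolding DERIV_def .
      moreover have "filterlim h (at 0) sequentially"
        unfolding filterlim_at using h LIMSEQ_inverse_real_of_nat
        by (auto simp: h_def[abs_def] inverse_eq_divide less_imp_neq[symmetric])
      ultimately have "(\<lambda>n. (F (x + (0 + h n) *\<^sub>R i) - F (x + 0 *\<^sub>R i)) / h n) \<longlonglongrightarrow> F' x"
        by (rule filterlim_compose)
      then show "(\<lambda>n. s n x) \<longlonglongrightarrow> F' x" by (simp add: s_def)
    qed
    show "AE x in lborel. norm (s n x) \<le> B * indicator C x" for n using sb by simp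
  qed
  moreover have "integral\<^sup>L lborel (s n) = 0" for n
  proof -
    have iF: "integrable lborel F" by (rule integrable_continuous_compact_support[OF cF K F0])
    have [measurable]: "F \<in> borel_measurable borel" using cF by (simp add: borel_measurable_continuous_onI)
    have tr: "(lborel :: 'a measure) = distr lborel borel ((+) (h n *\<^sub>R i))" by (rule lborel_distr_plus[symmetric])
    have "integral\<^sup>L lborel F = integral\<^sup>L lborel (\<lambda>x. F (h n *\<^sub>R i + x))"
      by (subst tr, subst integral_distr) auto
    moreover have "integrable lborel (\<lambda>x. F (h n *\<^sub>R i + x))"
      using iF by (subst (asm) tr, subst (asm) integrable_distr_eq) auto
    ultimately show ?thesis using iF
      by (simp add: s_def[abs_def] add.commute Bochner_Integration.integral_diff)
  qed
  ultimately show ?thesis by (simp add: LIMSEQ_const_iff)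
qed

lemma continuous_on_extend_zero:
  fixes f :: "'a::euclidean_space \<Rightarrow> 'b::real_normed_vector"
  assumes "open S" "closed K" "K \<subseteq> S" "continuous_on S f" "\<And>x. x \<in> S - K \<Longrightarrow> f x = 0"
  shows "continuous_on UNIV (\<lambda>x. if x \<in> S then f x else 0)"
proof -
  have "continuous_on (S \<union> - K) (\<lambda>x. if x \<in> S then f x else 0)"
  proof (rule continuous_on_open_Un)
    show "continuous_on S (\<lambda>x. if x \<in> S then f x else 0)"
      using assms(4) by (rule continuous_on_eq) auto
    show "continuous_on (- K) (\<lambda>x. if x \<in> S then f x else 0)"
      by (rule continuous_on_eq[of _ "\<lambda>_. 0"]) (use assms in auto)
  qed (use assms in auto)
  moreover have "S \<union> - K = UNIV" using assms by auto
  ultimately show ?thesis by simp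
qed

lemma has_derivative_extend_zero:
  fixes f :: "'a::euclidean_space \<Rightarrow> 'b::real_normed_vector"
  assumes "open S" "closed K" "K \<subseteq> S" and f: "\<And>x. x \<in> S \<Longrightarrow> (f has_derivative f' x) (at x)"
    and "\<And>x. x \<in> S - K \<Longrightarrow> f x = 0"
  shows "((\<lambda>x. if x \<in> S then f x else 0) has_derivative (if x \<in> S then f' x else (\<lambda>h. 0))) (at x)"
proof (cases "x \<in> S")
  case True
  have "((\<lambda>x. if x \<in> S then f x else 0) has_derivative f' x) (at x)"
    by (rule has_derivative_transform_within_open[OF f[OF True] assms(1) True]) auto
  then show ?thesis using True by simp
next
  case False
  then have "x \<in> - K" using assms by auto
  have "((\<lambda>_. 0) has_derivative (\<lambda>h. 0)) (at x)" by simp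
  then have "((\<lambda>x. if x \<in> S then f x else 0) has_derivative (\<lambda>h. 0)) (at x)"
    by (rule has_derivative_transform_within_open[OF _ _ \<open>x \<in> - K\<close>]) (use assms in auto)
  then show ?thesis using False by simp
qed

lemma has_derivative_zero_outside_support:
  assumes "(\<phi> has_derivative D) (at x)" "closed K" "x \<notin> K" "\<And>y. y \<notin> K \<Longrightarrow> \<phi> y = 0"
  shows "D = (\<lambda>h. 0)"
proof -
  have "((\<lambda>_. 0) has_derivative D) (at x)"
    by (rule has_derivative_transform_within_open[OF assms(1), of "- K"]) (use assms in auto)
  then show ?thesis by (rule has_derivative_unique) simp
qed

text \<open>Nothing is known about v at the boundary of S. Its product with \<phi> vanishes off K,
  so the extension by 0 is differentiable on the whole space with a continuous derivative in
  direction i, and that derivative integrates to 0.\<close>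

theorem integration_by_parts_compact_support:
  fixes v \<phi> :: "'a::euclidean_space \<Rightarrow> real"
  assumes S: "open S"
    and v: "\<And>x. x \<in> S \<Longrightarrow> (v has_derivative v' x) (at x)" and cv: "continuous_on S (\<lambda>x. v' x i)"
    and \<phi>: "\<And>x. (\<phi> has_derivative \<phi>' x) (at x)" and c\<phi>: "continuous_on UNIV (\<lambda>x. \<phi>' x i)"
    and K: "compact K" "K \<subseteq> S" and supp: "\<And>x. x \<notin> K \<Longrightarrow> \<phi> x = 0"
  shows "integral\<^sup>L (lebesgue_on S) (\<lambda>x. v x * \<phi>' x i) = - integral\<^sup>L (lebesgue_on S) (\<lambda>x. v' x i * \<phi> x)"
proof -
  have clK: "closed K" using K by (simp add: compact_imp_closed)
  have p0: "\<phi>' x = (\<lambda>h. 0)" if "x \<notin> K" for x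
    by (rule has_derivative_zero_outside_support[OF \<phi> clK that supp])
  have cv0: "continuous_on S v" by (rule has_derivative_continuous_on) (rule has_derivative_at_withinI[OF v])
  have cp0: "continuous_on S \<phi>" for S by (rule has_derivative_continuous_on) (rule has_derivative_at_withinI[OF \<phi>])
  have cpi: "continuous_on S (\<lambda>x. \<phi>' x i)" for S using c\<phi> by (rule continuous_on_subset) auto
  define F where "F x = (if x \<in> S then v x * \<phi> x else 0)" for x
  define G where "G x = (if x \<in> S then v x * \<phi>' x i else 0)" for x
  define H where "H x = (if x \<in> S then v' x i * \<phi> x else 0)" for x
  have cont: "continuous_on UNIV F" "continuous_on UNIV G" "continuous_on UNIV H"
    unfolding F_def G_def H_def using supp p0
    by (auto intro!: continuous_on_extend_zero[OF S clK K(2)] continuous_intros cv0 cp0 cpi cv)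
  have zero: "F x = 0" "G x = 0" "H x = 0" if "x \<notin> K" for x
    using supp[OF that] p0[OF that] by (auto simp: F_def G_def H_def)
  have int: "integrable lborel G" "integrable lborel H"
    by (auto intro!: integrable_continuous_compact_support[OF cont(2) K(1)] integrable_continuous_compact_support[OF cont(3) K(1)] zero)
  have dF: "(F has_derivative (if x \<in> S then (\<lambda>h. v x * \<phi>' x h + v' x h * \<phi> x) else (\<lambda>h. 0))) (at x)" for x
    unfolding F_def using supp
    by (intro has_derivative_extend_zero[OF S clK K(2)] has_derivative_mult v \<phi>) auto
  have "integral\<^sup>L lborel (\<lambda>x. G x + H x) = 0"
  proof (rule integral_directional_derivative_zero[where i = i and F = F and K = K])
    fix x
    have *: "((\<lambda>t. x + t *\<^sub>R i) has_derivative (\<lambda>t. t *\<^sub>R i)) (at 0)"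
      by (auto intro!: derivative_eq_intros)
    let ?D = "if x \<in> S then (\<lambda>h. v x * \<phi>' x h + v' x h * \<phi> x) else (\<lambda>h. 0)"
    have "(F has_derivative ?D) (at (x + 0 *\<^sub>R i))"
      using dF[of x] by simp
    from has_derivative_compose[OF * this]
    have "((\<lambda>t. F (x + t *\<^sub>R i)) has_derivative (\<lambda>t. ?D (t *\<^sub>R i))) (at 0)" .
    moreover have "(\<lambda>t. ?D (t *\<^sub>R i)) = (*) (G x + H x)"
    proof (cases "x \<in> S")
      case True
      have "linear (\<phi>' x)" "linear (v' x)" using has_derivative_linear[OF \<phi>] has_derivative_linear[OF v[OF True]] by auto
      then show ?thesis using True by (auto simp: fun_eq_iff G_def H_def linear_cmul algebra_simps)
    qed (auto simp: G_def H_def fun_eq_iff)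
    ultimately show "((\<lambda>t. F (x + t *\<^sub>R i)) has_real_derivative G x + H x) (at 0)"
      by (simp add: has_field_derivative_def)
  qed (use cont zero K in \<open>auto intro!: continuous_intros\<close>)
  then have "integral\<^sup>L lborel G = - integral\<^sup>L lborel H" using int by simp
  moreover have "integral\<^sup>L (lebesgue_on S) (\<lambda>x. v x * \<phi>' x i) = integral\<^sup>L lborel G"
  proof -
    have "integral\<^sup>L (lebesgue_on S) (\<lambda>x. v x * \<phi>' x i) = integral\<^sup>L lebesgue G"
      using S by (subst integral_restrict_space) (auto simp: G_def indicator_def intro!: Bochner_Integration.integral_cong)
    also have "\<dots> = integral\<^sup>L lborel G" using int(1) by (intro integral_completion) auto
    finally show ?thesis .
  qed
  moreover have "integral\<^sup>L (lebesgue_on S) (\<lambda>x. v' x i * \<phi> x) = integral\<^sup>L lborel H"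
  proof -
    have "integral\<^sup>L (lebesgue_on S) (\<lambda>x. v' x i * \<phi> x) = integral\<^sup>L lebesgue H"
      using S by (subst integral_restrict_space) (auto simp: H_def indicator_def intro!: Bochner_Integration.integral_cong)
    also have "\<dots> = integral\<^sup>L lborel H" using int(2) by (intro integral_completion) auto
    finally show ?thesis .
  qed
  ultimately show ?thesis by simp
qed

lemma test_fun_deriv:
  assumes "test_fun S \<phi>"
  shows "(\<phi> has_derivative frechet_derivative \<phi> (at x)) (at x)"
    and "i \<in> Basis \<Longrightarrow> test_fun S (partial i \<phi>)"
    and "i \<in> Basis \<Longrightarrow> continuous_on UNIV (partial i \<phi>)"
    and "continuous_on UNIV \<phi>"
proof -
  have Ck: "Ck k \<phi>" for k using assms by (auto simp: test_fun_def smooth_def)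
  show d: "(\<phi> has_derivative frechet_derivative \<phi> (at x)) (at x)" for x
    using Ck[of 1] by (simp flip: frechet_derivative_works)
  show "continuous_on UNIV \<phi>" using Ck[of 0] by simp
  assume i: "i \<in> Basis"
  have Ckp: "Ck k (partial i \<phi>)" for k using Ck[of "Suc k"] i by simp
  show "continuous_on UNIV (partial i \<phi>)" using Ckp[of 0] by simp
  let ?K = "closure {x. \<phi> x \<noteq> 0}"
  have "partial i \<phi> x = 0" if "x \<notin> ?K" for x
  proof -
    have "frechet_derivative \<phi> (at x) = (\<lambda>h. 0)"
      by (rule has_derivative_zero_outside_support[OF d closed_closure that])
        (use closure_subset[of "{x. \<phi> x \<noteq> 0}"] in auto)
    then show ?thesis by (simp add: partial_def)
  qed
  then have sub: "closure {x. partial i \<phi> x \<noteq> 0} \<subseteq> ?K" by (intro closure_minimal) auto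
  then have "compact (closure {x. partial i \<phi> x \<noteq> 0})"
    using compact_Int_closed[of ?K "closure {x. partial i \<phi> x \<noteq> 0}"] assms
    by (simp add: test_fun_def Int_absorb1)
  then show "test_fun S (partial i \<phi>)"
    using Ckp sub assms by (auto simp: test_fun_def smooth_def)
qed

lemma weak_partial_C1:
  fixes v :: "'a::euclidean_space \<Rightarrow> real"
  assumes S: "open S" and v: "\<And>x. x \<in> S \<Longrightarrow> (v has_derivative v' x) (at x)"
    and cv: "continuous_on S (\<lambda>x. v' x i)" and i: "i \<in> Basis"
  shows "weak_partial S i v (\<lambda>x. v' x i)"
  unfolding weak_partial_def
proof (intro allI impI)
  fix \<phi> :: "'a \<Rightarrow> real" assume t: "test_fun S \<phi>"
  show "integral\<^sup>L (lebesgue_on S) (\<lambda>x. v x * partial i \<phi> x) = - integral\<^sup>L (lebesgue_on S) (\<lambda>x. v' x i * \<phi> x)"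
    unfolding partial_def
  proof (rule integration_by_parts_compact_support[OF S v cv test_fun_deriv(1)[OF t]])
    show "continuous_on UNIV (\<lambda>x. frechet_derivative \<phi> (at x) i)"
      using test_fun_deriv(3)[OF t i] unfolding partial_def[abs_def] .
    show "\<phi> x = 0" if "x \<notin> closure {x. \<phi> x \<noteq> 0}" for x
      using that closure_subset[of "{x. \<phi> x \<noteq> 0}"] by auto
  qed (use t in \<open>auto simp: test_fun_def\<close>)
qed

subsection \<open>Weak second derivatives of radial functions\<close>

text \<open>If \<open>u x = U (norm x)\<close> with \<open>U' = W\<close>, \<open>W t = - mean_slope N \<beta> t\<close>, then \<open>- \<Delta> u = \<beta> (norm x)\<close>;
  \<open>radial_grad\<close> and \<open>radial_hess\<close> are the entries of the gradient and of the Hessian of \<open>u\<close>.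
  At the origin all quotients are \<open>0\<close>.\<close>

definition mean_slope :: "nat \<Rightarrow> (real \<Rightarrow> real) \<Rightarrow> real \<Rightarrow> real" where
  "mean_slope N \<beta> t = integral {0..t} (\<lambda>s. s ^ (N - 1) * \<beta> s) / t ^ (N - 1)"

definition radial_grad :: "(real \<Rightarrow> real) \<Rightarrow> 'a::euclidean_space \<Rightarrow> 'a \<Rightarrow> real" where
  "radial_grad \<beta> i x = - mean_slope DIM('a) \<beta> (norm x) / norm x * (x \<bullet> i)"

definition radial_hess :: "(real \<Rightarrow> real) \<Rightarrow> 'a::euclidean_space \<Rightarrow> 'a \<Rightarrow> 'a \<Rightarrow> real" where
  "radial_hess \<beta> i j x = - mean_slope DIM('a) \<beta> (norm x) / norm x * (i \<bullet> j)
     - (\<beta> (norm x) - real DIM('a) * (mean_slope DIM('a) \<beta> (norm x) / norm x)) * (x \<bullet> i) * (x \<bullet> j) / (norm x)\<^sup>2"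

lemma mean_slope_bound:
  assumes "1 \<le> N" "\<beta> \<in> borel_measurable borel" "\<And>s. \<bar>\<beta> s\<bar> \<le> C" "0 \<le> t"
  shows "\<bar>mean_slope N \<beta> t\<bar> \<le> C * t"
proof -
  interpret radial_weight N 1 C \<beta> using assms by unfold_locales auto
  show ?thesis
    using slope_bound[of t "\<lambda>_. 1" 1] assms(4) by (simp add: slope_def flux_def mean_slope_def)
qed

lemma mean_slope_div_bound:
  assumes "1 \<le> N" "\<beta> \<in> borel_measurable borel" "\<And>s. \<bar>\<beta> s\<bar> \<le> C" "0 \<le> t"
  shows "\<bar>mean_slope N \<beta> t / t\<bar> \<le> C"
proof (cases "t = 0")
  case False
  then show ?thesis using mean_slope_bound[OF assms] assms(4) by (simp add: abs_divide divide_le_eq)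
qed (use assms(3)[of 0] in simp)

lemma radial_grad_bound:
  fixes x :: "'a::euclidean_space"
  assumes "\<beta> \<in> borel_measurable borel" "\<And>s. \<bar>\<beta> s\<bar> \<le> C" "i \<in> Basis"
  shows "\<bar>radial_grad \<beta> i x\<bar> \<le> C * norm x"
proof -
  have "\<bar>mean_slope DIM('a) \<beta> (norm x) / norm x\<bar> * \<bar>x \<bullet> i\<bar> \<le> C * norm x"
    using assms by (intro mult_mono mean_slope_div_bound Basis_le_norm) (auto simp: Suc_leI intro: order_trans[OF abs_ge_zero])
  then show ?thesis by (simp add: radial_grad_def abs_mult)
qed

lemma radial_hess_bound:
  fixes x :: "'a::euclidean_space"
  assumes b: "\<beta> \<in> borel_measurable borel" "\<And>s. \<bar>\<beta> s\<bar> \<le> C" and i: "i \<in> Basis" and j: "j \<in> Basis"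
  shows "\<bar>radial_hess \<beta> i j x\<bar> \<le> (real DIM('a) + 2) * C"
proof -
  have C: "0 \<le> C" using order_trans[OF abs_ge_zero b(2)] .
  define m where "m = mean_slope DIM('a) \<beta> (norm x) / norm x"
  define p where "p = (x \<bullet> i) * (x \<bullet> j) / (norm x)\<^sup>2"
  have m: "\<bar>m\<bar> \<le> C" unfolding m_def by (rule mean_slope_div_bound) (use b in \<open>auto simp: Suc_leI\<close>)
  have p: "\<bar>p\<bar> \<le> 1"
  proof (cases "x = 0")
    case False
    have "\<bar>x \<bullet> i\<bar> * \<bar>x \<bullet> j\<bar> \<le> norm x * norm x" using i j by (intro mult_mono Basis_le_norm) auto
    then show ?thesis using False by (simp add: p_def abs_mult power2_eq_square divide_le_eq)
  qed (simp add: p_def)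
  have d: "\<bar>i \<bullet> j\<bar> \<le> 1" using i j by (simp add: inner_Basis)
  have 1: "\<bar>- m * (i \<bullet> j)\<bar> \<le> C * 1" unfolding abs_mult using m d C by (intro mult_mono) auto
  have "\<bar>\<beta> (norm x) - real DIM('a) * m\<bar> \<le> C + real DIM('a) * C"
    using b(2)[of "norm x"] mult_left_mono[OF m, of "real DIM('a)"]
    by (intro order_trans[OF abs_triangle_ineq4] add_mono) (auto simp: abs_mult)
  then have 2: "\<bar>(\<beta> (norm x) - real DIM('a) * m) * p\<bar> \<le> (C + real DIM('a) * C) * 1"
    unfolding abs_mult using p C by (intro mult_mono) auto
  have "radial_hess \<beta> i j x = - m * (i \<bullet> j) - (\<beta> (norm x) - real DIM('a) * m) * p"
    by (simp add: radial_hess_def m_def p_def)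
  also have "\<bar>\<dots>\<bar> \<le> C * 1 + (C + real DIM('a) * C) * 1"
    by (rule order_trans[OF abs_triangle_ineq4]) (intro add_mono 1 2)
  finally show ?thesis by (simp add: algebra_simps)
qed

text \<open>The identity part contributes - N m and the rank-one part returns + N m, so the nonlocal
  term cancels and only \<beta> remains.\<close>

lemma radial_hess_trace:
  fixes x :: "'a::euclidean_space"
  assumes "x \<noteq> 0"
  shows "(\<Sum>i\<in>Basis. radial_hess \<beta> i i x) = - \<beta> (norm x)"
proof -
  define m where "m = mean_slope DIM('a) \<beta> (norm x) / norm x"
  have "(\<Sum>i\<in>Basis. (x \<bullet> i) * (x \<bullet> i)) = (norm x)\<^sup>2"
    by (simp add: power2_norm_eq_inner flip: euclidean_inner)
  then have s: "(\<Sum>i\<in>Basis. (x \<bullet> i) * (x \<bullet> i) / (norm x)\<^sup>2) = 1"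
    using assms by (simp flip: sum_divide_distrib)
  have "(\<Sum>i\<in>Basis. radial_hess \<beta> i i x)
      = (\<Sum>i\<in>(Basis::'a set). - m - (\<beta> (norm x) - real DIM('a) * m) * ((x \<bullet> i) * (x \<bullet> i) / (norm x)\<^sup>2))"
    by (intro sum.cong) (auto simp: radial_hess_def m_def)
  also have "\<dots> = - real DIM('a) * m - (\<beta> (norm x) - real DIM('a) * m) * 1"
    unfolding s[symmetric] by (simp add: sum_subtractf sum_distrib_left)
  finally show ?thesis by simp
qed

lemma mean_slope_deriv:
  assumes "continuous_on UNIV \<beta>" "0 < t"
  shows "(mean_slope N \<beta> has_real_derivative \<beta> t - real (N - 1) * (mean_slope N \<beta> t / t)) (at t)"
proof -
  define I where "I t = integral {0..t} (\<lambda>s. s ^ (N - 1) * \<beta> s)" for t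
  have "continuous_on {0..t+1} (\<lambda>s. s ^ (N - 1) * \<beta> s)"
    by (intro continuous_intros continuous_on_subset[OF assms(1)]) auto
  from integral_has_real_derivative[OF this, of t] have I: "(I has_real_derivative t ^ (N - 1) * \<beta> t) (at t)"
    unfolding I_def using assms(2) by (simp add: at_within_Icc_at)
  have "((\<lambda>t. I t / t ^ (N - 1)) has_real_derivative
      (t ^ (N - 1) * \<beta> t * t ^ (N - 1) - I t * (real (N - 1) * t ^ (N - 1 - 1))) / (t ^ (N - 1) * t ^ (N - 1))) (at t)"
    using assms(2) by (auto intro!: derivative_eq_intros I)
  moreover have "(t ^ (N - 1) * \<beta> t * t ^ (N - 1) - I t * (real (N - 1) * t ^ (N - 1 - 1))) / (t ^ (N - 1) * t ^ (N - 1))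
      = \<beta> t - real (N - 1) * (I t / t ^ (N - 1) / t)"
  proof (cases "N - 1")
    case (Suc k)
    then show ?thesis using assms(2) by (simp add: field_simps)
  qed simp
  moreover have "mean_slope N \<beta> = (\<lambda>t. I t / t ^ (N - 1))" by (simp add: mean_slope_def I_def fun_eq_iff)
  ultimately show ?thesis by simp
qed

text \<open>Continuity of \<beta> makes the derivatives classical, and its vanishing near 0 makes
  the quotients that are singular at the origin vanish on a whole ball.\<close>

lemma radial_grad_C1:
  fixes i :: "'a::euclidean_space"
  assumes cont: "continuous_on UNIV \<beta>" and e: "0 < e" and z: "\<And>s. s \<le> e \<Longrightarrow> \<beta> s = 0"
  shows "(radial_grad \<beta> i has_derivative (\<lambda>h. radial_hess \<beta> i h x)) (at x)"
    and "continuous_on UNIV (radial_hess \<beta> i j)"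
proof -
  define m where "m = mean_slope DIM('a) \<beta>"
  have N: "1 \<le> DIM('a)" by (simp add: Suc_leI)
  have m0: "m t = 0" if "t \<le> e" for t
  proof -
    have "integral {0..t} (\<lambda>s. s ^ (DIM('a) - 1) * \<beta> s) = integral {0..t} (\<lambda>s. 0)"
      by (rule Henstock_Kurzweil_Integration.integral_cong) (use that z in auto)
    then show ?thesis by (simp add: m_def mean_slope_def)
  qed
  have g0: "radial_grad \<beta> i x = 0" "radial_hess \<beta> i j x = 0" if "norm x \<le> e" for x i j :: 'a
    using m0[OF that] z[OF that] by (simp_all add: radial_grad_def radial_hess_def m_def)
  have cm: "continuous_on {0<..} m"
    unfolding m_def using mean_slope_deriv[OF cont]
    by (intro continuous_at_imp_continuous_on ballI) (auto intro: DERIV_isCont)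
  show "(radial_grad \<beta> i has_derivative (\<lambda>h. radial_hess \<beta> i h x)) (at x)"
  proof (cases "norm x < e")
    case True
    have "((\<lambda>_. 0) has_derivative (\<lambda>h. 0)) (at x)" by simp
    then have "(radial_grad \<beta> i has_derivative (\<lambda>h. 0)) (at x)"
      by (rule has_derivative_transform_within_open[of _ _ _ _ "ball 0 e"]) (use True g0 in auto)
    moreover have "(\<lambda>h. radial_hess \<beta> i h x) = (\<lambda>h. 0)" using True g0 by (auto simp: fun_eq_iff)
    ultimately show ?thesis by simp
  next
    case False
    then have x: "x \<noteq> 0" "0 < norm x" using e by auto
    define r where "r = norm x"
    have r: "0 < r" using x by (simp add: r_def)
    define Q where "Q t = - m t / t" for t
    have dQ: "(Q has_real_derivative (- (\<beta> r - real (DIM('a) - 1) * (m r / r)) * r + m r) / (r * r)) (at r)"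
      unfolding Q_def m_def using r
      by (auto intro!: derivative_eq_intros mean_slope_deriv[OF cont] simp: field_simps)
    have "(Q has_derivative (*) ((- (\<beta> r - real (DIM('a) - 1) * (m r / r)) * r + m r) / (r * r))) (at (norm x))"
      using dQ by (simp add: has_field_derivative_def r_def)
    from has_derivative_compose[OF has_derivative_norm[OF x(1)] this]
    have "((\<lambda>x. Q (norm x) * (x \<bullet> i)) has_derivative (\<lambda>h. Q (norm x) * (h \<bullet> i)
       + (- (\<beta> r - real (DIM('a) - 1) * (m r / r)) * r + m r) / (r * r) * (sgn x \<bullet> h) * (x \<bullet> i))) (at x)"
      by (auto intro!: derivative_eq_intros simp: inner_commute)
    moreover have "(\<lambda>x. Q (norm x) * (x \<bullet> i)) = radial_grad \<beta> i"
      by (auto simp: radial_grad_def Q_def m_def fun_eq_iff)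
    moreover have "Q (norm x) * (h \<bullet> i)
       + (- (\<beta> r - real (DIM('a) - 1) * (m r / r)) * r + m r) / (r * r) * (sgn x \<bullet> h) * (x \<bullet> i) = radial_hess \<beta> i h x" for h
    proof -
      define c where "c = \<beta> r - real DIM('a) * (m r / r)"
      have 1: "(- (\<beta> r - real (DIM('a) - 1) * (m r / r)) * r + m r) / (r * r) = - c / r"
        using r N by (simp add: c_def of_nat_diff field_simps)
      have 2: "sgn x \<bullet> h = (x \<bullet> h) / r" by (simp add: sgn_div_norm r_def divide_inverse mult.commute)
      have 3: "radial_hess \<beta> i h x = - m r / r * (i \<bullet> h) - c * (x \<bullet> i) * (x \<bullet> h) / r\<^sup>2"
        by (simp add: radial_hess_def m_def r_def c_def)
      show ?thesis unfolding 1 2 3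
        by (simp add: Q_def r_def[symmetric] power2_eq_square inner_commute[of h i])
    qed
    ultimately show ?thesis by simp
  qed
  have "continuous_on (ball 0 e \<union> - {0}) (radial_hess \<beta> i j)"
  proof (rule continuous_on_open_Un)
    show "continuous_on (ball 0 e) (radial_hess \<beta> i j)"
      by (rule continuous_on_eq[of _ "\<lambda>_. 0"]) (use g0 in auto)
    have c1: "continuous_on (- {0}) (\<lambda>x::'a. m (norm x))"
      by (rule continuous_on_compose2[OF cm]) (auto intro!: continuous_intros)
    have c2: "continuous_on (- {0}) (\<lambda>x::'a. \<beta> (norm x))"
      by (rule continuous_on_compose2[OF cont]) (auto intro!: continuous_intros)
    show "continuous_on (- {0}) (radial_hess \<beta> i j)"
      unfolding radial_hess_def m_def[symmetric]
      by (intro continuous_intros c1 c2) auto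
  qed auto
  moreover have "ball 0 e \<union> - {0} = (UNIV :: 'a set)" using e by auto
  ultimately show "continuous_on UNIV (radial_hess \<beta> i j)" by simp
qed

text \<open>Supplies data for which the Hessian formula is classical. Clipping to [-C, C] keeps the
  bound, and the factor \<open>k\<close> vanishes on a neighbourhood of 0 that shrinks with
  n.\<close>

lemma continuous_approximation_off_zero:
  fixes \<beta> :: "real \<Rightarrow> real"
  assumes b: "\<beta> \<in> borel_measurable borel" "\<And>s. \<bar>\<beta> s\<bar> \<le> C"
  obtains \<gamma> Z where "negligible Z" "\<And>n. continuous_on UNIV (\<gamma> n)" "\<And>n s. \<bar>\<gamma> n s\<bar> \<le> C"
    "\<And>n s. s \<le> 1 / real (Suc n) \<Longrightarrow> \<gamma> n s = 0"
    "\<And>s. 0 < s \<Longrightarrow> s \<notin> Z \<Longrightarrow> (\<lambda>n. \<gamma> n s) \<longlonglongrightarrow> \<beta> s"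
proof -
  have C: "0 \<le> C" using order_trans[OF abs_ge_zero b(2)] .
  have "\<beta> measurable_on UNIV"
    using b(1) by (intro lebesgue_measurable_imp_measurable_on) (auto simp: lebesgue_on_UNIV_eq intro: measurable_completion)
  then obtain Z g where Z: "negligible Z" and g: "\<And>n. continuous_on UNIV (g n)"
    "\<And>x. x \<notin> Z \<Longrightarrow> (\<lambda>n. g n x) \<longlonglongrightarrow> \<beta> x"
    unfolding measurable_on_def by auto
  define k where "k n s = max 0 (min 1 (real (Suc n) * s - 1))" for n s
  define \<gamma> where "\<gamma> n s = max (- C) (min C (g n s)) * k n s" for n s
  have kb: "0 \<le> k n s" "k n s \<le> 1" for n s by (auto simp: k_def)
  show thesis
  proof (rule that[OF Z])
    show "continuous_on UNIV (\<gamma> n)" for n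
      unfolding \<gamma>_def k_def by (intro continuous_intros g)
    show "\<bar>\<gamma> n s\<bar> \<le> C" for n s
    proof -
      have "\<bar>max (- C) (min C (g n s))\<bar> * \<bar>k n s\<bar> \<le> C * 1" using C kb[of n s] by (intro mult_mono) auto
      then show ?thesis by (simp add: \<gamma>_def abs_mult)
    qed
    show "\<gamma> n s = 0" if "s \<le> 1 / real (Suc n)" for n s
    proof -
      have "real (Suc n) * s \<le> 1" using that by (simp add: field_simps)
      then have "k n s = 0" by (simp add: k_def)
      then show ?thesis by (simp add: \<gamma>_def)
    qed
    show "(\<lambda>n. \<gamma> n s) \<longlonglongrightarrow> \<beta> s" if s: "0 < s" "s \<notin> Z" for s
    proof -
      have "(\<lambda>n. max (- C) (min C (g n s))) \<longlonglongrightarrow> max (- C) (min C (\<beta> s))"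
        by (intro tendsto_intros g s)
      moreover have "max (- C) (min C (\<beta> s)) = \<beta> s" using b(2)[of s] by auto
      moreover have "(\<lambda>n. k n s) \<longlonglongrightarrow> 1"
      proof (rule tendsto_eventually)
        obtain m :: nat where m: "2 / s < real m" using reals_Archimedean2 by blast
        show "\<forall>\<^sub>F n in sequentially. k n s = 1"
          using eventually_ge_at_top[of m]
        proof eventually_elim
          case (elim n)
          have "2 / s < real (Suc n)" using m elim by simp
          then have "2 < real (Suc n) * s" using s by (simp add: divide_less_eq)
          then show ?case by (simp add: k_def)
        qed
      qed
      ultimately show ?thesis unfolding \<gamma>_def using tendsto_mult[of _ "\<beta> s" sequentially "\<lambda>n. k n s" 1] by simp
    qed
  qed
qed

lemma mean_slope_tendsto:
  assumes Z: "negligible Z" and c: "\<And>n. continuous_on UNIV (\<gamma> n)" and bd: "\<And>n s. \<bar>\<gamma> n s\<bar> \<le> C"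
    and lim: "\<And>s. 0 < s \<Longrightarrow> s \<notin> Z \<Longrightarrow> (\<lambda>n. \<gamma> n s) \<longlonglongrightarrow> \<beta> s"
  shows "(\<lambda>n. mean_slope N (\<gamma> n) t) \<longlonglongrightarrow> mean_slope N \<beta> t"
proof -
  let ?f = "\<lambda>\<beta> s. s ^ (N - 1) * \<beta> s :: real"
  \<comment> \<open>Removing 0 and the null set leaves the integrals unchanged and turns almost
    everywhere convergence into convergence at every point.\<close>
  define S where "S = {0..t} - insert 0 Z"
  have neg: "negligible (insert 0 Z)" using Z by simp
  have eq: "integral {0..t} (?f \<beta>) = integral S (?f \<beta>)" for \<beta>
    by (rule integral_spike_set) (auto simp: S_def intro: negligible_subset[OF neg])
  have inS: "?f (\<gamma> n) integrable_on S" for n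
  proof -
    have "?f (\<gamma> n) integrable_on {0..t}"
      by (intro integrable_continuous_interval continuous_intros continuous_on_subset[OF c]) auto
    then show ?thesis
      by (rule integrable_spike_set) (auto simp: S_def intro: negligible_subset[OF neg])
  qed
  have "(\<lambda>n. integral S (?f (\<gamma> n))) \<longlonglongrightarrow> integral S (?f \<beta>)"
  proof (rule dominated_convergence(2)[OF inS])
    have "(\<lambda>s. s ^ (N - 1) * C) integrable_on {0..t}"
      by (intro integrable_continuous_interval continuous_intros)
    then show "(\<lambda>s. s ^ (N - 1) * C) integrable_on S"
      by (rule integrable_spike_set) (auto simp: S_def intro: negligible_subset[OF neg])
    show "norm (?f (\<gamma> k) x) \<le> x ^ (N - 1) * C" if "x \<in> S" for k x
      using that bd[of k x] by (auto simp: S_def abs_mult intro!: mult_left_mono)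
    show "(\<lambda>k. ?f (\<gamma> k) x) \<longlonglongrightarrow> ?f \<beta> x" if "x \<in> S" for x
      using that by (intro tendsto_intros lim) (auto simp: S_def)
  qed
  then show ?thesis unfolding mean_slope_def eq by (simp add: divide_inverse tendsto_mult_right)
qed

text \<open>A discontinuous \<beta> admits second derivatives only in the weak sense. The identity
  is classical for the regular approximations; their gradients and Hessians are uniformly bounded
  and converge almost everywhere, so dominated convergence against a test function carries it
  over.\<close>

theorem radial_weak_hessian:
  fixes i j :: "'a::euclidean_space"
  assumes b: "\<beta> \<in> borel_measurable borel" "\<And>s. \<bar>\<beta> s\<bar> \<le> C" and R: "0 < R"
    and i: "i \<in> Basis" and j: "j \<in> Basis"
  shows "radial_grad \<beta> i \<in> borel_measurable borel"
    and "radial_hess \<beta> i j \<in> borel_measurable borel"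
    and "weak_partial (ball 0 R) j (radial_grad \<beta> i) (radial_hess \<beta> i j)"
proof -
  have N: "1 \<le> DIM('a)" by (simp add: Suc_leI)
  obtain \<gamma> Z where Z: "negligible Z" and c: "\<And>n. continuous_on UNIV (\<gamma> n)" and bd: "\<And>n s. \<bar>\<gamma> n s\<bar> \<le> C"
    and z: "\<And>n s. s \<le> 1 / real (Suc n) \<Longrightarrow> \<gamma> n s = 0"
    and lim: "\<And>s. 0 < s \<Longrightarrow> s \<notin> Z \<Longrightarrow> (\<lambda>n. \<gamma> n s) \<longlonglongrightarrow> \<beta> s"
    by (rule continuous_approximation_off_zero[OF b]) (rule that)
  have gb: "\<gamma> n \<in> borel_measurable borel" for n using c by (simp add: borel_measurable_continuous_onI)
  have e: "0 < 1 / real (Suc n)" for n by simp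
  have C1: "(radial_grad (\<gamma> n) i has_derivative (\<lambda>h. radial_hess (\<gamma> n) i h x)) (at x)" for n i and x :: 'a
    by (rule radial_grad_C1(1)[OF c e z])
  have C2: "continuous_on UNIV (radial_hess (\<gamma> n) i j)" for n and i j :: 'a
    by (rule radial_grad_C1(2)[OF c e z])
  have mlim: "(\<lambda>n. mean_slope DIM('a) (\<gamma> n) t) \<longlonglongrightarrow> mean_slope DIM('a) \<beta> t" for t
    by (rule mean_slope_tendsto[OF Z c bd lim])
  have glim: "(\<lambda>n. radial_grad (\<gamma> n) i x) \<longlonglongrightarrow> radial_grad \<beta> i x" for x
    unfolding radial_grad_def by (cases "x = 0") (auto intro!: tendsto_intros mlim)
  have cgrad: "continuous_on UNIV (radial_grad (\<gamma> n) i)" for n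
    by (rule has_derivative_continuous_on) (rule has_derivative_at_withinI[OF C1])
  show mg: "radial_grad \<beta> i \<in> borel_measurable borel"
    by (rule borel_measurable_LIMSEQ_real[OF glim]) (use cgrad in \<open>auto intro: borel_measurable_continuous_onI\<close>)
  have mm: "(\<lambda>x::'a. mean_slope DIM('a) \<beta> (norm x)) \<in> borel_measurable borel"
  proof (rule borel_measurable_LIMSEQ_real[OF mlim])
    fix n
    have "continuous_on UNIV (\<lambda>x::'a. mean_slope DIM('a) (\<gamma> n) (norm x))"
    proof -
      \<comment> \<open>Continuity is available on compact intervals. The sets
        \<open>{0..<b}\<close> are relatively open in \<open>{0..}\<close>, so limits within the two
        sets agree.\<close>
      have "continuous_on {0..} (mean_slope DIM('a) (\<gamma> n))"
      proof -
        interpret radial_weight "DIM('a)" 1 C "\<gamma> n" using N gb bd by unfold_locales auto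
        have *: "slope (\<lambda>_. 1) = mean_slope DIM('a) (\<gamma> n)" by (simp add: slope_def flux_def mean_slope_def fun_eq_iff)
        have cc: "continuous_on {0..b} (mean_slope DIM('a) (\<gamma> n))" for b
          using slope_continuous_on[of b "\<lambda>_. 1"] unfolding * by simp
        have "continuous_on {0..<b} (mean_slope DIM('a) (\<gamma> n))" for b
          by (rule continuous_on_subset[OF cc[of b]]) auto
        then show ?thesis
          unfolding continuous_on_eq_continuous_within
        proof (intro ballI)
          fix t :: real assume h: "\<And>b. \<forall>x\<in>{0..<b}. continuous (at x within {0..<b}) (mean_slope DIM('a) (\<gamma> n))" and t: "t \<in> {0..}"
          have "continuous (at t within {0..<t+1}) (mean_slope DIM('a) (\<gamma> n))" using h[of "t+1"] t by auto
          moreover have "at t within {0..<t+1} = at t within {0..}"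
            by (rule at_within_nhd[of _ "{..<t+1}"]) auto
          ultimately show "continuous (at t within {0..}) (mean_slope DIM('a) (\<gamma> n))" by simp
        qed
      qed
      then show ?thesis by (rule continuous_on_compose2) (auto intro!: continuous_intros)
    qed
    then show "(\<lambda>x::'a. mean_slope DIM('a) (\<gamma> n) (norm x)) \<in> borel_measurable borel"
      by (rule borel_measurable_continuous_onI)
  qed
  show mh: "radial_hess \<beta> i j \<in> borel_measurable borel"
  proof -
    have "(\<lambda>x::'a. \<beta> (norm x)) \<in> borel_measurable borel" using b(1) by measurable
    then show ?thesis unfolding radial_hess_def using mm by measurable
  qed
  \<comment> \<open>A null set of radii gives a null set of points. \<open>AE_ball_norm_iff\<close>
    asks for a Borel set, hence the enlargement Z' of Z.\<close>
  have Zb: "AE x in lebesgue_on (ball (0::'a) R). norm x \<notin> Z \<and> x \<noteq> 0"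
  proof -
    obtain Z' where Z': "Z' \<in> null_sets lborel" "Z \<subseteq> Z'"
      using Z by (auto simp: negligible_iff_null_sets null_sets_completion_iff2)
    have "AE r in lborel. r \<in> {0..R} \<longrightarrow> r \<notin> Z'" using AE_not_in[OF Z'(1)] by eventually_elim auto
    moreover have "{r. r \<notin> Z'} \<in> sets borel" using Z' by (auto simp: Compl_eq[symmetric] null_sets_def)
    ultimately have "AE x in lebesgue_on (ball (0::'a) R). norm x \<notin> Z'"
      using AE_ball_norm_iff[OF R, of "\<lambda>r. r \<notin> Z'", where 'a='a] by simp
    moreover have "AE x in lebesgue_on (ball (0::'a) R). x \<noteq> 0"
      using AE_lborel_singleton[of "0::'a"]
      by (simp add: AE_restrict_space_iff AE_completion_iff) (auto elim: eventually_mono)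
    ultimately show ?thesis by eventually_elim (use Z' in auto)
  qed
  have hlim: "AE x in lebesgue_on (ball (0::'a) R). (\<lambda>n. radial_hess (\<gamma> n) i j x) \<longlonglongrightarrow> radial_hess \<beta> i j x"
    using Zb
  proof eventually_elim
    case (elim x)
    then have x: "0 < norm x" "norm x \<noteq> 0" "(norm x)\<^sup>2 \<noteq> 0" by auto
    show ?case unfolding radial_hess_def
      by (intro tendsto_intros mlim lim) (use elim x in auto)
  qed
  show "weak_partial (ball 0 R) j (radial_grad \<beta> i) (radial_hess \<beta> i j)"
    unfolding weak_partial_def
  proof (intro allI impI)
    fix \<phi> :: "'a \<Rightarrow> real" assume t: "test_fun (ball 0 R) \<phi>"
    have cp: "continuous_on UNIV \<phi>" "continuous_on UNIV (partial j \<phi>)"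
      using test_fun_deriv(3,4)[OF t] j by auto
    have bmeas: "f \<in> borel_measurable borel \<Longrightarrow> f \<in> borel_measurable (lebesgue_on (ball (0::'a) R))" for f :: "'a \<Rightarrow> real"
      by (intro measurable_restrict_space1 measurable_completion) simp
    have fm: "finite_measure (lebesgue_on (ball (0::'a) R))"
      by (rule finite_measure_lebesgue_on) simp
    have tfb: "\<exists>B. 0 \<le> B \<and> (\<forall>x. \<bar>\<psi> x\<bar> \<le> B)" if "test_fun (ball 0 R) \<psi>" for \<psi> :: "'a \<Rightarrow> real"
    proof -
      have "\<psi> x = 0" if "x \<notin> closure {x. \<psi> x \<noteq> 0}" for x
        using that closure_subset[of "{x. \<psi> x \<noteq> 0}"] by auto
      then show ?thesis
        using bounded_continuous_compact_support[OF test_fun_deriv(4)[OF that], of "closure {x. \<psi> x \<noteq> 0}"] that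
        unfolding test_fun_def by metis
    qed
    obtain B where B: "0 \<le> B" "\<And>x. \<bar>\<phi> x\<bar> \<le> B" using tfb[OF t] by auto
    obtain B' where B': "0 \<le> B'" "\<And>x. \<bar>partial j \<phi> x\<bar> \<le> B'" using tfb[OF test_fun_deriv(2)[OF t j]] by auto
    have C: "0 \<le> C" using order_trans[OF abs_ge_zero b(2)] .
    let ?M = "lebesgue_on (ball (0::'a) R)"
    have 1: "(\<lambda>n. integral\<^sup>L ?M (\<lambda>x. radial_grad (\<gamma> n) i x * partial j \<phi> x))
        \<longlonglongrightarrow> integral\<^sup>L ?M (\<lambda>x. radial_grad \<beta> i x * partial j \<phi> x)"
    proof (rule integral_dominated_convergence[where w = "\<lambda>_. C * R * B'"])
      show "(\<lambda>x. radial_grad \<beta> i x * partial j \<phi> x) \<in> borel_measurable ?M"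
        using mg cp by (intro bmeas borel_measurable_times) (auto intro: borel_measurable_continuous_onI)
      show "(\<lambda>x. radial_grad (\<gamma> n) i x * partial j \<phi> x) \<in> borel_measurable ?M" for n
        using cgrad cp by (intro bmeas borel_measurable_times) (auto intro: borel_measurable_continuous_onI)
      show "integrable ?M (\<lambda>_. C * R * B')" using fm by (simp add: finite_measure.integrable_const)
      show "AE x in ?M. (\<lambda>n. radial_grad (\<gamma> n) i x * partial j \<phi> x) \<longlonglongrightarrow> radial_grad \<beta> i x * partial j \<phi> x"
        by (intro AE_I2 tendsto_intros glim)
      show "AE x in ?M. norm (radial_grad (\<gamma> n) i x * partial j \<phi> x) \<le> C * R * B'" for n
      proof (intro AE_I2)
        fix x assume "x \<in> space ?M"
        then have x: "norm x \<le> R" by simp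
        have "\<bar>radial_grad (\<gamma> n) i x\<bar> \<le> C * norm x" by (rule radial_grad_bound[OF gb bd i])
        also have "\<dots> \<le> C * R" using x C by (intro mult_left_mono) auto
        finally show "norm (radial_grad (\<gamma> n) i x * partial j \<phi> x) \<le> C * R * B'"
          unfolding real_norm_def abs_mult using B' C R by (intro mult_mono) auto
      qed
    qed
    have 2: "(\<lambda>n. integral\<^sup>L ?M (\<lambda>x. radial_hess (\<gamma> n) i j x * \<phi> x))
        \<longlonglongrightarrow> integral\<^sup>L ?M (\<lambda>x. radial_hess \<beta> i j x * \<phi> x)"
    proof (rule integral_dominated_convergence[where w = "\<lambda>_. (real DIM('a) + 2) * C * B"])
      show "(\<lambda>x. radial_hess \<beta> i j x * \<phi> x) \<in> borel_measurable ?M"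
        using mh cp by (intro bmeas borel_measurable_times) (auto intro: borel_measurable_continuous_onI)
      show "(\<lambda>x. radial_hess (\<gamma> n) i j x * \<phi> x) \<in> borel_measurable ?M" for n
        using C2 cp by (intro bmeas borel_measurable_times) (auto intro: borel_measurable_continuous_onI)
      show "integrable ?M (\<lambda>_. (real DIM('a) + 2) * C * B)" using fm by (simp add: finite_measure.integrable_const)
      show "AE x in ?M. (\<lambda>n. radial_hess (\<gamma> n) i j x * \<phi> x) \<longlonglongrightarrow> radial_hess \<beta> i j x * \<phi> x"
        using hlim by eventually_elim (intro tendsto_intros)
      show "AE x in ?M. norm (radial_hess (\<gamma> n) i j x * \<phi> x) \<le> (real DIM('a) + 2) * C * B" for n
        unfolding real_norm_def abs_mult using B C radial_hess_bound[OF gb bd i j]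
        by (intro AE_I2 mult_mono) auto
    qed
    have "integral\<^sup>L ?M (\<lambda>x. radial_grad (\<gamma> n) i x * partial j \<phi> x) = - integral\<^sup>L ?M (\<lambda>x. radial_hess (\<gamma> n) i j x * \<phi> x)" for n
      using weak_partial_C1[OF open_ball, of 0 R "radial_grad (\<gamma> n) i" "\<lambda>x h. radial_hess (\<gamma> n) i h x" j]
        C1 j t continuous_on_subset[OF C2] by (auto simp: weak_partial_def)
    then show "integral\<^sup>L ?M (\<lambda>x. radial_grad \<beta> i x * partial j \<phi> x) = - integral\<^sup>L ?M (\<lambda>x. radial_hess \<beta> i j x * \<phi> x)"
      using LIMSEQ_unique[OF 1] tendsto_minus[OF 2] by simp
  qed
qed

subsection \<open>Approximation by test functions\<close>

lemma partial_eq: "(f has_derivative f') (at x) \<Longrightarrow> partial i f x = f' i"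
  unfolding partial_def by (simp flip: frechet_derivative_at)

lemma Ck_Suc_has_derivative: "Ck (Suc k) f \<Longrightarrow> (f has_derivative frechet_derivative f (at x)) (at x)"
  by (simp flip: frechet_derivative_works)

lemma Ck_SucD: "Ck (Suc k) f \<Longrightarrow> Ck k f"
  by (induction k arbitrary: f) auto

text \<open>\<open>Ck\<close> is stated through \<open>frechet_derivative\<close>; this rule allows
  smoothness to be proved from any explicit derivative formula.\<close>

lemma Ck_SucI:
  assumes "\<And>x. (f has_derivative f' x) (at x)" "\<And>i. i \<in> Basis \<Longrightarrow> Ck k (\<lambda>x. f' x i)"
  shows "Ck (Suc k) f"
proof -
  have "continuous_on UNIV f"
    by (rule has_derivative_continuous_on) (rule has_derivative_at_withinI[OF assms(1)])
  moreover have "partial i f = (\<lambda>x. f' x i)" for i using partial_eq[OF assms(1)] by auto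
  ultimately show ?thesis using assms by (auto simp: differentiable_def)
qed

lemma Ck_const: "Ck k (\<lambda>x. c)"
  by (induction k arbitrary: c) (auto simp del: Ck.simps(2) intro!: Ck_SucI[where f' = "\<lambda>_ _. 0"])

lemma Ck_inner: "Ck k (\<lambda>x. x \<bullet> i)"
proof (cases k)
  case (Suc n)
  show ?thesis unfolding Suc
    by (rule Ck_SucI[where f' = "\<lambda>_ h. h \<bullet> i"]) (auto intro!: derivative_eq_intros Ck_const)
qed (auto intro: continuous_intros)

lemma Ck_add: "Ck k f \<Longrightarrow> Ck k g \<Longrightarrow> Ck k (\<lambda>x. f x + g x)"
proof (induction k arbitrary: f g)
  case (Suc k)
  have "Ck k (partial i f)" "Ck k (partial i g)" if "i \<in> Basis" for i using Suc.prems that by auto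
  then show ?case
    by (intro Ck_SucI[where f' = "\<lambda>x h. frechet_derivative f (at x) h + frechet_derivative g (at x) h"]
        has_derivative_add Ck_Suc_has_derivative[OF Suc.prems(1)] Ck_Suc_has_derivative[OF Suc.prems(2)])
      (auto simp flip: partial_def intro!: Suc.IH)
qed (auto intro: continuous_intros)

lemma Ck_mult: "Ck k f \<Longrightarrow> Ck k g \<Longrightarrow> Ck k (\<lambda>x. f x * g x)"
proof (induction k arbitrary: f g)
  case (Suc k)
  have "Ck k (partial i f)" "Ck k (partial i g)" if "i \<in> Basis" for i using Suc.prems that by auto
  moreover have "Ck k f" "Ck k g" using Suc.prems by (auto simp del: Ck.simps intro: Ck_SucD)
  ultimately show ?case
    by (intro Ck_SucI[where f' = "\<lambda>x h. f x * frechet_derivative g (at x) h + frechet_derivative f (at x) h * g x"]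
        has_derivative_mult Ck_Suc_has_derivative[OF Suc.prems(1)] Ck_Suc_has_derivative[OF Suc.prems(2)])
      (auto simp flip: partial_def intro!: Suc.IH Ck_add)
qed (auto intro: continuous_intros)

text \<open>The negative powers are carried along because differentiating exp (- 1 / t) / t^k gives
  combinations of the same family, which closes the smoothness induction.\<close>

definition flat_exp :: "nat \<Rightarrow> real \<Rightarrow> real" where
  "flat_exp k t = (if 0 < t then exp (- 1 / t) / t ^ k else 0)"

lemma power_le_fact_exp:
  fixes x :: real
  assumes "0 \<le> x"
  shows "x ^ n \<le> fact n * exp x"
proof -
  have "(\<Sum>m\<in>{n}. x ^ m /\<^sub>R fact m) \<le> (\<Sum>m. x ^ m /\<^sub>R fact m)"
    by (rule sum_le_suminf[OF sums_summable[OF exp_converges]]) (use assms in auto)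
  then have "inverse (fact n) * x ^ n \<le> exp x" using sums_unique[OF exp_converges, of x] by simp
  then have "fact n * (inverse (fact n) * x ^ n) \<le> fact n * exp x" by (intro mult_left_mono) auto
  then show ?thesis by (simp add: mult.assoc[symmetric])
qed

text \<open>From x^(k+2) <= (k+2)! exp x at x = 1 / t. The second power of t makes the difference
  quotient at 0 tend to 0.\<close>

lemma flat_exp_bound: "\<bar>flat_exp k t\<bar> \<le> fact (k + 2) * t\<^sup>2"
proof (cases "0 < t")
  case True
  define x where "x = 1 / t"
  have x: "0 < x" using True by (simp add: x_def)
  have "x ^ (k + 2) * exp (- x) \<le> fact (k + 2) * exp x * exp (- x)"
    using x by (intro mult_right_mono power_le_fact_exp) auto
  also have "\<dots> = fact (k + 2)" by (simp only: mult.assoc exp_add[symmetric]) simp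
  finally have "x ^ (k + 2) * exp (- x) * t\<^sup>2 \<le> fact (k + 2) * t\<^sup>2" by (intro mult_right_mono) auto
  moreover have "flat_exp k t = x ^ (k + 2) * exp (- x) * t\<^sup>2"
    using True by (simp add: flat_exp_def x_def power_add power_divide power2_eq_square)
  moreover have "0 \<le> flat_exp k t" using True by (simp add: flat_exp_def)
  ultimately show ?thesis by (simp only: abs_of_nonneg)
qed (simp add: flat_exp_def)

lemma flat_exp_deriv:
  "(flat_exp k has_real_derivative flat_exp (k + 2) t - real k * flat_exp (k + 1) t) (at t)"
proof (cases t "0::real" rule: linorder_cases)
  case less
  have "((\<lambda>_. 0) has_real_derivative 0) (at t)" by simp
  then have "(flat_exp k has_real_derivative 0) (at t)"
    by (rule has_field_derivative_transform_within_open[of _ _ _ "{..<0}"]) (use less in \<open>auto simp: flat_exp_def\<close>)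
  then show ?thesis using less by (simp add: flat_exp_def)
next
  case greater
  have "((\<lambda>t. exp (- 1 / t) / t ^ k) has_real_derivative
     (exp (- 1 / t) * (1 / t\<^sup>2) * t ^ k - exp (- 1 / t) * (real k * t ^ (k - 1))) / (t ^ k * t ^ k)) (at t)"
    using greater by (auto intro!: derivative_eq_intros simp: power2_eq_square)
  moreover have "(exp (- 1 / t) * (1 / t\<^sup>2) * t ^ k - exp (- 1 / t) * (real k * t ^ (k - 1))) / (t ^ k * t ^ k)
      = flat_exp (k + 2) t - real k * flat_exp (k + 1) t"
    using greater by (cases k) (auto simp: flat_exp_def field_simps power2_eq_square)
  ultimately have "((\<lambda>t. exp (- 1 / t) / t ^ k) has_real_derivative flat_exp (k + 2) t - real k * flat_exp (k + 1) t) (at t)"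
    by simp
  then show ?thesis
    by (rule has_field_derivative_transform_within_open[of _ _ _ "{0<..}"]) (use greater in \<open>auto simp: flat_exp_def\<close>)
next
  case equal
  have "((\<lambda>h. flat_exp k h / h) \<longlongrightarrow> 0) (at 0)"
  proof (rule Lim_null_comparison)
    show "\<forall>\<^sub>F h in at 0. norm (flat_exp k h / h) \<le> fact (k + 2) * \<bar>h\<bar>"
      unfolding eventually_at_filter
    proof (intro always_eventually allI impI)
      fix h :: real assume "h \<noteq> 0"
      then show "norm (flat_exp k h / h) \<le> fact (k + 2) * \<bar>h\<bar>"
        using flat_exp_bound[of k h] by (simp add: abs_divide divide_le_eq power2_eq_square abs_mult[symmetric] mult.assoc)
    qed
    have "((\<lambda>h. fact (k + 2) * \<bar>h\<bar>) \<longlongrightarrow> fact (k + 2) * \<bar>0::real\<bar>) (at 0)"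
      by (intro tendsto_intros)
    then show "((\<lambda>h. fact (k + 2) * \<bar>h\<bar>) \<longlongrightarrow> 0) (at (0::real))" by (simp only: abs_zero mult_zero_right)
  qed
  then show ?thesis using equal by (simp add: DERIV_def flat_exp_def)
qed

text \<open>The polynomial x . x serves as radial variable because it is smooth at the origin too.
  The induction runs over all k at once, since every derivative raises k.\<close>

lemma Ck_bump: "Ck n (\<lambda>x::'a::euclidean_space. flat_exp k (e - x \<bullet> x))"
proof (induction n arbitrary: k)
  case 0
  have "continuous_on UNIV (flat_exp k)"
    by (intro continuous_at_imp_continuous_on ballI DERIV_isCont[OF flat_exp_deriv])
  then show ?case by (auto intro!: continuous_on_compose2[of UNIV "flat_exp k"] continuous_intros)
next
  case (Suc n)
  show ?case
  proof (rule Ck_SucI)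
    fix x :: 'a
    show "((\<lambda>x. flat_exp k (e - x \<bullet> x)) has_derivative
        (\<lambda>h. (flat_exp (k + 2) (e - x \<bullet> x) + (- real k) * flat_exp (k + 1) (e - x \<bullet> x)) * ((- 2) * (x \<bullet> h)))) (at x)"
    proof -
      have "((\<lambda>x. e - x \<bullet> x) has_derivative (\<lambda>h. - 2 * (x \<bullet> h))) (at x)"
        by (auto intro!: derivative_eq_intros simp: inner_commute)
      from has_derivative_compose[OF this flat_exp_deriv[of k, unfolded has_field_derivative_def]]
      show ?thesis by simp
    qed
    show "Ck n (\<lambda>x::'a. (flat_exp (k + 2) (e - x \<bullet> x) + (- real k) * flat_exp (k + 1) (e - x \<bullet> x)) * ((- 2) * (x \<bullet> i)))" for i
      by (intro Ck_mult Ck_add Suc Ck_const Ck_inner)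
  qed
qed

section \<open>Convolution and mollifiers\<close>

definition convol :: "('a::euclidean_space \<Rightarrow> real) \<Rightarrow> ('a \<Rightarrow> real) \<Rightarrow> 'a \<Rightarrow> real" where
  "convol f g x = integral\<^sup>L lborel (\<lambda>y. f y * g (x - y))"

lemma convol_commute:
  fixes f g :: "'a::euclidean_space \<Rightarrow> real"
  assumes "continuous_on UNIV f" "continuous_on UNIV g"
  shows "convol f g = convol g f"
proof
  fix x :: 'a
  have [measurable]: "f \<in> borel_measurable borel" "g \<in> borel_measurable borel"
    using assms by (auto intro: borel_measurable_continuous_onI)
  have r: "(lborel :: 'a measure) = distr lborel borel (\<lambda>y. x - y)"
    using lborel_affine[of "-1" x] by (simp add: density_1)
  have "convol f g x = integral\<^sup>L (distr lborel borel (\<lambda>y. x - y)) (\<lambda>y. f y * g (x - y))"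
    unfolding convol_def using r by simp
  also have "\<dots> = integral\<^sup>L lborel (\<lambda>y. f (x - y) * g y)"
    by (subst integral_distr) auto
  finally show "convol f g x = convol g f x" by (simp add: convol_def mult.commute)
qed

text \<open>Differentiation under the integral over a box containing the support of f. It serves in
  both roles: with g a mollifier for smoothness, with g the approximated function for the first
  derivatives.\<close>

lemma convol_has_derivative:
  fixes f g :: "'a::euclidean_space \<Rightarrow> real"
  assumes f: "continuous_on UNIV f" and K: "compact K" and supp: "\<And>x. x \<notin> K \<Longrightarrow> f x = 0"
    and g: "\<And>x. (g has_derivative g' x) (at x)" and cg: "\<And>i. i \<in> Basis \<Longrightarrow> continuous_on UNIV (\<lambda>x. g' x i)"
  shows "(convol f g has_derivative (\<lambda>h. \<Sum>i\<in>Basis. (h \<bullet> i) * convol f (\<lambda>z. g' z i) x)) (at x)"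
proof -
  obtain a where a: "K \<subseteq> cbox (- a) a"
    using bounded_subset_cbox_symmetric[OF compact_imp_bounded[OF K]] by auto
  have cg0: "continuous_on UNIV g" by (rule has_derivative_continuous_on) (rule has_derivative_at_withinI[OF g])
  have cint: "continuous_on S (\<lambda>y. f y * k (x - y))" if "continuous_on UNIV k" for S x and k :: "'a \<Rightarrow> real"
    by (intro continuous_intros continuous_on_subset[OF f] continuous_on_compose2[OF that]) auto
  have conv: "convol f k x = integral (cbox (- a) a) (\<lambda>y. f y * k (x - y))" if k: "continuous_on UNIV k" for k x
  proof -
    have "integrable lborel (\<lambda>y. f y * k (x - y))"
      by (rule integrable_continuous_compact_support[OF cint[OF k] K]) (simp add: supp)
    then have "convol f k x = integral UNIV (\<lambda>y. f y * k (x - y))"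
      unfolding convol_def by (rule integral_lborel[symmetric])
    also have "\<dots> = integral (cbox (- a) a) (\<lambda>y. f y * k (x - y))"
      by (rule integral_spike_set) (use a supp in \<open>auto intro!: negligible_subset[of "{}"]\<close>)
    finally show ?thesis .
  qed
  \<comment> \<open>\<open>leibniz_rule\<close> takes the derivative as a bounded linear map that is
    jointly continuous in (x, t); it is assembled here from its values on the basis.\<close>
  define G where "G x t = f t *\<^sub>R (\<Sum>i\<in>Basis. g' (x - t) i *\<^sub>R blinfun_inner_left i)" for x t
  have G: "blinfun_apply (G x t) h = f t * g' (x - t) h" for x t h
  proof -
    have "g' (x - t) h = g' (x - t) (\<Sum>i\<in>Basis. (h \<bullet> i) *\<^sub>R i)" by (simp add: euclidean_representation)
    also have "\<dots> = (\<Sum>i\<in>Basis. (h \<bullet> i) * g' (x - t) i)"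
      using has_derivative_linear[OF g[of "x - t"]] by (simp add: linear_sum linear_cmul)
    finally show ?thesis by (simp add: G_def blinfun.scaleR_left blinfun.sum_left mult.commute)
  qed
  have cG: "continuous_on S (G x)" for S x
    unfolding G_def
    by (intro continuous_intros continuous_on_subset[OF f] continuous_on_compose2[OF cg]) auto
  have "((\<lambda>x. integral (cbox (- a) a) (\<lambda>t. f t * g (x - t))) has_derivative
      blinfun_apply (integral (cbox (- a) a) (G x))) (at x within UNIV)"
  proof (rule leibniz_rule)
    fix x t :: 'a
    have "((\<lambda>x. g (x - t)) has_derivative g' (x - t)) (at x)"
      by (rule has_derivative_compose[where f' = "\<lambda>h. h", OF _ g]) (auto intro!: derivative_eq_intros)
    then have "((\<lambda>x. f t * g (x - t)) has_derivative (\<lambda>h. f t * g' (x - t) h)) (at x)"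
      by (rule has_derivative_mult_right)
    then show "((\<lambda>x. f t * g (x - t)) has_derivative blinfun_apply (G x t)) (at x within UNIV)"
      unfolding G[abs_def] by simp
    show "(\<lambda>t. f t * g (x - t)) integrable_on cbox (- a) a"
      by (intro integrable_continuous cint[OF cg0])
    show "continuous_on (UNIV \<times> cbox (- a) a) (\<lambda>(x, t). G x t)"
      unfolding G_def split_beta
      by (intro continuous_intros continuous_on_compose2[OF f] continuous_on_compose2[OF cg]) auto
  qed auto
  moreover have "(\<lambda>x. integral (cbox (- a) a) (\<lambda>t. f t * g (x - t))) = convol f g"
    using conv[OF cg0] by auto
  moreover have "blinfun_apply (integral (cbox (- a) a) (G x)) h = (\<Sum>i\<in>Basis. (h \<bullet> i) * convol f (\<lambda>z. g' z i) x)" for h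
  proof -
    have "blinfun_apply (integral (cbox (- a) a) (G x)) h = integral (cbox (- a) a) (\<lambda>t. blinfun_apply (G x t) h)"
      using integral_linear[OF integrable_continuous[OF cG] blinfun.bounded_linear_left, of "- a" a h x] by (simp add: o_def)
    also have "\<dots> = integral (cbox (- a) a) (\<lambda>t. \<Sum>i\<in>Basis. (h \<bullet> i) * (f t * g' (x - t) i))"
      unfolding G_def by (simp add: blinfun.scaleR_left blinfun.sum_left sum_distrib_left mult_ac)
    also have "\<dots> = (\<Sum>i\<in>Basis. integral (cbox (- a) a) (\<lambda>t. (h \<bullet> i) * (f t * g' (x - t) i)))"
      by (intro integral_sum integrable_continuous continuous_intros cint cg) auto
    also have "\<dots> = (\<Sum>i\<in>Basis. (h \<bullet> i) * convol f (\<lambda>z. g' z i) x)"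
      by (intro sum.cong refl) (simp add: conv[OF cg])
    finally show ?thesis .
  qed
  ultimately show ?thesis by (simp add: fun_eq_iff) (metis (no_types, lifting) ext)
qed

text \<open>Each partial derivative is again a convolution of f, with \<open>partial i g\<close> in
  place of g; hence the induction over arbitrary g.\<close>

lemma Ck_convol:
  fixes f g :: "'a::euclidean_space \<Rightarrow> real"
  assumes f: "continuous_on UNIV f" and K: "compact K" and supp: "\<And>x. x \<notin> K \<Longrightarrow> f x = 0"
  shows "(\<And>k. Ck k g) \<Longrightarrow> Ck n (convol f g)"
proof (induction n arbitrary: g)
  case (0 g)
  have "continuous_on UNIV (\<lambda>x. frechet_derivative g (at x) i)" if "i \<in> Basis" for i
    using 0[of 1] that by (simp add: partial_def[abs_def])
  note * = convol_has_derivative[OF f K supp Ck_Suc_has_derivative[OF 0] this]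
  show ?case unfolding Ck.simps
    by (rule has_derivative_continuous_on) (rule has_derivative_at_withinI[OF *])
next
  case (Suc n g)
  have "continuous_on UNIV (\<lambda>x. frechet_derivative g (at x) i)" if "i \<in> Basis" for i
    using Suc.prems[of 1] that by (simp add: partial_def[abs_def])
  note * = convol_has_derivative[OF f K supp Ck_Suc_has_derivative[OF Suc.prems] this]
  show ?case
  proof (rule Ck_SucI[OF *])
    fix i :: 'a assume i: "i \<in> Basis"
    have "(\<lambda>x. \<Sum>j\<in>Basis. (i \<bullet> j) * convol f (\<lambda>z. frechet_derivative g (at z) j) x) = convol f (partial i g)"
    proof
      fix x
      have "(\<Sum>j\<in>Basis. (i \<bullet> j) * convol f (\<lambda>z. frechet_derivative g (at z) j) x)
          = (\<Sum>j\<in>Basis. if j = i then convol f (\<lambda>z. frechet_derivative g (at z) j) x else 0)"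
        using i by (intro sum.cong) (auto simp: inner_Basis)
      then show "(\<Sum>j\<in>Basis. (i \<bullet> j) * convol f (\<lambda>z. frechet_derivative g (at z) j) x) = convol f (partial i g) x"
        using i by (simp add: partial_def[abs_def])
    qed
    moreover have "Ck n (convol f (partial i g))"
    proof (rule Suc.IH)
      show "Ck k (partial i g)" for k using Suc.prems[of "Suc k"] i by simp
    qed
    ultimately show "Ck n (\<lambda>x. \<Sum>j\<in>Basis. (i \<bullet> j) * convol f (\<lambda>z. frechet_derivative g (at z) j) x)" by simp
  qed
qed

lemma mollifier_exists:
  assumes e: "0 < e"
  obtains \<rho> :: "'a::euclidean_space \<Rightarrow> real"
  where "\<And>k. Ck k \<rho>" "\<And>x. 0 \<le> \<rho> x" "\<And>x. e \<le> norm x \<Longrightarrow> \<rho> x = 0" "integrable lborel \<rho>" "integral\<^sup>L lborel \<rho> = 1"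
proof -
  define h where "h x = flat_exp 0 (e\<^sup>2 - x \<bullet> x)" for x :: 'a
  have Ck: "Ck k h" for k unfolding h_def by (rule Ck_bump)
  have cont: "continuous_on UNIV h" using Ck[of 0] by simp
  have nn: "0 \<le> h x" for x by (simp add: h_def flat_exp_def)
  have z: "h x = 0" if "e \<le> norm x" for x
  proof -
    have "e\<^sup>2 \<le> (norm x)\<^sup>2" using that e by (intro power_mono) auto
    then show ?thesis by (simp add: h_def flat_exp_def power2_norm_eq_inner)
  qed
  have zc: "h x = 0" if "x \<notin> cball 0 e" for x using z[of x] that by auto
  have int: "integrable lborel h"
    by (rule integrable_continuous_compact_support[OF cont compact_cball zc])
  have "integral\<^sup>L lborel h \<noteq> 0"
  proof
    assume "integral\<^sup>L lborel h = 0"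
    then have "AE x in lborel. h x = 0" using integral_nonneg_eq_0_iff_AE[OF int] nn by auto
    moreover have "h x \<noteq> 0" if "x \<in> ball 0 e" for x
    proof -
      have "(norm x)\<^sup>2 < e\<^sup>2" using that by (intro power_strict_mono) auto
      then show ?thesis by (simp add: h_def flat_exp_def power2_norm_eq_inner)
    qed
    ultimately have "AE x in lborel. x \<notin> ball (0::'a) e" by (auto elim!: eventually_mono)
    then have "ball (0::'a) e \<in> null_sets lborel" by (subst AE_iff_null_sets) auto
    then have "measure lborel (ball (0::'a) e) = 0" by (auto simp: null_sets_def measure_def)
    then show False using content_ball_pos[OF e, of "0::'a"] by simp
  qed
  moreover have "0 \<le> integral\<^sup>L lborel h" using nn by simp
  ultimately have pos: "0 < integral\<^sup>L lborel h" by simp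
  define c where "c = 1 / integral\<^sup>L lborel h"
  show thesis
  proof (rule that[of "\<lambda>x. c * h x"])
    show "Ck k (\<lambda>x. c * h x)" for k by (intro Ck_mult Ck_const Ck)
    show "integral\<^sup>L lborel (\<lambda>x. c * h x) = 1" using pos by (simp add: c_def)
  qed (use nn pos z int in \<open>auto simp: c_def\<close>)
qed

text \<open>One estimate for two purposes: c = f x gives convergence, and c = 0 with \<delta> a
  bound for f gives the uniform bound.\<close>

lemma convol_mollifier_bound:
  fixes f :: "'a::euclidean_space \<Rightarrow> real"
  assumes \<rho>: "continuous_on UNIV \<rho>" "\<And>x. 0 \<le> \<rho> x" "integrable lborel \<rho>" "integral\<^sup>L lborel \<rho> = 1"
    and f: "continuous_on UNIV f" and z: "\<And>y. e \<le> norm y \<Longrightarrow> \<rho> y = 0"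
    and d: "\<And>y. norm y < e \<Longrightarrow> \<bar>f (x - y) - c\<bar> \<le> \<delta>"
  shows "\<bar>convol \<rho> f x - c\<bar> \<le> \<delta>"
proof -
  have c1: "continuous_on UNIV (\<lambda>y. \<rho> y * f (x - y))"
    by (intro continuous_intros \<rho>(1) continuous_on_compose2[OF f]) auto
  have int1: "integrable lborel (\<lambda>y. \<rho> y * f (x - y))"
    by (rule integrable_continuous_compact_support[OF c1, of "cball 0 e"]) (auto simp: z)
  have int2: "integrable lborel (\<lambda>y. \<rho> y * c)" using \<rho>(3) by simp
  have "convol \<rho> f x - c = integral\<^sup>L lborel (\<lambda>y. \<rho> y * f (x - y)) - integral\<^sup>L lborel (\<lambda>y. \<rho> y * c)"
    using \<rho>(4) by (simp add: convol_def)
  also have "\<dots> = integral\<^sup>L lborel (\<lambda>y. \<rho> y * (f (x - y) - c))"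
    using int1 int2 by (simp add: right_diff_distrib)
  also have "\<bar>\<dots>\<bar> \<le> integral\<^sup>L lborel (\<lambda>y. \<rho> y * \<delta>)"
    unfolding real_norm_def[symmetric]
  proof (rule Bochner_Integration.integral_norm_bound_integral)
    show "integrable lborel (\<lambda>y. \<rho> y * (f (x - y) - c))"
      using int1 int2 by (simp add: right_diff_distrib)
    show "integrable lborel (\<lambda>y. \<rho> y * \<delta>)" using \<rho>(3) by simp
    show "norm (\<rho> y * (f (x - y) - c)) \<le> \<rho> y * \<delta>" for y
      using \<rho>(2)[of y] d[of y] z[of y] by (cases "norm y < e") (auto simp: abs_mult intro!: mult_left_mono)
  qed
  also have "\<dots> = \<delta>" using \<rho>(4) by simp
  finally show ?thesis .
qed

text \<open>The weak equation speaks of smooth test functions, while the uniqueness proof uses only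
  C^1 ones. Pointwise convergence with uniform bounds, for values and first derivatives, is what
  dominated convergence asks for.\<close>

theorem test_fun_approximation:
  fixes \<phi> :: "'a::euclidean_space \<Rightarrow> real"
  assumes S: "open S" and \<phi>: "\<And>x. (\<phi> has_derivative \<phi>' x) (at x)"
    and c\<phi>: "\<And>i. i \<in> Basis \<Longrightarrow> continuous_on UNIV (\<lambda>x. \<phi>' x i)"
    and K: "compact K" "K \<subseteq> S" and supp: "\<And>x. x \<notin> K \<Longrightarrow> \<phi> x = 0"
  obtains \<psi> B where "\<And>n. test_fun S (\<psi> n)"
    "\<And>x. (\<lambda>n. \<psi> n x) \<longlonglongrightarrow> \<phi> x" "\<And>i x. i \<in> Basis \<Longrightarrow> (\<lambda>n. partial i (\<psi> n) x) \<longlonglongrightarrow> \<phi>' x i"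
    "\<And>n x. \<bar>\<psi> n x\<bar> \<le> B" "\<And>n i x. i \<in> Basis \<Longrightarrow> \<bar>partial i (\<psi> n) x\<bar> \<le> B"
proof -
  have cphi: "continuous_on UNIV \<phi>" by (rule has_derivative_continuous_on) (rule has_derivative_at_withinI[OF \<phi>])
  have clK: "closed K" using K by (simp add: compact_imp_closed)
  have d0: "\<phi>' x i = 0" if "x \<notin> K" for x i
    using has_derivative_zero_outside_support[OF \<phi> clK that supp] by simp
  obtain e where e: "0 < e" "\<And>x. x \<in> K \<Longrightarrow> cball x e \<subseteq> S"
  proof -
    obtain e where "0 < e" "(\<Union>x\<in>K. cball x e) \<subseteq> S" using compact_subset_open_imp_cball_epsilon_subset[OF K(1) S K(2)] by auto
    then show thesis by (intro that) auto
  qed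
  \<comment> \<open>Radii of at most \<open>e\<close> keep all supports inside a fixed compact
    neighbourhood of K in S.\<close>
  define h where "h n = e / real (Suc n)" for n
  have h: "0 < h n" "h n \<le> e" for n using e by (auto simp: h_def field_simps)
  have "\<exists>\<rho> :: 'a \<Rightarrow> real. (\<forall>k. Ck k \<rho>) \<and> (\<forall>x. 0 \<le> \<rho> x) \<and> (\<forall>x. h n \<le> norm x \<longrightarrow> \<rho> x = 0) \<and>
      integrable lborel \<rho> \<and> integral\<^sup>L lborel \<rho> = 1" for n
    by (rule mollifier_exists[OF h(1)[of n], where 'a='a]) blast
  then obtain \<rho> :: "nat \<Rightarrow> 'a \<Rightarrow> real" where \<rho>: "\<And>n k. Ck k (\<rho> n)" "\<And>n x. 0 \<le> \<rho> n x"
    "\<And>n x. h n \<le> norm x \<Longrightarrow> \<rho> n x = 0" "\<And>n. integrable lborel (\<rho> n)" "\<And>n. integral\<^sup>L lborel (\<rho> n) = 1"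
    by metis
  have cr: "continuous_on UNIV (\<rho> n)" for n using \<rho>(1)[of 0 n] by simp
  have rz: "\<rho> n x = 0" if "x \<notin> cball 0 (h n)" for n x using \<rho>(3)[of n x] that by auto
  define \<psi> where "\<psi> n = convol \<phi> (\<rho> n)" for n
  \<comment> \<open>Read as \<open>convol \<phi> (\<rho> n)\<close> the function is smooth; read in
    the other order, its derivatives are mollified derivatives of \<phi>.\<close>
  have psi: "\<psi> n = convol (\<rho> n) \<phi>" for n unfolding \<psi>_def by (rule convol_commute[OF cphi cr])
  have dpsi: "(\<psi> n has_derivative (\<lambda>k. \<Sum>i\<in>Basis. (k \<bullet> i) * convol (\<rho> n) (\<lambda>z. \<phi>' z i) x)) (at x)" for n x
    unfolding psi by (rule convol_has_derivative[OF cr compact_cball rz \<phi> c\<phi>])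
  have ppsi: "partial i (\<psi> n) x = convol (\<rho> n) (\<lambda>z. \<phi>' z i) x" if i: "i \<in> Basis" for i n x
  proof -
    have "partial i (\<psi> n) x = (\<Sum>j\<in>Basis. (i \<bullet> j) * convol (\<rho> n) (\<lambda>z. \<phi>' z j) x)"
      by (rule partial_eq[OF dpsi])
    also have "\<dots> = (\<Sum>j\<in>Basis. if j = i then convol (\<rho> n) (\<lambda>z. \<phi>' z j) x else 0)"
      using i by (intro sum.cong) (auto simp: inner_Basis)
    finally show ?thesis using i by simp
  qed
  have conv_lim: "(\<lambda>n. convol (\<rho> n) f x) \<longlonglongrightarrow> f x" if f: "continuous_on UNIV f" for f x
  proof (rule LIMSEQ_I)
    fix r :: real assume r: "0 < r"
    obtain d where d: "0 < d" "\<And>y. dist y x < d \<Longrightarrow> dist (f y) (f x) < r / 2"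
      using f[unfolded continuous_on_iff, rule_format, of x "r / 2"] r by auto
    obtain m :: nat where m: "e / d < real m" using reals_Archimedean2 by blast
    show "\<exists>n0. \<forall>n\<ge>n0. norm (convol (\<rho> n) f x - f x) < r"
    proof (intro exI allI impI)
      fix n assume n: "m \<le> n"
      have "e / d < real (Suc n)" using m n by simp
      then have hd: "h n < d" using d(1) by (simp add: h_def field_simps)
      have "\<bar>convol (\<rho> n) f x - f x\<bar> \<le> r / 2"
      proof (rule convol_mollifier_bound[OF cr \<rho>(2,4,5) f \<rho>(3)])
        fix y :: 'a assume "norm y < h n"
        then have "dist (x - y) x < d" using hd by (simp add: dist_norm)
        then show "\<bar>f (x - y) - f x\<bar> \<le> r / 2" using d(2)[of "x - y"] by (auto simp: dist_real_def)
      qed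
      then show "norm (convol (\<rho> n) f x - f x) < r" using r by simp
    qed
  qed
  have conv_bd: "\<bar>convol (\<rho> n) f x\<bar> \<le> B" if f: "continuous_on UNIV f" "\<And>x. \<bar>f x\<bar> \<le> B" for f B n x
    using convol_mollifier_bound[OF cr \<rho>(2,4,5) f(1) \<rho>(3), where c = 0 and \<delta> = B and x = x] f(2) by simp
  obtain B0 where B0: "0 \<le> B0" "\<And>x. \<bar>\<phi> x\<bar> \<le> B0"
    using bounded_continuous_compact_support[OF cphi K(1) supp] by blast
  have "\<exists>B. 0 \<le> B \<and> (\<forall>x. \<bar>\<phi>' x i\<bar> \<le> B)" if "i \<in> Basis" for i
    by (rule bounded_continuous_compact_support[OF c\<phi>[OF that] K(1) d0]) auto
  then obtain B1 where B1: "\<And>i. i \<in> Basis \<Longrightarrow> 0 \<le> B1 i" "\<And>i x. i \<in> Basis \<Longrightarrow> \<bar>\<phi>' x i\<bar> \<le> B1 i" by metis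
  define B where "B = B0 + (\<Sum>i\<in>Basis. B1 i)"
  have B: "B0 \<le> B" "\<And>i. i \<in> Basis \<Longrightarrow> B1 i \<le> B"
  proof -
    show "B0 \<le> B" unfolding B_def using B1(1) by (simp add: sum_nonneg)
    show "B1 i \<le> B" if "i \<in> Basis" for i
      unfolding B_def using member_le_sum[OF that, of B1] B1(1) B0(1) by auto
  qed
  show thesis
  proof (rule that)
    fix n
    show "\<bar>\<psi> n x\<bar> \<le> B" for x unfolding psi by (rule conv_bd[OF cphi]) (use B0(2) B(1) in \<open>auto intro: order_trans\<close>)
    show "\<bar>partial i (\<psi> n) x\<bar> \<le> B" if "i \<in> Basis" for i x
      unfolding ppsi[OF that] by (rule conv_bd[OF c\<phi>[OF that]]) (use B1(2)[OF that] B(2)[OF that] in \<open>auto intro: order_trans\<close>)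
    have sub: "{x. \<psi> n x \<noteq> 0} \<subseteq> (\<Union>x\<in>K. cball x e)"
    proof
      fix x assume "x \<in> {x. \<psi> n x \<noteq> 0}"
      then have "\<psi> n x \<noteq> 0" by simp
      have "\<exists>y. y \<in> K \<and> norm (x - y) < h n"
      proof (rule ccontr)
        assume "\<not> ?thesis"
        then have "(\<lambda>y. \<phi> y * \<rho> n (x - y)) = (\<lambda>_. 0)"
          using supp \<rho>(3)[of n] by (auto simp: fun_eq_iff not_less)
        then have "\<psi> n x = 0" unfolding \<psi>_def convol_def by simp
        with \<open>\<psi> n x \<noteq> 0\<close> show False by simp
      qed
      then obtain y where "y \<in> K" "norm (x - y) < h n" by blast
      then have "x \<in> cball y e" using h[of n] by (auto simp: dist_norm norm_minus_commute)
      with \<open>y \<in> K\<close> show "x \<in> (\<Union>x\<in>K. cball x e)" by auto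
    qed
    have co: "compact (\<Union>x\<in>K. cball x e)"
    proof -
      have "(\<Union>x\<in>K. cball x e) = {x + y | x y. x \<in> K \<and> y \<in> cball 0 e}"
      proof (intro equalityI subsetI)
        fix z assume "z \<in> (\<Union>x\<in>K. cball x e)"
        then obtain x where "x \<in> K" "dist x z \<le> e" by auto
        then have "z = x + (z - x)" "x \<in> K" "z - x \<in> cball 0 e" by (auto simp: dist_norm norm_minus_commute)
        then show "z \<in> {x + y | x y. x \<in> K \<and> y \<in> cball 0 e}" by blast
      next
        fix z assume "z \<in> {x + y | x y. x \<in> K \<and> y \<in> cball 0 e}"
        then obtain x y where "x \<in> K" "z = x + y" "norm y \<le> e" by auto
        then have "x \<in> K" "z \<in> cball x e" by (auto simp: dist_norm)
        then show "z \<in> (\<Union>x\<in>K. cball x e)" by blast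
      qed
      then show ?thesis using compact_sums[OF K(1) compact_cball[of 0 e]] by (simp only:)
    qed
    have cl: "closure {x. \<psi> n x \<noteq> 0} \<subseteq> (\<Union>x\<in>K. cball x e)"
      by (rule closure_minimal[OF sub compact_imp_closed[OF co]])
    then have "compact (closure {x. \<psi> n x \<noteq> 0})"
      using compact_Int_closed[OF co closed_closure[of "{x. \<psi> n x \<noteq> 0}"]] by (simp add: Int_absorb1)
    moreover have "closure {x. \<psi> n x \<noteq> 0} \<subseteq> S" using cl e(2) by auto
    moreover have "smooth (\<psi> n)" unfolding smooth_def \<psi>_def using Ck_convol[OF cphi K(1) supp \<rho>(1)] by blast
    ultimately show "test_fun S (\<psi> n)" by (simp add: test_fun_def)
  next
    show "(\<lambda>n. \<psi> n x) \<longlonglongrightarrow> \<phi> x" for x unfolding psi by (rule conv_lim[OF cphi])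
    show "(\<lambda>n. partial i (\<psi> n) x) \<longlonglongrightarrow> \<phi>' x i" if "i \<in> Basis" for i x
      unfolding ppsi[OF that] by (rule conv_lim[OF c\<phi>[OF that]])
  qed
qed

subsection \<open>The weak Neumann problem\<close>

lemma finite_measure_ball: "finite_measure (lebesgue_on (ball (0::'a::euclidean_space) R))"
  by (rule finite_measure_lebesgue_on) simp

lemma integrable_on_ball_bounded:
  fixes f :: "'a::euclidean_space \<Rightarrow> real"
  assumes "f \<in> borel_measurable (lebesgue_on (ball 0 R))" "AE x in lebesgue_on (ball 0 R). \<bar>f x\<bar> \<le> B"
  shows "integrable (lebesgue_on (ball 0 R)) f"
  using assms by (intro finite_measure.integrable_const_bound[OF finite_measure_ball, of _ B]) auto

lemma borel_measurable_on_ball_continuous: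
  fixes f :: "'a::euclidean_space \<Rightarrow> real"
  assumes "continuous_on (ball 0 R) f"
  shows "f \<in> borel_measurable (lebesgue_on (ball 0 R))"
  using assms by (intro continuous_imp_measurable_on_sets_lebesgue) auto

lemma continuous_on_cball_bounded:
  fixes f :: "'a::euclidean_space \<Rightarrow> real"
  assumes "continuous_on (cball 0 R) f"
  obtains B where "0 \<le> B" "\<And>x. x \<in> cball 0 R \<Longrightarrow> \<bar>f x\<bar> \<le> B"
proof -
  have "bounded (f ` cball 0 R)" using assms by (intro compact_imp_bounded compact_continuous_image) auto
  then obtain B where "\<And>x. x \<in> cball 0 R \<Longrightarrow> \<bar>f x\<bar> \<le> B" unfolding bounded_real by blast
  then show thesis by (intro that[of "\<bar>B\<bar>"]) force+
qed

lemma integrable_on_ball_continuous: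
  fixes f :: "'a::euclidean_space \<Rightarrow> real"
  assumes "continuous_on (cball 0 R) f"
  shows "integrable (lebesgue_on (ball 0 R)) f"
proof -
  obtain B where "\<And>x. x \<in> cball 0 R \<Longrightarrow> \<bar>f x\<bar> \<le> B" using continuous_on_cball_bounded[OF assms] by blast
  then show ?thesis
    using assms by (intro integrable_on_ball_bounded[where B = B] borel_measurable_on_ball_continuous AE_I2)
      (auto intro: continuous_on_subset)
qed

lemma Lp_on_integrable:
  fixes f :: "'a::euclidean_space \<Rightarrow> real"
  assumes "Lp_on p (ball 0 R) f" "1 \<le> p"
  shows "integrable (lebesgue_on (ball 0 R)) f"
proof (rule Bochner_Integration.integrable_bound)
  show "integrable (lebesgue_on (ball 0 R)) (\<lambda>x. 1 + \<bar>f x\<bar> powr p)"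
    using assms by (intro Bochner_Integration.integrable_add finite_measure.integrable_const[OF finite_measure_ball])
      (auto simp: Lp_on_def)
  show "f \<in> borel_measurable (lebesgue_on (ball 0 R))" using assms by (simp add: Lp_on_def)
  show "AE x in lebesgue_on (ball 0 R). norm (f x) \<le> norm (1 + \<bar>f x\<bar> powr p)"
  proof (intro AE_I2)
    fix x
    have "\<bar>f x\<bar> \<le> 1 + \<bar>f x\<bar> powr p"
    proof (cases "\<bar>f x\<bar> \<le> 1")
      case False
      then show ?thesis using powr_mono[of 1 p "\<bar>f x\<bar>"] assms(2) by simp
    qed (simp add: add_increasing2)
    then show "norm (f x) \<le> norm (1 + \<bar>f x\<bar> powr p)" by simp
  qed
qed

lemma Linf_times_continuous:
  fixes a :: "'a::euclidean_space \<Rightarrow> real"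
  assumes a: "Linf_on (ball 0 R) a" and f: "continuous_on (cball 0 R) f"
  obtains B where "(\<lambda>x. a x * f x) \<in> borel_measurable (lebesgue_on (ball 0 R))"
    "AE x in lebesgue_on (ball 0 R). \<bar>a x * f x\<bar> \<le> B"
proof -
  obtain M where am: "a \<in> borel_measurable (lebesgue_on (ball 0 R))" and M: "AE x in lebesgue_on (ball 0 R). \<bar>a x\<bar> \<le> M"
    using a by (auto simp: Linf_on_def)
  obtain C where C: "0 \<le> C" "\<And>x. x \<in> cball 0 R \<Longrightarrow> \<bar>f x\<bar> \<le> C" using continuous_on_cball_bounded[OF f] by blast
  have fm: "f \<in> borel_measurable (lebesgue_on (ball 0 R))"
    by (rule borel_measurable_on_ball_continuous) (auto intro: continuous_on_subset[OF f])
  have "AE x in lebesgue_on (ball 0 R). x \<in> ball 0 R" by (auto intro!: AE_I2)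
  with M have "AE x in lebesgue_on (ball 0 R). \<bar>a x * f x\<bar> \<le> M * C"
  proof eventually_elim
    case (elim x)
    then show ?case unfolding abs_mult using C(1) C(2)[of x] by (intro mult_mono) auto
  qed
  moreover have "(\<lambda>x. a x * f x) \<in> borel_measurable (lebesgue_on (ball 0 R))" using am fm by measurable
  ultimately show thesis by (rule that[rotated])
qed

text \<open>\<open>D1\<close> and the classical gradient G are compared only under the integral:
  both are weak derivatives of u, and \<open>partial i \<psi>\<close> is itself a test function, so
  their integrals against it agree. A second step moves the derivative onto
  \<open>D1\<close>.\<close>

lemma weak_form_test_fun:
  fixes a u :: "'a::euclidean_space \<Rightarrow> real"
  assumes a: "Linf_on (ball 0 R) a" and sol: "is_solution R a q u"
    and cu: "continuous_on (cball 0 R) (\<lambda>x. u x powr q)" and G: "continuous_on (cball 0 R) G"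
    and du: "\<And>x. x \<in> ball 0 R \<Longrightarrow> (u has_derivative (\<lambda>h. G x \<bullet> h)) (at x)"
    and t: "test_fun (ball 0 R) \<psi>"
  shows "integral\<^sup>L (lebesgue_on (ball 0 R)) (\<lambda>x. \<Sum>i\<in>Basis. (G x \<bullet> i) * partial i \<psi> x)
    = integral\<^sup>L (lebesgue_on (ball 0 R)) (\<lambda>x. a x * u x powr q * \<psi> x)"
proof -
  let ?M = "lebesgue_on (ball (0::'a) R)"
  obtain r D1 D2 where r: "r > real DIM('a)"
    and D1: "\<And>i. i \<in> Basis \<Longrightarrow> weak_partial (ball 0 R) i u (D1 i)"
    and D2: "\<And>i j. i \<in> Basis \<Longrightarrow> j \<in> Basis \<Longrightarrow> Lp_on r (ball 0 R) (D2 i j)"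
      "\<And>i j. i \<in> Basis \<Longrightarrow> j \<in> Basis \<Longrightarrow> weak_partial (ball 0 R) j (D1 i) (D2 i j)"
    and eq: "AE x in ?M. - (\<Sum>i\<in>Basis. D2 i i x) = a x * u x powr q"
    using sol unfolding is_solution_def by blast
  have r1: "1 \<le> r" using r DIM_positive[where 'a='a] by linarith
  have cG: "continuous_on (ball 0 R) (\<lambda>x. G x \<bullet> i)" for i
    by (intro continuous_intros continuous_on_subset[OF G]) auto
  have eqi: "integral\<^sup>L ?M (\<lambda>x. (G x \<bullet> i) * partial i \<psi> x) = - integral\<^sup>L ?M (\<lambda>x. D2 i i x * \<psi> x)" if i: "i \<in> Basis" for i
  proof -
    have ti: "test_fun (ball 0 R) (partial i \<psi>)" by (rule test_fun_deriv(2)[OF t i])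
    have "weak_partial (ball 0 R) i u (\<lambda>x. G x \<bullet> i)"
      using weak_partial_C1[OF open_ball du cG i] by simp
    then have "integral\<^sup>L ?M (\<lambda>x. (G x \<bullet> i) * partial i \<psi> x) = integral\<^sup>L ?M (\<lambda>x. D1 i x * partial i \<psi> x)"
      using D1[OF i] ti unfolding weak_partial_def by fastforce
    also have "\<dots> = - integral\<^sup>L ?M (\<lambda>x. D2 i i x * \<psi> x)"
      using D2(2)[OF i i] t unfolding weak_partial_def by blast
    finally show ?thesis .
  qed
  have supp: "\<psi> x = 0" if "x \<notin> closure {x. \<psi> x \<noteq> 0}" for x
    using that closure_subset[of "{x. \<psi> x \<noteq> 0}"] by auto
  have comp: "compact (closure {x. \<psi> x \<noteq> 0})" using t by (simp add: test_fun_def)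
  obtain B where B: "0 \<le> B" "\<And>x. \<bar>\<psi> x\<bar> \<le> B"
    using bounded_continuous_compact_support[OF test_fun_deriv(4)[OF t] comp supp] by blast
  have pm: "\<psi> \<in> borel_measurable ?M"
    by (rule borel_measurable_on_ball_continuous) (auto intro: continuous_on_subset[OF test_fun_deriv(4)[OF t]])
  have intD: "integrable ?M (\<lambda>x. D2 i i x * \<psi> x)" if i: "i \<in> Basis" for i
  proof (rule Bochner_Integration.integrable_bound)
    show "integrable ?M (\<lambda>x. B * D2 i i x)" using Lp_on_integrable[OF D2(1)[OF i i] r1] by simp
    show "(\<lambda>x. D2 i i x * \<psi> x) \<in> borel_measurable ?M"
      using pm borel_measurable_integrable[OF Lp_on_integrable[OF D2(1)[OF i i] r1]] by (rule borel_measurable_times[rotated])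
    show "AE x in ?M. norm (D2 i i x * \<psi> x) \<le> norm (B * D2 i i x)"
      using B by (intro AE_I2) (auto simp: abs_mult mult.commute intro!: mult_right_mono)
  qed
  have intG: "integrable ?M (\<lambda>x. (G x \<bullet> i) * partial i \<psi> x)" if i: "i \<in> Basis" for i
    by (intro integrable_on_ball_continuous continuous_intros G continuous_on_subset[OF test_fun_deriv(3)[OF t i]]) auto
  have "integral\<^sup>L ?M (\<lambda>x. \<Sum>i\<in>Basis. (G x \<bullet> i) * partial i \<psi> x) = (\<Sum>i\<in>Basis. integral\<^sup>L ?M (\<lambda>x. (G x \<bullet> i) * partial i \<psi> x))"
    by (rule Bochner_Integration.integral_sum) (rule intG)
  also have "\<dots> = (\<Sum>i\<in>Basis. - integral\<^sup>L ?M (\<lambda>x. D2 i i x * \<psi> x))" by (intro sum.cong refl eqi)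
  also have "\<dots> = - integral\<^sup>L ?M (\<lambda>x. \<Sum>i\<in>Basis. D2 i i x * \<psi> x)"
    by (subst Bochner_Integration.integral_sum[OF intD]) (auto simp: sum_negf)
  also have "\<dots> = integral\<^sup>L ?M (\<lambda>x. - (\<Sum>i\<in>Basis. D2 i i x) * \<psi> x)"
    by (simp add: sum_distrib_right flip: Bochner_Integration.integral_minus)
  also have "\<dots> = integral\<^sup>L ?M (\<lambda>x. a x * u x powr q * \<psi> x)"
  proof (rule integral_cong_AE)
    have "(\<lambda>x. \<Sum>i\<in>Basis. D2 i i x * \<psi> x) \<in> borel_measurable ?M"
      by (intro borel_measurable_sum borel_measurable_integrable[OF intD])
    then show m: "(\<lambda>x. - (\<Sum>i\<in>Basis. D2 i i x) * \<psi> x) \<in> borel_measurable ?M" by (simp add: sum_distrib_right)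
    show ae: "AE x in ?M. - (\<Sum>i\<in>Basis. D2 i i x) * \<psi> x = a x * u x powr q * \<psi> x"
      using eq by eventually_elim simp
    show "(\<lambda>x. a x * u x powr q * \<psi> x) \<in> borel_measurable ?M"
      using Linf_times_continuous[OF a cu] pm by (metis borel_measurable_times)
  qed
  finally show ?thesis .
qed

lemma weak_form_C1_compact:
  fixes a u \<phi> :: "'a::euclidean_space \<Rightarrow> real"
  assumes a: "Linf_on (ball 0 R) a" and sol: "is_solution R a q u"
    and cu: "continuous_on (cball 0 R) (\<lambda>x. u x powr q)" and G: "continuous_on (cball 0 R) G"
    and du: "\<And>x. x \<in> ball 0 R \<Longrightarrow> (u has_derivative (\<lambda>h. G x \<bullet> h)) (at x)"
    and \<phi>: "\<And>x. (\<phi> has_derivative (\<lambda>h. \<Gamma> x \<bullet> h)) (at x)" and \<Gamma>: "continuous_on UNIV \<Gamma>"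
    and K: "compact K" "K \<subseteq> ball 0 R" and supp: "\<And>x. x \<notin> K \<Longrightarrow> \<phi> x = 0"
  shows "integral\<^sup>L (lebesgue_on (ball 0 R)) (\<lambda>x. G x \<bullet> \<Gamma> x)
    = integral\<^sup>L (lebesgue_on (ball 0 R)) (\<lambda>x. a x * u x powr q * \<phi> x)"
proof -
  let ?M = "lebesgue_on (ball (0::'a) R)"
  have cGi: "continuous_on UNIV (\<lambda>x. \<Gamma> x \<bullet> i)" for i by (intro continuous_intros \<Gamma>)
  obtain \<psi> B where t: "\<And>n. test_fun (ball 0 R) (\<psi> n)" and l0: "\<And>x. (\<lambda>n. \<psi> n x) \<longlonglongrightarrow> \<phi> x"
    and l1: "\<And>i x. i \<in> Basis \<Longrightarrow> (\<lambda>n. partial i (\<psi> n) x) \<longlonglongrightarrow> \<Gamma> x \<bullet> i"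
    and b0: "\<And>n x. \<bar>\<psi> n x\<bar> \<le> B" and b1: "\<And>n i x. i \<in> Basis \<Longrightarrow> \<bar>partial i (\<psi> n) x\<bar> \<le> B"
    by (rule test_fun_approximation[OF open_ball \<phi> cGi K supp]) (assumption, rule that)
  have "0 \<le> B" using order_trans[OF abs_ge_zero b0] .
  have cphi: "continuous_on UNIV \<phi>" by (rule has_derivative_continuous_on) (rule has_derivative_at_withinI[OF \<phi>])
  have cG: "continuous_on (cball 0 R) (\<lambda>x. G x \<bullet> i)" for i by (intro continuous_intros G)
  have "\<exists>C. 0 \<le> C \<and> (\<forall>x\<in>cball 0 R. \<bar>G x \<bullet> i\<bar> \<le> C)" for i
    by (rule continuous_on_cball_bounded[OF cG[of i]]) auto
  then obtain C where C: "\<And>i. 0 \<le> C i" "\<And>i x. x \<in> cball 0 R \<Longrightarrow> \<bar>G x \<bullet> i\<bar> \<le> C i" by metis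
  obtain H where hm: "(\<lambda>x. a x * u x powr q) \<in> borel_measurable ?M" and hb: "AE x in ?M. \<bar>a x * u x powr q\<bar> \<le> H"
    by (rule Linf_times_continuous[OF a cu]) (rule that)
  have pm: "f \<in> borel_measurable ?M" if "continuous_on UNIV f" for f :: "'a \<Rightarrow> real"
    by (rule borel_measurable_on_ball_continuous) (auto intro: continuous_on_subset[OF that])
  have Gm: "(\<lambda>x. G x \<bullet> i) \<in> borel_measurable ?M" for i
    by (rule borel_measurable_on_ball_continuous) (auto intro: continuous_on_subset[OF cG])
  have 1: "(\<lambda>n. integral\<^sup>L ?M (\<lambda>x. \<Sum>i\<in>Basis. (G x \<bullet> i) * partial i (\<psi> n) x))
      \<longlonglongrightarrow> integral\<^sup>L ?M (\<lambda>x. \<Sum>i\<in>Basis. (G x \<bullet> i) * (\<Gamma> x \<bullet> i))"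
  proof (rule integral_dominated_convergence[where w = "\<lambda>_. \<Sum>i\<in>(Basis::'a set). C i * B"])
    show "(\<lambda>x. \<Sum>i\<in>Basis. (G x \<bullet> i) * (\<Gamma> x \<bullet> i)) \<in> borel_measurable ?M"
      by (intro borel_measurable_sum borel_measurable_times Gm pm cGi)
    show "(\<lambda>x. \<Sum>i\<in>Basis. (G x \<bullet> i) * partial i (\<psi> n) x) \<in> borel_measurable ?M" for n
      by (intro borel_measurable_sum borel_measurable_times Gm pm test_fun_deriv(3)[OF t])
    show "integrable ?M (\<lambda>_. \<Sum>i\<in>(Basis::'a set). C i * B)"
      by (rule finite_measure.integrable_const[OF finite_measure_ball])
    show "AE x in ?M. (\<lambda>n. \<Sum>i\<in>Basis. (G x \<bullet> i) * partial i (\<psi> n) x) \<longlonglongrightarrow> (\<Sum>i\<in>Basis. (G x \<bullet> i) * (\<Gamma> x \<bullet> i))"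
      by (intro AE_I2 tendsto_sum tendsto_mult tendsto_const l1)
    show "AE x in ?M. norm (\<Sum>i\<in>Basis. (G x \<bullet> i) * partial i (\<psi> n) x) \<le> (\<Sum>i\<in>Basis. C i * B)" for n
    proof (intro AE_I2)
      fix x assume "x \<in> space ?M"
      then have x: "x \<in> cball 0 R" by simp
      show "norm (\<Sum>i\<in>Basis. (G x \<bullet> i) * partial i (\<psi> n) x) \<le> (\<Sum>i\<in>Basis. C i * B)"
        by (intro sum_norm_le) (auto simp: abs_mult intro!: mult_mono C(1) C(2)[OF x] b1)
    qed
  qed
  have 2: "(\<lambda>n. integral\<^sup>L ?M (\<lambda>x. a x * u x powr q * \<psi> n x)) \<longlonglongrightarrow> integral\<^sup>L ?M (\<lambda>x. a x * u x powr q * \<phi> x)"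
  proof (rule integral_dominated_convergence[where w = "\<lambda>_. H * B"])
    show "(\<lambda>x. a x * u x powr q * \<phi> x) \<in> borel_measurable ?M"
      by (intro borel_measurable_times hm pm cphi)
    show "(\<lambda>x. a x * u x powr q * \<psi> n x) \<in> borel_measurable ?M" for n
      by (intro borel_measurable_times hm pm test_fun_deriv(4)[OF t])
    show "integrable ?M (\<lambda>_. H * B)" by (rule finite_measure.integrable_const[OF finite_measure_ball])
    show "AE x in ?M. (\<lambda>n. a x * u x powr q * \<psi> n x) \<longlonglongrightarrow> a x * u x powr q * \<phi> x"
      by (intro AE_I2 tendsto_mult tendsto_const l0)
    show "AE x in ?M. norm (a x * u x powr q * \<psi> n x) \<le> H * B" for n
      using hb
    proof eventually_elim
      case (elim x)
      then show ?case unfolding real_norm_def abs_mult[of "a x * u x powr q"]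
        using b0[of n x] \<open>0 \<le> B\<close> by (intro mult_mono) auto
    qed
  qed
  have "integral\<^sup>L ?M (\<lambda>x. \<Sum>i\<in>Basis. (G x \<bullet> i) * partial i (\<psi> n) x) = integral\<^sup>L ?M (\<lambda>x. a x * u x powr q * \<psi> n x)" for n
    by (rule weak_form_test_fun[OF a sol cu G du t])
  then have "integral\<^sup>L ?M (\<lambda>x. \<Sum>i\<in>Basis. (G x \<bullet> i) * (\<Gamma> x \<bullet> i)) = integral\<^sup>L ?M (\<lambda>x. a x * u x powr q * \<phi> x)"
    using LIMSEQ_unique[OF 1] 2 by simp
  then show ?thesis by (simp flip: euclidean_inner)
qed

section \<open>Cutoff functions and the behaviour at the boundary sphere\<close>

lemma pos_part_power_deriv:
  assumes m: "2 \<le> m"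
  shows "((\<lambda>t::real. (max t 0) ^ m) has_real_derivative real m * (max t 0) ^ (m - 1)) (at t)"
proof (cases t "0::real" rule: linorder_cases)
  case less
  have "((\<lambda>_. 0) has_real_derivative 0) (at t)" by simp
  then have "((\<lambda>t. (max t 0) ^ m) has_real_derivative 0) (at t)"
    by (rule has_field_derivative_transform_within_open[of _ _ _ "{..<0}"]) (use less m in \<open>auto simp: max_def\<close>)
  then show ?thesis using less m by (simp add: max_def zero_power)
next
  case greater
  have "((\<lambda>t. t ^ m) has_real_derivative real m * t ^ (m - 1)) (at t)"
    by (auto intro!: derivative_eq_intros)
  then have "((\<lambda>t. (max t 0) ^ m) has_real_derivative real m * t ^ (m - 1)) (at t)"
    by (rule has_field_derivative_transform_within_open[of _ _ _ "{0<..}"]) (use greater in \<open>auto simp: max_def\<close>)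
  then show ?thesis using greater by (simp add: max_def)
next
  case equal
  define j where "j = m - 2"
  have m': "m = Suc (Suc j)" using m by (simp add: j_def)
  have "((\<lambda>h. (max h 0) ^ m / h) \<longlongrightarrow> 0) (at (0::real))"
  proof (rule Lim_null_comparison)
    show "\<forall>\<^sub>F h in at (0::real). norm ((max h 0) ^ m / h) \<le> \<bar>h\<bar> ^ (m - 1)"
    proof (intro always_eventually allI)
      fix h :: real
      show "norm ((max h 0) ^ m / h) \<le> \<bar>h\<bar> ^ (m - 1)"
        by (auto simp: m' max_def abs_mult power_abs intro!: mult_nonpos_nonneg)
    qed
    have "((\<lambda>h. \<bar>h\<bar> ^ (m - 1)) \<longlongrightarrow> \<bar>0::real\<bar> ^ (m - 1)) (at 0)" by (intro tendsto_intros)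
    then show "((\<lambda>h. \<bar>h\<bar> ^ (m - 1)) \<longlongrightarrow> 0) (at (0::real))" using m by (simp add: zero_power)
  qed
  then show ?thesis using equal m by (simp add: DERIV_def zero_power)
qed

text \<open>With p(t) the square of the positive part of t, the function 1 - p(1 - p(t)) is 0 for t
  <= 0, is 1 for t >= 1, and is C^1 across both ends. The gradient of the cutoff is radial, - k x
  with k >= 0, so it meets only the radial part of the gradient of u.\<close>

lemma radial_cutoff:
  fixes b c :: real
  assumes bc: "c < b"
  obtains \<eta> k :: "'a::euclidean_space \<Rightarrow> real"
  where "\<And>x. (\<eta> has_derivative (\<lambda>h. - k x * (x \<bullet> h))) (at x)" "continuous_on UNIV k"
    "\<And>x. 0 \<le> \<eta> x \<and> \<eta> x \<le> 1" "\<And>x. x \<bullet> x \<le> c \<Longrightarrow> \<eta> x = 1" "\<And>x. b \<le> x \<bullet> x \<Longrightarrow> \<eta> x = 0"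
    "\<And>x. 0 \<le> k x" "\<And>x. x \<bullet> x < c \<Longrightarrow> k x = 0" "\<And>x. b \<le> x \<bullet> x \<Longrightarrow> k x = 0"
proof -
  define p where "p t = (max t 0)\<^sup>2" for t :: real
  have p: "(p has_real_derivative 2 * max t 0) (at t)" for t
    using pos_part_power_deriv[of 2 t] by (simp add: p_def[abs_def])
  define \<tau> where "\<tau> x = (b - x \<bullet> x) / (b - c)" for x :: 'a
  define \<eta> where "\<eta> x = 1 - p (1 - p (\<tau> x))" for x
  define k where "k x = 8 * max (1 - p (\<tau> x)) 0 * max (\<tau> x) 0 / (b - c)" for x
  have "((\<lambda>t. 1 - p (1 - p t)) has_real_derivative 4 * max (1 - p t) 0 * max t 0) (at t)" for t
    by (auto intro!: derivative_eq_intros DERIV_chain2[OF p] p)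
  then have d1: "((\<lambda>t. 1 - p (1 - p t)) has_derivative (*) (4 * max (1 - p t) 0 * max t 0)) (at t)" for t
    by (simp add: has_field_derivative_def)
  have d2: "(\<tau> has_derivative (\<lambda>h. - 2 * (x \<bullet> h) / (b - c))) (at x)" for x
    unfolding \<tau>_def using bc by (auto intro!: derivative_eq_intros simp: inner_commute)
  have cp: "continuous_on UNIV p" unfolding p_def by (intro continuous_intros)
  have ct: "continuous_on UNIV \<tau>" unfolding \<tau>_def using bc by (intro continuous_intros) auto
  have p01: "0 \<le> p t" for t by (simp add: p_def)
  have p1: "p t \<le> 1" if "t \<le> 1" for t unfolding p_def by (intro power_le_one) (use that in auto)
  show thesis
  proof (rule that[of \<eta> k])
    show "(\<eta> has_derivative (\<lambda>h. - k x * (x \<bullet> h))) (at x)" for x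
    proof -
      have "(\<eta> has_derivative (\<lambda>h. 4 * max (1 - p (\<tau> x)) 0 * max (\<tau> x) 0 * (- 2 * (x \<bullet> h) / (b - c)))) (at x)"
        using has_derivative_compose[OF d2 d1] by (simp add: \<eta>_def[abs_def])
      then show ?thesis by (simp add: k_def field_simps)
    qed
    show "continuous_on UNIV k"
      unfolding k_def using bc by (intro continuous_intros ct continuous_on_compose2[OF cp]) auto
    show "0 \<le> \<eta> x \<and> \<eta> x \<le> 1" for x using p01[of "\<tau> x"] p01[of "1 - p (\<tau> x)"] p1[of "1 - p (\<tau> x)"] by (auto simp: \<eta>_def)
    show "\<eta> x = 1" if "x \<bullet> x \<le> c" for x
    proof -
      have "1 \<le> \<tau> x" using that bc by (simp add: \<tau>_def field_simps)
      then have "1 \<le> p (\<tau> x)" unfolding p_def by (intro one_le_power) auto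
      then show ?thesis by (simp add: \<eta>_def p_def[of "1 - p (\<tau> x)"])
    qed
    show "k x = 0" if "x \<bullet> x < c" for x
    proof -
      have "1 \<le> \<tau> x" using that bc by (simp add: \<tau>_def field_simps)
      then have "1 \<le> p (\<tau> x)" unfolding p_def by (intro one_le_power) auto
      then show ?thesis by (simp add: k_def)
    qed
    show "\<eta> x = 0" "k x = 0" if "b \<le> x \<bullet> x" for x
    proof -
      have "\<tau> x \<le> 0" using that bc by (simp add: \<tau>_def field_simps)
      then show "\<eta> x = 0" "k x = 0" by (simp_all add: \<eta>_def k_def p_def)
    qed
    show "0 \<le> k x" for x unfolding k_def using bc by (intro divide_nonneg_nonneg mult_nonneg_nonneg) auto
  qed
qed

text \<open>The mean value theorem on the segment from t x to x expresses the difference quotient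
  through G at a nearby point of the segment; continuity of G up to the sphere transfers the limit 0
  to the value at x.\<close>

lemma normal_derivative_zero:
  fixes u :: "'a::euclidean_space \<Rightarrow> real"
  assumes cu: "continuous_on (cball 0 R) u" and G: "continuous_on (cball 0 R) G"
    and du: "\<And>x. x \<in> ball 0 R \<Longrightarrow> (u has_derivative (\<lambda>h. G x \<bullet> h)) (at x)"
    and R: "0 < R" and x: "norm x = R"
    and n: "((\<lambda>t. u (t *\<^sub>R x)) has_real_derivative 0) (at_left 1)"
  shows "G x \<bullet> x = 0"
proof (rule ccontr)
  assume ne: "G x \<bullet> x \<noteq> 0"
  define e where "e = \<bar>G x \<bullet> x\<bar> / 2"
  have e: "0 < e" using ne by (simp add: e_def)
  have seg: "t *\<^sub>R x \<in> cball 0 R" if "0 \<le> t" "t \<le> 1" for t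
    using that x R by (simp add: mult_left_le_one_le)
  have segb: "t *\<^sub>R x \<in> ball 0 R" if "0 \<le> t" "t < 1" for t
    using that x R by simp
  have cg: "continuous_on {0..1} (\<lambda>t. G (t *\<^sub>R x) \<bullet> x)"
    by (intro continuous_intros continuous_on_compose2[OF G]) (use seg in auto)
  obtain d1 where d1: "0 < d1" "\<And>t. t \<in> {0..1} \<Longrightarrow> dist t 1 < d1 \<Longrightarrow> \<bar>G (t *\<^sub>R x) \<bullet> x - G x \<bullet> x\<bar> < e"
    using cg[unfolded continuous_on_iff, rule_format, of 1 e] e by (auto simp: dist_real_def)
  have "((\<lambda>t. (u (t *\<^sub>R x) - u x) / (t - 1)) \<longlongrightarrow> 0) (at_left 1)"
    using n by (simp add: has_field_derivative_iff)
  from tendstoD[OF this e] have "\<forall>\<^sub>F t in at_left 1. \<bar>(u (t *\<^sub>R x) - u x) / (t - 1)\<bar> < e"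
    by (simp add: dist_real_def)
  then obtain b where b: "b < 1" "\<And>t. b < t \<Longrightarrow> t < 1 \<Longrightarrow> \<bar>(u (t *\<^sub>R x) - u x) / (t - 1)\<bar> < e"
    unfolding eventually_at_left_field by auto
  define t where "t = max (max (1/2) (1 - d1 / 2)) ((b + 1) / 2)"
  have t: "0 < t" "t < 1" "1 - d1 < t" "b < t" using d1 b by (auto simp: t_def max_def field_simps)
  have "\<exists>\<xi>. t < \<xi> \<and> \<xi> < 1 \<and> u (1 *\<^sub>R x) - u (t *\<^sub>R x) = (1 - t) * (G (\<xi> *\<^sub>R x) \<bullet> x)"
  proof -
    have c: "continuous_on {t..1} (\<lambda>s. u (s *\<^sub>R x))"
      by (intro continuous_intros continuous_on_compose2[OF cu]) (use seg t in auto)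
    have d: "((\<lambda>s. u (s *\<^sub>R x)) has_derivative (\<lambda>k. k * (G (s *\<^sub>R x) \<bullet> x))) (at s)" if "t < s" "s < 1" for s
    proof -
      have "((\<lambda>s. s *\<^sub>R x) has_derivative (\<lambda>k. k *\<^sub>R x)) (at s)" by (auto intro!: derivative_eq_intros)
      from has_derivative_compose[OF this du[OF segb]] that t show ?thesis by simp
    qed
    show ?thesis using mvt[OF t(2) c d] by auto
  qed
  then obtain \<xi> where \<xi>: "t < \<xi>" "\<xi> < 1" "u x - u (t *\<^sub>R x) = (1 - t) * (G (\<xi> *\<^sub>R x) \<bullet> x)" by auto
  have "u (t *\<^sub>R x) - u x = (t - 1) * (G (\<xi> *\<^sub>R x) \<bullet> x)" using \<xi>(3) by (simp add: algebra_simps)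
  then have "(u (t *\<^sub>R x) - u x) / (t - 1) = G (\<xi> *\<^sub>R x) \<bullet> x" using t by simp
  then have "\<bar>G (\<xi> *\<^sub>R x) \<bullet> x\<bar> < e" using b(2)[of t] t by simp
  moreover have "\<bar>G (\<xi> *\<^sub>R x) \<bullet> x - G x \<bullet> x\<bar> < e" using \<xi> t by (intro d1) (auto simp: dist_real_def)
  ultimately show False by (auto simp: e_def abs_if split: if_splits)
qed

text \<open>Uniform continuity, comparing each point near the sphere with its radial
  projection.\<close>

lemma radial_part_small_near_sphere:
  fixes f :: "'a::euclidean_space \<Rightarrow> real"
  assumes f: "continuous_on (cball 0 R) f" and z: "\<And>x. norm x = R \<Longrightarrow> f x = 0" and R: "0 < R" and e: "0 < e"
  obtains \<rho> where "0 < \<rho>" "\<rho> < R" "\<And>x. x \<in> cball 0 R \<Longrightarrow> \<rho> \<le> norm x \<Longrightarrow> \<bar>f x\<bar> \<le> e"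
proof -
  have "uniformly_continuous_on (cball 0 R) f" using f by (intro compact_uniformly_continuous) auto
  then obtain d where d: "0 < d" "\<And>x y. x \<in> cball 0 R \<Longrightarrow> y \<in> cball 0 R \<Longrightarrow> dist y x < d \<Longrightarrow> dist (f y) (f x) < e"
    unfolding uniformly_continuous_on_def using e by metis
  define \<rho> where "\<rho> = max (R / 2) (R - d / 2)"
  show thesis
  proof (rule that[of \<rho>])
    show "0 < \<rho>" "\<rho> < R" using R d by (auto simp: \<rho>_def max_def)
    fix x :: 'a assume x: "x \<in> cball 0 R" "\<rho> \<le> norm x"
    have nx: "0 < norm x" using x R by (auto simp: \<rho>_def)
    define y where "y = (R / norm x) *\<^sub>R x"
    have y: "norm y = R" using nx R by (simp add: y_def)
    have "y - x = (R / norm x - 1) *\<^sub>R x" by (simp add: y_def scaleR_diff_left)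
    then have "norm (y - x) = \<bar>R / norm x - 1\<bar> * norm x" by simp
    also have "\<dots> = \<bar>(R / norm x - 1) * norm x\<bar>" by (simp add: abs_mult)
    also have "(R / norm x - 1) * norm x = R - norm x" using nx by (simp add: left_diff_distrib)
    finally have "dist y x < d" using x d by (auto simp: dist_norm \<rho>_def)
    then have "dist (f y) (f x) < e" using d(2)[of x y] x y by auto
    then show "\<bar>f x\<bar> \<le> e" using z[OF y] by (simp add: dist_real_def)
  qed
qed

text \<open>Testing with \<open>x\<close> shows that the gradient \<open>- k x *\<^sub>R x\<close> of a cutoff has bounded total mass.\<close>

lemma cutoff_gradient_mass:
  fixes \<eta> k :: "'a::euclidean_space \<Rightarrow> real"
  assumes R: "0 < R" and b: "b < R\<^sup>2"
    and d: "\<And>x. (\<eta> has_derivative (\<lambda>h. - k x * (x \<bullet> h))) (at x)" and ck: "continuous_on UNIV k"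
    and \<eta>: "\<And>x. 0 \<le> \<eta> x \<and> \<eta> x \<le> 1" and \<eta>0: "\<And>x. b \<le> x \<bullet> x \<Longrightarrow> \<eta> x = 0"
  shows "integral\<^sup>L (lebesgue_on (ball 0 R)) (\<lambda>x. k x * (x \<bullet> x)) \<le> real DIM('a) * measure (lebesgue_on (ball 0 R)) (ball (0::'a) R)"
proof -
  let ?M = "lebesgue_on (ball (0::'a) R)"
  obtain \<rho> where \<rho>: "0 \<le> \<rho>" "\<rho> < R" "b \<le> \<rho>\<^sup>2"
  proof (cases "0 \<le> b")
    case True
    have "sqrt b < R" using b R by (intro real_less_lsqrt) auto
    then show thesis using True by (intro that[of "sqrt b"]) auto
  qed (use R in \<open>auto intro!: that[of 0]\<close>)
  have supp: "\<eta> x = 0" if "x \<notin> cball 0 \<rho>" for x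
  proof -
    have "\<rho>\<^sup>2 \<le> (norm x)\<^sup>2" using that \<rho> by (intro power_mono) auto
    then show ?thesis using \<rho> by (intro \<eta>0) (simp add: power2_norm_eq_inner)
  qed
  have ce: "continuous_on UNIV \<eta>" by (rule has_derivative_continuous_on) (rule has_derivative_at_withinI[OF d])
  have ie: "integrable ?M \<eta>" by (intro integrable_on_ball_continuous continuous_on_subset[OF ce]) auto
  have parts: "integral\<^sup>L ?M (\<lambda>x. k x * ((x \<bullet> i) * (x \<bullet> i))) = integral\<^sup>L ?M \<eta>" if i: "i \<in> Basis" for i
  proof -
    \<comment> \<open>Integration by parts against a coordinate function. Summing over i gives N
      times the integral of \<eta>, and \<eta> <= 1.\<close>
    have "integral\<^sup>L ?M (\<lambda>x. (x \<bullet> i) * (- k x * (x \<bullet> i))) = - integral\<^sup>L ?M (\<lambda>x. (i \<bullet> i) * \<eta> x)"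
    proof (rule integration_by_parts_compact_support[where K = "cball 0 \<rho>" and v' = "\<lambda>x h. h \<bullet> i" and \<phi>' = "\<lambda>x h. - k x * (x \<bullet> h)"])
      show "((\<lambda>x. x \<bullet> i) has_derivative (\<lambda>h. h \<bullet> i)) (at x)" for x by (auto intro!: derivative_eq_intros)
      show "continuous_on UNIV (\<lambda>x. - k x * (x \<bullet> i))" by (intro continuous_intros ck)
    qed (use \<rho> supp d in auto)
    moreover have "integral\<^sup>L ?M (\<lambda>x. (x \<bullet> i) * (- k x * (x \<bullet> i))) = - integral\<^sup>L ?M (\<lambda>x. k x * ((x \<bullet> i) * (x \<bullet> i)))"
      by (simp add: mult_ac flip: Bochner_Integration.integral_minus)
    ultimately show ?thesis using i by simp
  qed
  have "integral\<^sup>L ?M (\<lambda>x. k x * (x \<bullet> x)) = integral\<^sup>L ?M (\<lambda>x. \<Sum>i\<in>Basis. k x * ((x \<bullet> i) * (x \<bullet> i)))"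
    by (simp add: euclidean_inner[of x x for x] sum_distrib_left)
  also have "\<dots> = (\<Sum>i\<in>Basis. integral\<^sup>L ?M (\<lambda>x. k x * ((x \<bullet> i) * (x \<bullet> i))))"
    by (rule Bochner_Integration.integral_sum)
      (intro integrable_on_ball_continuous continuous_intros continuous_on_subset[OF ck] subset_UNIV)
  also have "\<dots> = (\<Sum>i\<in>(Basis::'a set). integral\<^sup>L ?M \<eta>)" by (intro sum.cong refl parts)
  also have "\<dots> = real DIM('a) * integral\<^sup>L ?M \<eta>" by simp
  also have "\<dots> \<le> real DIM('a) * integral\<^sup>L ?M (\<lambda>_. 1)"
    using \<eta> ie finite_measure.integrable_const[OF finite_measure_ball]
    by (intro mult_left_mono integral_mono) auto
  finally show ?thesis by simp
qed

text \<open>Cutting \<phi> off near the sphere produces the extra term with k \<phi> (G . x). The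
  mass of k stays bounded by \<open>cutoff_gradient_mass\<close>, while G . x tends uniformly to 0
  at the sphere by the Neumann condition, so the term disappears in the limit and \<phi> is free on
  the boundary.\<close>

theorem neumann_weak_form:
  fixes a u :: "'a::euclidean_space \<Rightarrow> real"
  assumes R: "0 < R" and a: "Linf_on (ball 0 R) a" and sol: "is_solution R a q u"
    and cu: "continuous_on (cball 0 R) u" and pos: "\<And>x. x \<in> cball 0 R \<Longrightarrow> 0 < u x"
    and G: "continuous_on (cball 0 R) G"
    and du: "\<And>x. x \<in> ball 0 R \<Longrightarrow> (u has_derivative (\<lambda>h. G x \<bullet> h)) (at x)"
    and c\<phi>: "continuous_on (cball 0 R) \<phi>" and \<Gamma>: "continuous_on (cball 0 R) \<Gamma>"
    and \<phi>: "\<And>x. x \<in> ball 0 R \<Longrightarrow> (\<phi> has_derivative (\<lambda>h. \<Gamma> x \<bullet> h)) (at x)"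
  shows "integral\<^sup>L (lebesgue_on (ball 0 R)) (\<lambda>x. G x \<bullet> \<Gamma> x)
    = integral\<^sup>L (lebesgue_on (ball 0 R)) (\<lambda>x. a x * u x powr q * \<phi> x)"
proof -
  let ?M = "lebesgue_on (ball (0::'a) R)"
  define V where "V = measure ?M (ball (0::'a) R)"
  have V: "0 \<le> V" by (simp add: V_def)
  have cq: "continuous_on (cball 0 R) (\<lambda>x. u x powr q)"
    using pos by (intro continuous_intros cu) (auto simp: less_imp_neq[symmetric])
  have normal: "G x \<bullet> x = 0" if "norm x = R" for x
    by (rule normal_derivative_zero[OF cu G du R that]) (use sol that in \<open>auto simp: is_solution_def\<close>)
  \<comment> \<open>The cutoffs fall from 1 to 0 while x . x runs from c n to b n, and both increase
    to R^2. The bound c n >= R^2 / 2 gives 1 <= 2 (x . x) / R^2 wherever \<open>k n\<close> is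
    nonzero.\<close>
  define c where "c n = R\<^sup>2 * (1 - 1 / (real n + 2))" for n
  define b where "b n = (c n + R\<^sup>2) / 2" for n
  have R2: "0 < R\<^sup>2" using R by simp
  have c: "c n < R\<^sup>2" "R\<^sup>2 / 2 \<le> c n" for n
    using R2 by (auto simp: c_def field_simps)
  have clim: "c \<longlonglongrightarrow> R\<^sup>2"
  proof -
    have "(\<lambda>n. 1 / (real n + 2)) \<longlonglongrightarrow> 0"
      using LIMSEQ_ignore_initial_segment[OF LIMSEQ_inverse_real_of_nat, of 1] by (simp add: inverse_eq_divide add_ac)
    then have "(\<lambda>n. R\<^sup>2 * (1 - 1 / (real n + 2))) \<longlonglongrightarrow> R\<^sup>2 * (1 - 0)" by (intro tendsto_intros)
    then show ?thesis by (simp add: c_def[abs_def])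
  qed
  have bc: "c n < b n" "b n < R\<^sup>2" for n using c[of n] by (auto simp: b_def)
  have "\<exists>\<eta> k :: 'a \<Rightarrow> real. (\<forall>x. (\<eta> has_derivative (\<lambda>h. - k x * (x \<bullet> h))) (at x)) \<and> continuous_on UNIV k \<and>
    (\<forall>x. 0 \<le> \<eta> x \<and> \<eta> x \<le> 1) \<and> (\<forall>x. x \<bullet> x \<le> c n \<longrightarrow> \<eta> x = 1) \<and> (\<forall>x. b n \<le> x \<bullet> x \<longrightarrow> \<eta> x = 0) \<and>
    (\<forall>x. 0 \<le> k x) \<and> (\<forall>x. x \<bullet> x < c n \<longrightarrow> k x = 0) \<and> (\<forall>x. b n \<le> x \<bullet> x \<longrightarrow> k x = 0)" for n
    by (rule radial_cutoff[OF bc(1)[of n], where 'a='a]) (intro exI conjI allI impI, assumption+, simp_all)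
  then obtain \<eta> k :: "nat \<Rightarrow> 'a \<Rightarrow> real" where d\<eta>: "\<And>n x. (\<eta> n has_derivative (\<lambda>h. - k n x * (x \<bullet> h))) (at x)"
    and ck: "\<And>n. continuous_on UNIV (k n)" and \<eta>b: "\<And>n x. 0 \<le> \<eta> n x \<and> \<eta> n x \<le> 1"
    and \<eta>1: "\<And>n x. x \<bullet> x \<le> c n \<Longrightarrow> \<eta> n x = 1" and \<eta>0: "\<And>n x. b n \<le> x \<bullet> x \<Longrightarrow> \<eta> n x = 0"
    and kn: "\<And>n x. 0 \<le> k n x" and k0: "\<And>n x. x \<bullet> x < c n \<Longrightarrow> k n x = 0" and kb: "\<And>n x. b n \<le> x \<bullet> x \<Longrightarrow> k n x = 0"
    by metis
  have ce: "continuous_on S (\<eta> n)" for n S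
    by (rule has_derivative_continuous_on) (rule has_derivative_at_withinI[OF d\<eta>])
  have ck': "continuous_on S (k n)" for n S by (rule continuous_on_subset[OF ck]) auto
  have lim\<eta>: "(\<lambda>n. \<eta> n x) \<longlonglongrightarrow> 1" if x: "x \<in> ball 0 R" for x
  proof (rule tendsto_eventually)
    have "x \<bullet> x < R\<^sup>2"
    proof -
      have "(norm x)\<^sup>2 < R\<^sup>2" using x by (intro power_strict_mono) auto
      then show ?thesis by (simp add: power2_norm_eq_inner)
    qed
    with clim have "\<forall>\<^sub>F n in sequentially. x \<bullet> x < c n" by (rule order_tendstoD)
    then show "\<forall>\<^sub>F n in sequentially. \<eta> n x = 1" by eventually_elim (simp add: \<eta>1)
  qed
  have ident: "integral\<^sup>L ?M (\<lambda>x. \<eta> n x * (G x \<bullet> \<Gamma> x)) - integral\<^sup>L ?M (\<lambda>x. k n x * \<phi> x * (G x \<bullet> x))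
      = integral\<^sup>L ?M (\<lambda>x. a x * u x powr q * (\<eta> n x * \<phi> x))" for n
  proof -
    let ?S = "ball (0::'a) R"
    define K where "K = cball (0::'a) (sqrt (b n))"
    have bp: "0 < b n" using c[of n] R2 by (simp add: b_def)
    have "sqrt (b n) < R" using bc(2)[of n] R by (intro real_less_lsqrt) auto
    then have K: "compact K" "K \<subseteq> ?S" "closed K" by (auto simp: K_def)
    have out: "b n \<le> x \<bullet> x" if "x \<notin> K" for x
    proof -
      have "sqrt (b n) \<le> norm x" using that by (auto simp: K_def)
      then have "(sqrt (b n))\<^sup>2 \<le> (norm x)\<^sup>2" using bp by (intro power_mono) auto
      then show ?thesis using bp by (simp add: power2_norm_eq_inner)
    qed
    define F where "F x = (if x \<in> ?S then \<eta> n x * \<phi> x else 0)" for x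
    define D where "D x = (if x \<in> ?S then \<eta> n x *\<^sub>R \<Gamma> x - (k n x * \<phi> x) *\<^sub>R x else 0)" for x
    have dF: "(F has_derivative (\<lambda>h. D x \<bullet> h)) (at x)" for x
    proof -
      have "(F has_derivative (if x \<in> ?S then (\<lambda>h. (\<eta> n x *\<^sub>R \<Gamma> x - (k n x * \<phi> x) *\<^sub>R x) \<bullet> h) else (\<lambda>h. 0))) (at x)"
        unfolding F_def
      proof (rule has_derivative_extend_zero[OF open_ball K(3,2)])
        fix y assume y: "y \<in> ?S"
        show "((\<lambda>x. \<eta> n x * \<phi> x) has_derivative (\<lambda>h. (\<eta> n y *\<^sub>R \<Gamma> y - (k n y * \<phi> y) *\<^sub>R y) \<bullet> h)) (at y)"
          using has_derivative_mult[OF d\<eta> \<phi>[OF y], of n]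
          by (rule has_derivative_eq_rhs) (auto simp: fun_eq_iff inner_diff_left algebra_simps)
      next
        fix y assume "y \<in> ?S - K"
        then show "\<eta> n y * \<phi> y = 0" using \<eta>0 out by auto
      qed
      moreover have "(if x \<in> ?S then (\<lambda>h. (\<eta> n x *\<^sub>R \<Gamma> x - (k n x * \<phi> x) *\<^sub>R x) \<bullet> h) else (\<lambda>h. 0)) = (\<lambda>h. D x \<bullet> h)"
        by (auto simp: D_def)
      ultimately show ?thesis by simp
    qed
    have cD: "continuous_on UNIV D"
      unfolding D_def
    proof (rule continuous_on_extend_zero[OF open_ball K(3,2)])
      show "continuous_on ?S (\<lambda>x. \<eta> n x *\<^sub>R \<Gamma> x - (k n x * \<phi> x) *\<^sub>R x)"
        by (intro continuous_intros ce ck' continuous_on_subset[OF \<Gamma>] continuous_on_subset[OF c\<phi>]) auto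
      show "\<eta> n x *\<^sub>R \<Gamma> x - (k n x * \<phi> x) *\<^sub>R x = 0" if "x \<in> ?S - K" for x
        using that \<eta>0 kb out by auto
    qed
    have F0: "F x = 0" if "x \<notin> K" for x using that \<eta>0 out by (auto simp: F_def)
    have "integral\<^sup>L ?M (\<lambda>x. G x \<bullet> D x) = integral\<^sup>L ?M (\<lambda>x. a x * u x powr q * F x)"
      by (rule weak_form_C1_compact[OF a sol cq G du dF cD K(1,2) F0])
    also have "\<dots> = integral\<^sup>L ?M (\<lambda>x. a x * u x powr q * (\<eta> n x * \<phi> x))"
      by (intro Bochner_Integration.integral_cong) (auto simp: F_def)
    finally have "integral\<^sup>L ?M (\<lambda>x. G x \<bullet> D x) = integral\<^sup>L ?M (\<lambda>x. a x * u x powr q * (\<eta> n x * \<phi> x))" .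
    moreover have "integral\<^sup>L ?M (\<lambda>x. G x \<bullet> D x)
        = integral\<^sup>L ?M (\<lambda>x. \<eta> n x * (G x \<bullet> \<Gamma> x) - k n x * \<phi> x * (G x \<bullet> x))"
      by (intro Bochner_Integration.integral_cong) (auto simp: D_def inner_diff_right)
    moreover have "\<dots> = integral\<^sup>L ?M (\<lambda>x. \<eta> n x * (G x \<bullet> \<Gamma> x)) - integral\<^sup>L ?M (\<lambda>x. k n x * \<phi> x * (G x \<bullet> x))"
      by (intro Bochner_Integration.integral_diff integrable_on_ball_continuous continuous_intros ce ck' G \<Gamma> c\<phi>)
    ultimately show ?thesis by simp
  qed
  have 1: "(\<lambda>n. integral\<^sup>L ?M (\<lambda>x. \<eta> n x * (G x \<bullet> \<Gamma> x))) \<longlonglongrightarrow> integral\<^sup>L ?M (\<lambda>x. G x \<bullet> \<Gamma> x)"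
  proof (rule integral_dominated_convergence[where w = "\<lambda>x. \<bar>G x \<bullet> \<Gamma> x\<bar>"])
    have i: "integrable ?M (\<lambda>x. G x \<bullet> \<Gamma> x)" by (intro integrable_on_ball_continuous continuous_intros G \<Gamma>)
    then show "(\<lambda>x. G x \<bullet> \<Gamma> x) \<in> borel_measurable ?M" "integrable ?M (\<lambda>x. \<bar>G x \<bullet> \<Gamma> x\<bar>)" by auto
    show "(\<lambda>x. \<eta> n x * (G x \<bullet> \<Gamma> x)) \<in> borel_measurable ?M" for n
      by (intro borel_measurable_integrable integrable_on_ball_continuous continuous_intros ce G \<Gamma>)
    show "AE x in ?M. (\<lambda>n. \<eta> n x * (G x \<bullet> \<Gamma> x)) \<longlonglongrightarrow> G x \<bullet> \<Gamma> x"
      using lim\<eta> by (intro AE_I2) (auto intro!: tendsto_eq_intros)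
    show "AE x in ?M. norm (\<eta> n x * (G x \<bullet> \<Gamma> x)) \<le> \<bar>G x \<bullet> \<Gamma> x\<bar>" for n
      using \<eta>b by (intro AE_I2) (auto simp: abs_mult intro!: mult_left_le_one_le)
  qed
  obtain H where hm: "(\<lambda>x. a x * (u x powr q * \<phi> x)) \<in> borel_measurable ?M"
    and hb: "AE x in ?M. \<bar>a x * (u x powr q * \<phi> x)\<bar> \<le> H"
    by (rule Linf_times_continuous[OF a continuous_on_mult[OF cq c\<phi>]]) (rule that)
  have 2: "(\<lambda>n. integral\<^sup>L ?M (\<lambda>x. a x * u x powr q * (\<eta> n x * \<phi> x))) \<longlonglongrightarrow> integral\<^sup>L ?M (\<lambda>x. a x * u x powr q * \<phi> x)"
  proof (rule integral_dominated_convergence[where w = "\<lambda>x. \<bar>a x * (u x powr q * \<phi> x)\<bar>"])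
    show "integrable ?M (\<lambda>x. \<bar>a x * (u x powr q * \<phi> x)\<bar>)"
      using integrable_on_ball_bounded[OF hm hb] by (rule integrable_abs)
    show m: "(\<lambda>x. a x * u x powr q * \<phi> x) \<in> borel_measurable ?M" using hm by (simp add: mult.assoc)
    have "(\<lambda>x. \<eta> n x * (a x * u x powr q * \<phi> x)) \<in> borel_measurable ?M" for n
      by (rule borel_measurable_times[OF borel_measurable_on_ball_continuous[OF ce] m])
    then show "(\<lambda>x. a x * u x powr q * (\<eta> n x * \<phi> x)) \<in> borel_measurable ?M" for n by (simp add: mult_ac)
    show "AE x in ?M. (\<lambda>n. a x * u x powr q * (\<eta> n x * \<phi> x)) \<longlonglongrightarrow> a x * u x powr q * \<phi> x"
      using lim\<eta> by (intro AE_I2) (auto intro!: tendsto_eq_intros)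
    show "AE x in ?M. norm (a x * u x powr q * (\<eta> n x * \<phi> x)) \<le> \<bar>a x * (u x powr q * \<phi> x)\<bar>" for n
    proof (intro AE_I2)
      fix x
      have "a x * u x powr q * (\<eta> n x * \<phi> x) = \<eta> n x * (a x * (u x powr q * \<phi> x))" by (simp only: mult_ac)
      then show "norm (a x * u x powr q * (\<eta> n x * \<phi> x)) \<le> \<bar>a x * (u x powr q * \<phi> x)\<bar>"
        unfolding real_norm_def abs_mult[of "\<eta> n x"]
        using \<eta>b[of n x] mult_left_le_one_le[of "\<bar>a x * (u x powr q * \<phi> x)\<bar>" "\<eta> n x"]
        by (simp only: abs_mult[of "\<eta> n x"] abs_of_nonneg abs_ge_zero)
    qed
  qed
  obtain P where P: "0 \<le> P" "\<And>x. x \<in> cball 0 R \<Longrightarrow> \<bar>\<phi> x\<bar> \<le> P" using continuous_on_cball_bounded[OF c\<phi>] by blast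
  have 3: "(\<lambda>n. integral\<^sup>L ?M (\<lambda>x. k n x * \<phi> x * (G x \<bullet> x))) \<longlonglongrightarrow> 0"
  proof (rule LIMSEQ_I)
    fix r :: real assume r: "0 < r"
    \<comment> \<open>The summand 1 keeps A positive, so that e = r / (2 A) makes the boundary term
      at most r / 2.\<close>
    define A where "A = P * (2 / R\<^sup>2) * (real DIM('a) * V) + 1"
    have A: "1 \<le> A" using P V R2 by (simp add: A_def)
    define e where "e = r / (2 * A)"
    have e: "0 < e" using r A by (simp add: e_def)
    have cGx: "continuous_on (cball 0 R) (\<lambda>x. G x \<bullet> x)" by (intro continuous_intros G)
    obtain \<rho> where \<rho>: "0 < \<rho>" "\<rho> < R" "\<And>x. x \<in> cball 0 R \<Longrightarrow> \<rho> \<le> norm x \<Longrightarrow> \<bar>G x \<bullet> x\<bar> \<le> e"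
      by (rule radial_part_small_near_sphere[OF cGx normal R e]) (assumption, rule that)
    have "\<rho>\<^sup>2 < R\<^sup>2" using \<rho> by (intro power_strict_mono) auto
    then have "\<forall>\<^sub>F n in sequentially. \<rho>\<^sup>2 < c n" using clim by (intro order_tendstoD)
    then obtain n0 where n0: "\<And>n. n0 \<le> n \<Longrightarrow> \<rho>\<^sup>2 < c n" by (auto simp: eventually_sequentially)
    show "\<exists>n0. \<forall>n\<ge>n0. norm (integral\<^sup>L ?M (\<lambda>x. k n x * \<phi> x * (G x \<bullet> x)) - 0) < r"
    proof (intro exI allI impI)
      fix n assume n: "n0 \<le> n"
      have bound: "norm (k n x * \<phi> x * (G x \<bullet> x)) \<le> e * P * (2 / R\<^sup>2) * (k n x * (x \<bullet> x))" if x: "x \<in> ball 0 R" for x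
      proof (cases "x \<bullet> x < c n")
        case False
        have "\<rho>\<^sup>2 < (norm x)\<^sup>2" using False n0[OF n] by (simp add: power2_norm_eq_inner)
        then have "\<rho> \<le> norm x" using \<rho>(1) by (meson norm_ge_zero not_le order_less_imp_le power_mono)
        then have g: "\<bar>G x \<bullet> x\<bar> \<le> e" using \<rho>(3)[of x] x by simp
        have "1 \<le> 2 / R\<^sup>2 * (x \<bullet> x)" using False c(2)[of n] R2 by (simp add: field_simps)
        then have "k n x * 1 \<le> k n x * (2 / R\<^sup>2 * (x \<bullet> x))" using kn by (intro mult_left_mono) auto
        moreover have "\<bar>k n x * \<phi> x * (G x \<bullet> x)\<bar> \<le> k n x * P * e"
          unfolding abs_mult using kn[of n x] P g x by (intro mult_mono) auto
        moreover have "e * P * (k n x * 1) \<le> e * P * (k n x * (2 / R\<^sup>2 * (x \<bullet> x)))"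
          using e P by (intro mult_left_mono[OF calculation(1)]) auto
        ultimately show ?thesis by (simp add: mult_ac)
      qed (simp add: k0)
      have "norm (integral\<^sup>L ?M (\<lambda>x. k n x * \<phi> x * (G x \<bullet> x))) \<le> integral\<^sup>L ?M (\<lambda>x. e * P * (2 / R\<^sup>2) * (k n x * (x \<bullet> x)))"
        by (rule Bochner_Integration.integral_norm_bound_integral)
          (use bound R in \<open>auto intro!: integrable_on_ball_continuous continuous_intros ck' G c\<phi>\<close>)
      also have "\<dots> = e * P * (2 / R\<^sup>2) * integral\<^sup>L ?M (\<lambda>x. k n x * (x \<bullet> x))" by simp
      also have "\<dots> \<le> e * P * (2 / R\<^sup>2) * (real DIM('a) * V)"
        unfolding V_def using e P
        by (intro mult_left_mono cutoff_gradient_mass[OF R bc(2) d\<eta> ck \<eta>b \<eta>0]) auto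
      also have "\<dots> \<le> e * A" using e by (simp add: A_def algebra_simps)
      also have "\<dots> = r / 2" using A by (simp add: e_def)
      also have "\<dots> < r" using r by simp
      finally show "norm (integral\<^sup>L ?M (\<lambda>x. k n x * \<phi> x * (G x \<bullet> x)) - 0) < r" by simp
    qed
  qed
  have "(\<lambda>n. integral\<^sup>L ?M (\<lambda>x. a x * u x powr q * (\<eta> n x * \<phi> x))) \<longlonglongrightarrow> integral\<^sup>L ?M (\<lambda>x. G x \<bullet> \<Gamma> x)"
    using tendsto_diff[OF 1 3] unfolding ident by simp
  then show ?thesis using 2 by (rule LIMSEQ_unique)
qed

subsection \<open>Uniqueness\<close>

text \<open>Convexity and homogeneity of |A|^2 / a in the pair (A, a): the two sides differ by |b A
  - a B|^2 / (a b (a + b)).\<close>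

lemma perspective_subadditive:
  fixes A B :: "'a::real_inner"
  assumes "0 < a" "0 < b"
  shows "(A + B) \<bullet> (A + B) / (a + b) \<le> A \<bullet> A / a + B \<bullet> B / b"
proof -
  have "0 \<le> (b *\<^sub>R A - a *\<^sub>R B) \<bullet> (b *\<^sub>R A - a *\<^sub>R B)" by simp
  also have "\<dots> = (a + b) * (b * (A \<bullet> A) + a * (B \<bullet> B)) - a * b * ((A + B) \<bullet> (A + B))"
    by (simp add: inner_diff_left inner_diff_right inner_add_left inner_add_right inner_commute algebra_simps)
  finally have *: "a * b * ((A + B) \<bullet> (A + B)) \<le> (a + b) * (b * (A \<bullet> A) + a * (B \<bullet> B))" by simp
  have "(A + B) \<bullet> (A + B) / (a + b) = a * b * ((A + B) \<bullet> (A + B)) / (a * b * (a + b))" using assms by simp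
  also have "\<dots> \<le> (a + b) * (b * (A \<bullet> A) + a * (B \<bullet> B)) / (a * b * (a + b))"
    using * assms by (intro divide_right_mono) auto
  also have "\<dots> = (b * (A \<bullet> A) + a * (B \<bullet> B)) / (a * b)" using assms by simp
  also have "\<dots> = A \<bullet> A / a + B \<bullet> B / b" using assms by (simp add: add_divide_distrib)
  finally show ?thesis .
qed

lemma powr_has_gradient:
  fixes u :: "'a::euclidean_space \<Rightarrow> real"
  assumes "(u has_derivative (\<lambda>h. G \<bullet> h)) (at x)" "0 < u x"
  shows "((\<lambda>x. u x powr p) has_derivative (\<lambda>h. ((p * u x powr (p - 1)) *\<^sub>R G) \<bullet> h)) (at x)"
proof -
  have "((\<lambda>t. t powr p) has_real_derivative p * u x powr (p - 1)) (at (u x))"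
    using assms(2) by (auto intro!: derivative_eq_intros)
  then have "((\<lambda>t. t powr p) has_derivative (*) (p * u x powr (p - 1))) (at (u x))"
    by (simp add: has_field_derivative_def)
  from has_derivative_compose[OF assms(1) this] show ?thesis by simp
qed

lemma nonneg_continuous_integral_zero:
  fixes f :: "'a::euclidean_space \<Rightarrow> real"
  assumes c: "continuous_on (cball 0 R) f" and nn: "\<And>x. x \<in> ball 0 R \<Longrightarrow> 0 \<le> f x"
    and z: "integral\<^sup>L (lebesgue_on (ball 0 R)) f = 0" and x: "x \<in> ball 0 R"
  shows "f x = 0"
proof (rule ccontr)
  assume ne: "f x \<noteq> 0"
  have "AE x in lebesgue_on (ball 0 R). 0 \<le> f x" using nn by (intro AE_I2) simp
  then have "AE x in lebesgue_on (ball 0 R). f x = 0"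
    using integral_nonneg_eq_0_iff_AE[OF integrable_on_ball_continuous[OF c]] z by simp
  then have "AE x in lebesgue. x \<in> ball 0 R \<longrightarrow> f x = 0" by (simp add: AE_restrict_space_iff)
  then obtain Z where Z: "Z \<in> null_sets lebesgue" "{x. \<not> (x \<in> ball 0 R \<longrightarrow> f x = 0)} \<subseteq> Z"
    by (auto simp: eventually_ae_filter)
  define S where "S = ball 0 R \<inter> f -` (- {0})"
  have "open S" unfolding S_def
    by (intro continuous_open_preimage continuous_on_subset[OF c]) auto
  moreover have "S \<noteq> {}" using x ne by (auto simp: S_def)
  moreover have "negligible S"
    by (rule negligible_subset[of Z]) (use Z in \<open>auto simp: S_def negligible_iff_null_sets\<close>)
  ultimately show False using open_not_negligible by blast
qed

text \<open>Dividing the test function by u^q removes u from the right-hand side, at the price of a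
  term with q |grad u|^2 / u^(q+1). The perspective inequality bounds the difference of these terms
  for u and v by |P1 - P2|^2 / z, and a large power of the positive part of z makes the good term
  win.\<close>

lemma solution_comparison:
  fixes a u v :: "'a::euclidean_space \<Rightarrow> real"
  assumes R: "0 < R" and q: "0 < q" "q < 1" and a: "Linf_on (ball 0 R) a"
    and neg: "integral\<^sup>L (lebesgue_on (ball 0 R)) a < 0"
    and u: "u \<in> Pcirc R" "is_solution R a q u" and v: "v \<in> Pcirc R" "is_solution R a q v"
    and x: "x \<in> ball 0 R"
  shows "u x \<le> v x"
proof -
  let ?M = "lebesgue_on (ball (0::'a) R)"
  obtain G1 where cu: "continuous_on (cball 0 R) u" and pu: "\<And>x. x \<in> cball 0 R \<Longrightarrow> 0 < u x"
    and G1: "continuous_on (cball 0 R) G1" and du: "\<And>x. x \<in> ball 0 R \<Longrightarrow> (u has_derivative (\<lambda>h. G1 x \<bullet> h)) (at x)"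
    using u(1) unfolding Pcirc_def by blast
  obtain G2 where cv: "continuous_on (cball 0 R) v" and pv: "\<And>x. x \<in> cball 0 R \<Longrightarrow> 0 < v x"
    and G2: "continuous_on (cball 0 R) G2" and dv: "\<And>x. x \<in> ball 0 R \<Longrightarrow> (v has_derivative (\<lambda>h. G2 x \<bullet> h)) (at x)"
    using v(1) unfolding Pcirc_def by blast
  have cup: "continuous_on (cball 0 R) (\<lambda>x. u x powr p)" for p
    using pu by (intro continuous_intros cu) (auto simp: less_imp_neq[symmetric])
  have cvp: "continuous_on (cball 0 R) (\<lambda>x. v x powr p)" for p
    using pv by (intro continuous_intros cv) (auto simp: less_imp_neq[symmetric])
  define w1 where "w1 x = u x powr (1 - q)" for x
  define w2 where "w2 x = v x powr (1 - q)" for x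
  \<comment> \<open>\<open>P1\<close> is the gradient of \<open>w1\<close> divided by 1 - q; in
    these variables |grad u|^2 / u^(q+1) becomes |P1|^2 / w1.\<close>
  define P1 where "P1 x = u x powr (- q) *\<^sub>R G1 x" for x
  define P2 where "P2 x = v x powr (- q) *\<^sub>R G2 x" for x
  define z where "z x = w1 x - w2 x" for x
  have w: "0 < w1 x" "0 < w2 x" if "x \<in> ball 0 R" for x
    using pu[of x] pv[of x] that by (auto simp: w1_def w2_def)
  have dz: "(z has_derivative (\<lambda>h. ((1 - q) *\<^sub>R (P1 x - P2 x)) \<bullet> h)) (at x)" if "x \<in> ball 0 R" for x
  proof -
    have "0 < u x" "0 < v x" using pu[of x] pv[of x] that by auto
    then show ?thesis
      unfolding z_def w1_def w2_def
      using has_derivative_diff[OF powr_has_gradient[OF du[OF that], of "1 - q"] powr_has_gradient[OF dv[OF that], of "1 - q"]]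
      by (simp add: P1_def P2_def inner_diff_left algebra_simps)
  qed
  have cz: "continuous_on (cball 0 R) z" unfolding z_def w1_def w2_def by (intro continuous_intros cup cvp)
  have cP: "continuous_on (cball 0 R) P1" "continuous_on (cball 0 R) P2"
    unfolding P1_def P2_def by (intro continuous_intros cup cvp G1 G2)+
  \<comment> \<open>m > q / (1 - q) makes the coefficient m (1 - q) - q in \<open>lower\<close>
    positive, and m >= 2 makes \<psi> continuously differentiable.\<close>
  obtain m0 :: nat where m0: "q / (1 - q) < real m0" using reals_Archimedean2 by blast
  define m where "m = m0 + 2"
  have m: "2 \<le> m" by (simp add: m_def)
  have "q / (1 - q) < real m" using m0 by (simp add: m_def)
  then have mq: "0 < real m * (1 - q) - q" using q by (simp add: divide_less_eq)
  define \<psi> where "\<psi> x = (max (z x) 0) ^ m" for x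
  define D where "D x = (real m * (max (z x) 0) ^ (m - 1) * (1 - q)) *\<^sub>R (P1 x - P2 x)" for x
  have c\<psi>: "continuous_on (cball 0 R) \<psi>" unfolding \<psi>_def by (intro continuous_intros cz)
  have cD: "continuous_on (cball 0 R) D" unfolding D_def by (intro continuous_intros cz cP)
  have d\<psi>: "(\<psi> has_derivative (\<lambda>h. D x \<bullet> h)) (at x)" if "x \<in> ball 0 R" for x
    using has_derivative_compose[OF dz[OF that] pos_part_power_deriv[OF m, unfolded has_field_derivative_def]]
    by (simp add: \<psi>_def[abs_def] D_def mult_ac)
  \<comment> \<open>Tested with \<psi> s^(-q), the right-hand side is the integral of a \<psi>, the
    same for both solutions.\<close>
  have test: "integral\<^sup>L ?M (\<lambda>x. (s x powr (- q) *\<^sub>R G x) \<bullet> D x - q * \<psi> x * ((s x powr (- q) *\<^sub>R G x) \<bullet> (s x powr (- q) *\<^sub>R G x) / s x powr (1 - q)))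
      = integral\<^sup>L ?M (\<lambda>x. a x * \<psi> x)"
    if sol: "is_solution R a q s" and cs: "continuous_on (cball 0 R) s" and ps: "\<And>x. x \<in> cball 0 R \<Longrightarrow> 0 < s x"
      and G: "continuous_on (cball 0 R) G" and ds: "\<And>x. x \<in> ball 0 R \<Longrightarrow> (s has_derivative (\<lambda>h. G x \<bullet> h)) (at x)"
    for s G
  proof -
    have csp: "continuous_on (cball 0 R) (\<lambda>x. s x powr p)" for p
      using ps by (intro continuous_intros cs) (auto simp: less_imp_neq[symmetric])
    define \<Gamma> where "\<Gamma> x = s x powr (- q) *\<^sub>R D x - (q * \<psi> x * s x powr (- q - 1)) *\<^sub>R G x" for x
    have "integral\<^sup>L ?M (\<lambda>x. G x \<bullet> \<Gamma> x) = integral\<^sup>L ?M (\<lambda>x. a x * s x powr q * (\<psi> x * s x powr (- q)))"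
    proof (rule neumann_weak_form[OF R a sol cs ps G ds])
      show "continuous_on (cball 0 R) (\<lambda>x. \<psi> x * s x powr (- q))" by (intro continuous_intros c\<psi> csp)
      show "continuous_on (cball 0 R) \<Gamma>" unfolding \<Gamma>_def by (intro continuous_intros cD csp c\<psi> G)
      fix x :: 'a assume x: "x \<in> ball 0 R"
      have "0 < s x" using ps x by auto
      from has_derivative_mult[OF d\<psi>[OF x] powr_has_gradient[OF ds[OF x] this, of "- q"]]
      show "((\<lambda>x. \<psi> x * s x powr (- q)) has_derivative (\<lambda>h. \<Gamma> x \<bullet> h)) (at x)"
        by (rule has_derivative_eq_rhs) (auto simp: \<Gamma>_def fun_eq_iff inner_diff_left algebra_simps)
    qed
    moreover have "integral\<^sup>L ?M (\<lambda>x. a x * s x powr q * (\<psi> x * s x powr (- q))) = integral\<^sup>L ?M (\<lambda>x. a x * \<psi> x)"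
    proof (rule Bochner_Integration.integral_cong[OF refl])
      fix x assume "x \<in> space ?M"
      then have "0 < s x" using ps[of x] by simp
      then have "s x powr q * s x powr (- q) = 1" by (simp flip: powr_add)
      then show "a x * s x powr q * (\<psi> x * s x powr (- q)) = a x * \<psi> x"
        by (metis (no_types, opaque_lifting) mult.assoc mult.commute mult.right_neutral)
    qed
    moreover have "integral\<^sup>L ?M (\<lambda>x. G x \<bullet> \<Gamma> x) = integral\<^sup>L ?M (\<lambda>x. (s x powr (- q) *\<^sub>R G x) \<bullet> D x
        - q * \<psi> x * ((s x powr (- q) *\<^sub>R G x) \<bullet> (s x powr (- q) *\<^sub>R G x) / s x powr (1 - q)))"
    proof (rule Bochner_Integration.integral_cong[OF refl])
      fix x assume "x \<in> space ?M"
      then have sp: "0 < s x" using ps[of x] by simp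
      have "s x powr (- q) * s x powr (- q) / s x powr (1 - q) = s x powr (- q - 1)"
        using sp by (simp flip: powr_add powr_diff)
      then have "(s x powr (- q) *\<^sub>R G x) \<bullet> (s x powr (- q) *\<^sub>R G x) / s x powr (1 - q) = s x powr (- q - 1) * (G x \<bullet> G x)"
        by (simp add: mult.assoc[symmetric]) (metis mult.commute times_divide_eq_left)
      then show "G x \<bullet> \<Gamma> x = (s x powr (- q) *\<^sub>R G x) \<bullet> D x
        - q * \<psi> x * ((s x powr (- q) *\<^sub>R G x) \<bullet> (s x powr (- q) *\<^sub>R G x) / s x powr (1 - q))"
        by (simp only: \<Gamma>_def inner_diff_right inner_scaleR_left inner_scaleR_right mult.assoc)
    qed
    ultimately show ?thesis by simp
  qed
  \<comment> \<open>The difference of the two tested integrands. Its integral is 0, and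
    \<open>lower\<close> makes it nonnegative, so it vanishes pointwise.\<close>
  define I where "I x = (P1 x - P2 x) \<bullet> D x - q * \<psi> x * (P1 x \<bullet> P1 x / w1 x - P2 x \<bullet> P2 x / w2 x)" for x
  have wne: "w1 x \<noteq> 0" "w2 x \<noteq> 0" if "x \<in> cball 0 R" for x
    using pu[OF that] pv[OF that] by (auto simp: w1_def w2_def)
  have cw: "continuous_on (cball 0 R) w1" "continuous_on (cball 0 R) w2"
    unfolding w1_def w2_def by (rule cup cvp)+
  have c1: "continuous_on (cball 0 R) (\<lambda>x. P1 x \<bullet> D x - q * \<psi> x * (P1 x \<bullet> P1 x / w1 x))"
    using wne by (intro continuous_intros cP cD c\<psi> cw) auto
  have c2: "continuous_on (cball 0 R) (\<lambda>x. P2 x \<bullet> D x - q * \<psi> x * (P2 x \<bullet> P2 x / w2 x))"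
    using wne by (intro continuous_intros cP cD c\<psi> cw) auto
  have I_eq: "I x = (P1 x \<bullet> D x - q * \<psi> x * (P1 x \<bullet> P1 x / w1 x)) - (P2 x \<bullet> D x - q * \<psi> x * (P2 x \<bullet> P2 x / w2 x))" for x
    by (simp add: I_def inner_diff_left algebra_simps)
  have cI: "continuous_on (cball 0 R) I" unfolding I_eq[abs_def] by (intro continuous_intros c1 c2)
  have "integral\<^sup>L ?M I = integral\<^sup>L ?M (\<lambda>x. P1 x \<bullet> D x - q * \<psi> x * (P1 x \<bullet> P1 x / w1 x))
      - integral\<^sup>L ?M (\<lambda>x. P2 x \<bullet> D x - q * \<psi> x * (P2 x \<bullet> P2 x / w2 x))"
    unfolding I_eq[abs_def]
    by (rule Bochner_Integration.integral_diff[OF integrable_on_ball_continuous[OF c1] integrable_on_ball_continuous[OF c2]])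
  also have "\<dots> = 0"
    using test[OF u(2) cu pu G1 du] test[OF v(2) cv pv G2 dv] by (simp only: P1_def P2_def w1_def w2_def)
  finally have I0: "integral\<^sup>L ?M I = 0" .
  have lower: "(real m * (1 - q) - q) * (max (z x) 0) ^ (m - 1) * ((P1 x - P2 x) \<bullet> (P1 x - P2 x)) \<le> I x" if x: "x \<in> ball 0 R" for x
  proof (cases "0 < z x")
    case False
    then have "max (z x) 0 = 0" by simp
    then show ?thesis using m by (simp add: I_def D_def \<psi>_def zero_power)
  next
    case True
    define E where "E = (P1 x - P2 x) \<bullet> (P1 x - P2 x)"
    have mz: "max (z x) 0 = z x" using True by simp
    have zm: "z x ^ m = z x ^ (m - 1) * z x" using m by (cases m) auto
    \<comment> \<open>The decomposition is P1 = P2 + (P1 - P2) over w1 = w2 + z, where z > 0 serves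
      as the second denominator.\<close>
    have "(P2 x + (P1 x - P2 x)) \<bullet> (P2 x + (P1 x - P2 x)) / (w2 x + z x) \<le> P2 x \<bullet> P2 x / w2 x + E / z x"
      unfolding E_def by (rule perspective_subadditive[OF w(2)[OF x] True])
    moreover define T where "T = P1 x \<bullet> P1 x / w1 x - P2 x \<bullet> P2 x / w2 x"
    ultimately have "T \<le> E / z x" by (simp add: z_def)
    then have "q * z x ^ m * T \<le> q * z x ^ m * (E / z x)"
      using q True by (intro mult_left_mono) auto
    also have "\<dots> = q * z x ^ (m - 1) * E" using True by (simp add: zm)
    finally have "q * z x ^ m * T \<le> q * z x ^ (m - 1) * E" .
    moreover have "I x = real m * z x ^ (m - 1) * (1 - q) * E - q * z x ^ m * T"
      by (simp add: I_def D_def \<psi>_def mz E_def T_def)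
    ultimately show ?thesis unfolding mz E_def[symmetric] by (simp add: algebra_simps)
  qed
  have Inn: "0 \<le> I x" if "x \<in> ball 0 R" for x
    by (rule order_trans[OF _ lower[OF that]]) (use mq in \<open>auto intro!: mult_nonneg_nonneg\<close>)
  have Iz: "I x = 0" if "x \<in> ball 0 R" for x
    by (rule nonneg_continuous_integral_zero[OF cI Inn I0 that])
  have Peq: "P1 x = P2 x" if "x \<in> ball 0 R" "0 < z x" for x
  proof -
    have "(real m * (1 - q) - q) * (max (z x) 0) ^ (m - 1) * ((P1 x - P2 x) \<bullet> (P1 x - P2 x)) \<le> 0"
      using lower[OF that(1)] Iz[OF that(1)] by simp
    moreover have "0 < (real m * (1 - q) - q) * (max (z x) 0) ^ (m - 1)" using mq that by simp
    ultimately have "(P1 x - P2 x) \<bullet> (P1 x - P2 x) \<le> 0" by (metis mult_le_0_iff linorder_not_le)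
    then have "(P1 x - P2 x) \<bullet> (P1 x - P2 x) = 0" using inner_ge_zero[of "P1 x - P2 x"] by linarith
    then show ?thesis by simp
  qed
  have D0: "D x = 0" if "x \<in> ball 0 R" for x
    using Peq[OF that] m by (cases "0 < z x") (auto simp: D_def max_def zero_power)
  have "\<exists>c. \<forall>x\<in>ball 0 R. \<psi> x = c"
  proof (rule has_derivative_zero_constant[OF convex_ball])
    show "(\<psi> has_derivative (\<lambda>h. 0)) (at x within ball 0 R)" if "x \<in> ball 0 R" for x
      using has_derivative_at_withinI[OF d\<psi>[OF that]] D0[OF that] by simp
  qed
  then obtain k where k: "\<And>x. x \<in> ball 0 R \<Longrightarrow> \<psi> x = k" by blast
  \<comment> \<open>If k > 0, then z > 0 on the whole ball and P1 = P2; since I = 0 and w1 differs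
    from w2, this leaves P2 = 0. Then v has zero gradient, and testing its equation with v^(-q)
    gives the value 0 for the integral of a.\<close>
  have "k \<le> 0"
  proof (rule ccontr)
    assume "\<not> k \<le> 0"
    then have zpos: "0 < z x" if "x \<in> ball 0 R" for x
      using k[OF that] m by (cases "0 < z x") (auto simp: \<psi>_def max_def zero_power)
    have G20: "G2 x = 0" if x: "x \<in> ball 0 R" for x
    proof -
      have P: "P1 x = P2 x" by (rule Peq[OF x zpos[OF x]])
      have "q * \<psi> x * (P2 x \<bullet> P2 x / w1 x - P2 x \<bullet> P2 x / w2 x) = 0"
        using Iz[OF x] by (simp add: I_def P)
      moreover have "\<psi> x \<noteq> 0" using zpos[OF x] by (simp add: \<psi>_def)
      ultimately have "P2 x \<bullet> P2 x / w1 x = P2 x \<bullet> P2 x / w2 x" using q by simp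
      moreover have "w1 x \<noteq> w2 x" using zpos[OF x] by (simp add: z_def)
      ultimately have "P2 x \<bullet> P2 x = 0" using w[OF x] by (simp add: frac_eq_eq)
      then have "P2 x = 0" by simp
      then show ?thesis using pv[of x] x by (simp add: P2_def)
    qed
    have "integral\<^sup>L ?M (\<lambda>x. G2 x \<bullet> ((- q * v x powr (- q - 1)) *\<^sub>R G2 x)) = integral\<^sup>L ?M (\<lambda>x. a x * v x powr q * v x powr (- q))"
    proof (rule neumann_weak_form[OF R a v(2) cv pv G2 dv])
      show "((\<lambda>x. v x powr (- q)) has_derivative (\<lambda>h. ((- q * v x powr (- q - 1)) *\<^sub>R G2 x) \<bullet> h)) (at x)" if "x \<in> ball 0 R" for x
        by (rule powr_has_gradient[OF dv[OF that]]) (use pv that in auto)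
    qed (auto intro!: continuous_intros cvp G2)
    moreover have "integral\<^sup>L ?M (\<lambda>x. G2 x \<bullet> ((- q * v x powr (- q - 1)) *\<^sub>R G2 x)) = integral\<^sup>L ?M (\<lambda>x. 0)"
      by (intro Bochner_Integration.integral_cong refl) (simp add: G20)
    moreover have "integral\<^sup>L ?M (\<lambda>x. a x * v x powr q * v x powr (- q)) = integral\<^sup>L ?M a"
    proof (rule Bochner_Integration.integral_cong[OF refl])
      fix x assume "x \<in> space ?M"
      then have "0 < v x" using pv[of x] by simp
      then have "v x powr q * v x powr (- q) = 1" by (simp flip: powr_add)
      then show "a x * v x powr q * v x powr (- q) = a x" by (simp add: mult.assoc)
    qed
    ultimately show False using neg by simp
  qed
  have "z x \<le> 0"
  proof (rule ccontr)
    assume "\<not> z x \<le> 0"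
    then have "0 < \<psi> x" by (simp add: \<psi>_def)
    with k[OF x] \<open>k \<le> 0\<close> show False by simp
  qed
  then have "u x powr (1 - q) \<le> v x powr (1 - q)" by (simp add: z_def w1_def w2_def)
  then show ?thesis using pu[of x] pv[of x] x q
    by (metis diff_gt_0_iff_gt linorder_not_le mem_ball_imp_mem_cball order_less_imp_le powr_less_mono2)
qed

text \<open>The comparison is applied in both directions on the open ball; the sphere follows by
  continuity.\<close>

theorem solution_unique:
  fixes a u v :: "'a::euclidean_space \<Rightarrow> real"
  assumes R: "0 < R" and q: "0 < q" "q < 1" and a: "Linf_on (ball 0 R) a"
    and neg: "integral\<^sup>L (lebesgue_on (ball 0 R)) a < 0"
    and u: "u \<in> Pcirc R" "is_solution R a q u" and v: "v \<in> Pcirc R" "is_solution R a q v"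
    and x: "x \<in> cball 0 R"
  shows "v x = u x"
proof -
  have c: "continuous_on (cball 0 R) (\<lambda>x. v x - u x)"
    using u(1) v(1) by (intro continuous_intros) (auto simp: Pcirc_def)
  have b: "v x - u x = 0" if "x \<in> ball 0 R" for x
    using solution_comparison[OF R q a neg u v that] solution_comparison[OF R q a neg v u that] by simp
  have cl: "closure (ball (0::'a) R) = cball 0 R" using R by simp
  have "v x - u x = 0"
    by (rule continuous_constant_on_closure[of "ball 0 R" "\<lambda>x. v x - u x"]) (use c b x cl in auto)
  then show ?thesis by simp
qed

subsection \<open>Existence\<close>

lemma Lp_on_bounded:
  fixes f :: "'a::euclidean_space \<Rightarrow> real"
  assumes f: "f \<in> borel_measurable (lebesgue_on (ball 0 R))" and b: "\<And>x. x \<in> ball 0 R \<Longrightarrow> \<bar>f x\<bar> \<le> B" and p: "0 \<le> p"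
  shows "Lp_on p (ball 0 R) f"
proof -
  have m: "(\<lambda>x. \<bar>f x\<bar> powr p) \<in> borel_measurable (lebesgue_on (ball 0 R))" using f by measurable
  have "integrable (lebesgue_on (ball 0 R)) (\<lambda>x. \<bar>f x\<bar> powr p)"
    by (rule integrable_on_ball_bounded[OF m, of "B powr p"]) (use b p in \<open>auto intro!: AE_I2 powr_mono2\<close>)
  with f show ?thesis by (simp add: Lp_on_def)
qed

lemma radial_solution:
  fixes a :: "'a::euclidean_space \<Rightarrow> real"
  assumes iw: "indefinite_weight DIM('a) R K \<alpha> q R0 M"
    and a: "AE x in lebesgue_on (ball 0 R). a x = \<alpha> (norm x)"
  obtains u where "u \<in> Pcirc R" "is_solution R a q u"
proof -
  interpret indefinite_weight "DIM('a)" R K \<alpha> q R0 M by (rule iw)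
  obtain U where U: "positive_profile U" and UR: "slope (\<lambda>s. U s powr q) R = 0" using neumann_profile by blast
  have Upos: "0 < U r" if "r \<in> {0..R}" for r using U that by (auto simp: positive_profile_def)
  have dU: "(U has_real_derivative - slope (\<lambda>s. U s powr q) r) (at r within {0..R})" if "r \<in> {0..R}" for r
    using U that unfolding positive_profile_def by blast
  have cU: "continuous_on {0..R} U" by (rule DERIV_continuous_on[OF dU])
  have cUq: "continuous_on {0..R} (\<lambda>s. U s powr q)"
    by (intro continuous_intros cU) (use Upos in \<open>auto simp: less_imp_neq[symmetric]\<close>)
  obtain B where B: "\<And>s. s \<in> {0..R} \<Longrightarrow> \<bar>U s powr q\<bar> \<le> B"
    using compact_imp_bounded[OF compact_continuous_image[OF cUq]] by (metis bounded_real compact_Icc imageI)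
  have B0: "0 \<le> B" using order_trans[OF abs_ge_zero B[of 0]] R_pos by simp
  \<comment> \<open>The right-hand side is frozen: for a given \<beta> = \<alpha> U^q the general
    formulas for radial gradients and Hessians apply. The indicator makes \<beta> bounded and Borel
    on the whole line, as U is controlled on \<open>{0..R}\<close> only.\<close>
  define \<beta> where "\<beta> s = \<alpha> s * (indicator {0..R} s *\<^sub>R (U s powr q))" for s
  define C where "C = K * B"
  have \<beta>m: "\<beta> \<in> borel_measurable borel"
    unfolding \<beta>_def by (intro borel_measurable_times weight_borel borel_measurable_continuous_on_indicator cUq) auto
  have \<beta>b: "\<bar>\<beta> s\<bar> \<le> C" for s
    unfolding \<beta>_def C_def abs_mult
    by (intro mult_mono weight_bound) (use B[of s] B0 K_nonneg in \<open>auto simp: indicator_def\<close>)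
  have ms: "mean_slope DIM('a) \<beta> t = slope (\<lambda>s. U s powr q) t" if "t \<le> R" for t
    unfolding mean_slope_def slope_def flux_def
    by (intro arg_cong2[where f = "(/)"] Henstock_Kurzweil_Integration.integral_cong refl) (use that in \<open>auto simp: \<beta>_def mult.assoc\<close>)
  define m where "m = mean_slope DIM('a) \<beta>"
  have cm: "continuous_on {0..R} m"
    using slope_continuous_on[OF cUq] by (rule continuous_on_eq) (simp add: m_def ms)
  have dU': "(U has_real_derivative - m r) (at r within {0..R})" if "r \<in> {0..R}" for r
    using dU[OF that] that by (simp add: m_def ms)
  have mb: "\<bar>m t\<bar> \<le> C * t" if "0 \<le> t" for t
    unfolding m_def by (rule mean_slope_bound) (use \<beta>m \<beta>b that in \<open>auto simp: Suc_leI\<close>)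
  define u where "u x = U (norm x)" for x :: 'a
  define G where "G x = (- m (norm x) / norm x) *\<^sub>R x" for x :: 'a
  have Gi: "G x \<bullet> i = radial_grad \<beta> i x" for x i by (simp add: G_def radial_grad_def m_def)
  have nG: "norm (G x) \<le> C * norm x" for x
    using mb[of "norm x"] by (cases "x = 0") (auto simp: G_def)
  have cu: "continuous_on (cball 0 R) u"
    unfolding u_def by (rule continuous_on_compose2[OF cU]) (auto intro!: continuous_intros)
  have cG: "continuous_on (cball 0 R) G"
    unfolding continuous_on_eq_continuous_within
  proof
    fix x :: 'a assume x: "x \<in> cball 0 R"
    show "continuous (at x within cball 0 R) G"
    proof (cases "x = 0")
      case True
      have "(G \<longlongrightarrow> 0) (at 0 within cball 0 R)"
      proof (rule Lim_null_comparison)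
        show "\<forall>\<^sub>F x in at 0 within cball 0 R. norm (G x) \<le> C * norm x" using nG by simp
        have "((\<lambda>x::'a. C * norm x) \<longlongrightarrow> C * norm (0::'a)) (at 0 within cball 0 R)" by (intro tendsto_intros)
        then show "((\<lambda>x::'a. C * norm x) \<longlongrightarrow> 0) (at 0 within cball 0 R)" by simp
      qed
      then show ?thesis using True by (simp add: continuous_within G_def)
    next
      case False
      have "continuous_on (cball 0 R) (\<lambda>x::'a. m (norm x))"
        by (rule continuous_on_compose2[OF cm]) (auto intro!: continuous_intros)
      then have "continuous (at x within cball 0 R) (\<lambda>x::'a. m (norm x))"
        using x by (simp add: continuous_on_eq_continuous_within)
      then show ?thesis unfolding G_def using False by (intro continuous_intros) auto
    qed
  qed
  have du: "(u has_derivative (\<lambda>h. G x \<bullet> h)) (at x)" if x: "x \<in> ball 0 R" for x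
  proof (cases "x = 0")
    case True
    \<comment> \<open>At the origin the norm is not differentiable, so the chain rule is replaced by
      composing the difference quotient of U, which tends to U'(0) = 0, with the norm.\<close>
    have "((\<lambda>y. (U y - U 0) / (y - 0)) \<longlongrightarrow> 0) (at 0 within {0..R})"
      using dU'[of 0] R_pos mb[of 0] by (simp add: has_field_derivative_iff)
    moreover have "filterlim norm (at (0::real) within {0..R}) (at (0::'a))"
      unfolding filterlim_at
    proof
      show "(norm \<longlongrightarrow> 0) (at (0::'a))" by (auto intro!: tendsto_eq_intros)
      show "\<forall>\<^sub>F x in at (0::'a). norm x \<in> {0..R} \<and> norm x \<noteq> 0"
        unfolding eventually_at using R_pos by (intro exI[of _ R]) (auto simp: dist_norm)
    qed
    ultimately have "((\<lambda>y::'a. (U (norm y) - U 0) / (norm y - 0)) \<longlongrightarrow> 0) (at 0)" by (rule filterlim_compose)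
    then have "((\<lambda>y::'a. norm (U (norm y) - U 0) / norm y) \<longlongrightarrow> 0) (at 0)"
      by (subst tendsto_norm_zero_iff[symmetric], subst (asm) tendsto_norm_zero_iff[symmetric]) simp
    then have "(u has_derivative (\<lambda>h. 0)) (at 0)"
      by (simp add: has_derivative_iff_norm u_def)
    then show ?thesis using True by (simp add: G_def)
  next
    case False
    then have r: "0 < norm x" "norm x < R" using x by auto
    have "(U has_real_derivative - m (norm x)) (at (norm x))"
      using dU'[of "norm x"] r by (simp add: at_within_Icc_at)
    then have "(U has_derivative (*) (- m (norm x))) (at (norm x))" by (simp add: has_field_derivative_def)
    from has_derivative_compose[OF has_derivative_norm[OF False] this]
    have "(u has_derivative (\<lambda>h. - m (norm x) * (sgn x \<bullet> h))) (at x)" by (simp add: u_def[abs_def] inner_commute)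
    moreover have "- m (norm x) * (sgn x \<bullet> h) = G x \<bullet> h" for h
      by (simp add: G_def sgn_div_norm divide_inverse)
    ultimately show ?thesis by simp
  qed
  have bm: "f \<in> borel_measurable borel \<Longrightarrow> f \<in> borel_measurable (lebesgue_on (ball (0::'a) R))" for f :: "'a \<Rightarrow> real"
    by (intro measurable_restrict_space1 measurable_completion) simp
  show thesis
  proof (rule that)
    show "u \<in> Pcirc R"
      unfolding Pcirc_def using cu cG du Upos by (auto simp: u_def intro!: exI[of _ G])
    obtain Bu where Bu: "\<And>x. x \<in> cball 0 R \<Longrightarrow> \<bar>u x\<bar> \<le> Bu" using continuous_on_cball_bounded[OF cu] by blast
    have C0: "0 \<le> C" using order_trans[OF abs_ge_zero \<beta>b] .
    have bnd: "weak_partial (ball 0 R) i u (radial_grad \<beta> i)" if i: "i \<in> Basis" for i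
    proof -
      have "continuous_on (ball 0 R) (\<lambda>x. G x \<bullet> i)" by (intro continuous_intros continuous_on_subset[OF cG]) auto
      from weak_partial_C1[OF open_ball du this i] show ?thesis by (simp add: Gi[abs_def])
    qed
    show "is_solution R a q u"
      unfolding is_solution_def
    \<comment> \<open>All entries are bounded, so N + 1 serves as an exponent above N.\<close>
    proof (intro conjI ballI exI[of _ "real DIM('a) + 1"] exI[of _ "radial_grad \<beta>"] exI[of _ "radial_hess \<beta>"])
      show "Lp_on (real DIM('a) + 1) (ball 0 R) u"
        by (rule Lp_on_bounded[where B = Bu])
          (use Bu in \<open>auto intro!: borel_measurable_on_ball_continuous continuous_on_subset[OF cu]\<close>)
      fix i :: 'a assume i: "i \<in> Basis"
      show "Lp_on (real DIM('a) + 1) (ball 0 R) (radial_grad \<beta> i)"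
      proof (rule Lp_on_bounded[where B = "C * R"])
        show "radial_grad \<beta> i \<in> borel_measurable (lebesgue_on (ball 0 R))"
          by (rule bm[OF radial_weak_hessian(1)[OF \<beta>m \<beta>b R_pos i i]])
        show "\<bar>radial_grad \<beta> i x\<bar> \<le> C * R" if "x \<in> ball 0 R" for x
          using radial_grad_bound[OF \<beta>m \<beta>b i, of x] mult_left_mono[OF _ C0, of "norm x" R] that by simp
      qed simp
      show "weak_partial (ball 0 R) i u (radial_grad \<beta> i)" by (rule bnd[OF i])
      fix j :: 'a assume j: "j \<in> Basis"
      show "Lp_on (real DIM('a) + 1) (ball 0 R) (radial_hess \<beta> i j)"
        by (rule Lp_on_bounded[OF bm[OF radial_weak_hessian(2)[OF \<beta>m \<beta>b R_pos i j]] radial_hess_bound[OF \<beta>m \<beta>b i j]]) simp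
      show "weak_partial (ball 0 R) j (radial_grad \<beta> i) (radial_hess \<beta> i j)"
        by (rule radial_weak_hessian(3)[OF \<beta>m \<beta>b R_pos i j])
    next
      have "AE x in lebesgue_on (ball (0::'a) R). x \<noteq> 0"
        using AE_lborel_singleton[of "0::'a"]
        by (simp add: AE_restrict_space_iff AE_completion_iff) (auto elim: eventually_mono)
      moreover have "AE x in lebesgue_on (ball (0::'a) R). x \<in> ball 0 R" by (auto intro!: AE_I2)
      ultimately show "AE x in lebesgue_on (ball 0 R). - (\<Sum>i\<in>Basis. radial_hess \<beta> i i x) = a x * u x powr q"
        using a
      proof eventually_elim
        case (elim x)
        then show ?case by (simp add: radial_hess_trace \<beta>_def u_def)
      qed
    next
      fix x :: 'a assume "x \<in> sphere 0 R"
      then have x: "norm x = R" by simp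
      \<comment> \<open>U is differentiable within \<open>{0..R}\<close> only, so the chain rule is
        applied within \<open>{0..<1}\<close>, which scaling by R maps into it; near 1 this is the
        left neighbourhood.\<close>
      have "((\<lambda>t. U (t * R)) has_real_derivative - m R * R) (at 1 within {0..<1})"
      proof -
        have "(U has_real_derivative - m R) (at (1 * R) within ((\<lambda>t. t * R) ` {0..<1}))"
          using dU'[of R] R_pos by (auto intro!: DERIV_subset[of U "- m R" R "{0..R}"] simp: mult_left_le_one_le)
        moreover have "((\<lambda>t. t * R) has_real_derivative R) (at 1 within {0..<1})"
          by (auto intro!: derivative_eq_intros)
        ultimately show ?thesis using DERIV_image_chain[of U "- m R" "\<lambda>t. t * R" 1 "{0..<1}" R] by (simp add: o_def)
      qed
      moreover have "m R = 0" using UR by (simp add: m_def ms)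
      moreover have "at (1::real) within {0..<1} = at_left 1"
        by (rule at_within_nhd[of _ "{0<..}"]) auto
      ultimately have "((\<lambda>t. U (t * R)) has_real_derivative 0) (at_left 1)" by simp
      moreover have "\<forall>\<^sub>F t in at_left (1::real). u (t *\<^sub>R x) = U (t * R)"
        using eventually_at_left_real[of 0 "1::real"] by (auto simp: u_def x elim!: eventually_mono)
      ultimately show "((\<lambda>t. u (t *\<^sub>R x)) has_real_derivative 0) (at_left 1)"
        by (subst has_field_derivative_cong_eventually[where g = "\<lambda>t. U (t * R)"]) (auto simp: u_def x)
    qed simp
  qed
qed

theorem theorem1p3:
  fixes a :: "'a::euclidean_space \<Rightarrow> real" and R R0 q :: real
  assumes "0 < q" and "q < 1"
    and "0 < R0" and "R0 < R"
    and "Linf_on (ball 0 R) a"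
    and "radial_on (ball 0 R) a"
    and "integral\<^sup>L (lebesgue_on (ball 0 R)) a < 0"
    and "AE x in lebesgue_on (annulus R0 R). 0 \<le> a x"
    and "(1 - q) / (2 * q + real DIM('a) * (1 - q)) * omega_sphere TYPE('a) * R0 ^ DIM('a)
           * Linf_norm (ball 0 R0) (\<lambda>x. max (- a x) 0)
         < integral\<^sup>L (lebesgue_on (annulus R0 R)) (\<lambda>x. max (a x) 0)"
  shows "\<exists>u. u \<in> Pcirc R \<and> is_solution R a q u \<and>
           (\<forall>v. v \<in> Pcirc R \<and> is_solution R a q v \<longrightarrow> (\<forall>x\<in>cball 0 R. v x = u x))"
proof -
  have R: "0 < R" using assms(3,4) by simp
  let ?M = "lebesgue_on (ball (0::'a) R)"
  define \<omega> where "\<omega> = omega_sphere TYPE('a)"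
  have om: "0 < \<omega>" by (simp add: \<omega>_def omega_sphere_pos)
  have am: "a \<in> borel_measurable ?M" using assms(5) by (simp add: Linf_on_def)
  obtain Ka where Ka: "AE x in ?M. \<bar>a x\<bar> \<le> Ka" using assms(5) by (auto simp: Linf_on_def)
  have annS: "annulus R0 R \<in> sets (lebesgue :: 'a measure)"
  proof -
    have "annulus R0 R = ball (0::'a) R - cball 0 R0" by (auto simp: annulus_def)
    then show ?thesis by simp
  qed
  obtain \<alpha>0 where \<alpha>0: "\<alpha>0 \<in> borel_measurable borel" "AE x in ?M. a x = \<alpha>0 (norm x)"
    using radial_borel_profile[OF am assms(6)] by blast
  define \<nu> where "\<nu> = Linf_norm (ball 0 R0) (\<lambda>x. max (- a x) 0)"
  define S where "S = {M. 0 \<le> M \<and> (AE x in lebesgue_on (ball (0::'a) R0). \<bar>max (- a x) 0\<bar> \<le> M)}"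
  have S_ne: "S \<noteq> {}"
  proof -
    have "AE x in lebesgue. x \<in> ball (0::'a) R \<longrightarrow> \<bar>a x\<bar> \<le> Ka" using Ka by (simp add: AE_restrict_space_iff)
    then have "AE x in lebesgue. x \<in> ball (0::'a) R0 \<longrightarrow> \<bar>max (- a x) 0\<bar> \<le> \<bar>Ka\<bar>"
      by eventually_elim (use assms(4) in auto)
    then have "\<bar>Ka\<bar> \<in> S" by (simp add: S_def AE_restrict_space_iff)
    then show ?thesis by blast
  qed
  have nu: "\<nu> = Inf S" by (simp add: \<nu>_def Linf_norm_def S_def)
  have nu0: "0 \<le> \<nu>" unfolding nu by (rule cInf_greatest[OF S_ne]) (simp add: S_def)
  define A where "A = (1 - q) / (2 * q + real DIM('a) * (1 - q)) * \<omega> * R0 ^ DIM('a)"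
  have A: "0 < A" unfolding A_def using assms(1-3) om
    by (intro mult_pos_pos divide_pos_pos add_pos_nonneg) auto
  define I where "I = integral\<^sup>L (lebesgue_on (annulus R0 R)) (\<lambda>x::'a. max (a x) 0)"
  have AI: "A * \<nu> < I" using assms(9) by (simp add: A_def I_def \<nu>_def \<omega>_def)
  \<comment> \<open>A M is the midpoint of A \<nu> and I. The strict inequality M > \<nu> is used
    because \<nu> is an infimum: some admissible essential bound then lies below M.\<close>
  define M where "M = \<nu> + (I - A * \<nu>) / (2 * A)"
  have AM: "A * M < I"
  proof -
    have "A * M = A * \<nu> + (I - A * \<nu>) / 2" using A by (simp add: M_def field_simps)
    then show ?thesis using AI by (simp only:) (simp add: field_simps)
  qed
  have M\<nu>: "\<nu> < M" using A AI by (simp add: M_def)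
  then have Mpos: "0 < M" using nu0 by simp
  obtain M' where "M' \<in> S" "M' < M" using cInf_lessD[OF S_ne] M\<nu> unfolding nu by blast
  then have aM: "AE x in lebesgue. x \<in> ball (0::'a) R0 \<longrightarrow> - M \<le> a x"
    by (auto simp: S_def AE_restrict_space_iff elim!: eventually_mono)
  have aA: "AE x in lebesgue. x \<in> annulus R0 R \<longrightarrow> 0 \<le> a x"
    using assms(8) annS by (simp add: AE_restrict_space_iff)
  define K where "K = max \<bar>Ka\<bar> M"
  \<comment> \<open>The bounds on the weight hold almost everywhere, but the locale asks for them at
    every radius, so the Borel profile is clamped. At R0 the lower bound 0 serves both regions, and
    the sphere of that radius is a null set.\<close>
  define lo where "lo r = (if r < R0 then - M else 0)" for r
  define \<alpha> where "\<alpha> r = max (lo r) (min K (\<alpha>0 r))" for r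
  have \<alpha>m: "\<alpha> \<in> borel_measurable borel" unfolding \<alpha>_def lo_def using \<alpha>0(1) by measurable
  have \<alpha>b: "\<bar>\<alpha> r\<bar> \<le> K" for r using Mpos by (auto simp: \<alpha>_def lo_def K_def)
  have sph: "AE x in lebesgue. norm (x::'a) \<noteq> R0"
  proof -
    have "sphere (0::'a) R0 \<in> null_sets lebesgue" using negligible_sphere by (simp add: negligible_iff_null_sets)
    then have "AE x in lebesgue. x \<notin> sphere (0::'a) R0" by (rule AE_not_in)
    then show ?thesis by simp
  qed
  have ae: "AE x in ?M. a x = \<alpha> (norm x)"
  proof -
    have "AE x in lebesgue. x \<in> ball (0::'a) R \<longrightarrow> \<bar>a x\<bar> \<le> Ka" "AE x in lebesgue. x \<in> ball 0 R \<longrightarrow> a x = \<alpha>0 (norm x)"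
      using Ka \<alpha>0(2) by (simp_all add: AE_restrict_space_iff)
    with aM aA sph have "AE x in lebesgue. x \<in> ball (0::'a) R \<longrightarrow> a x = \<alpha> (norm x)"
    proof eventually_elim
      case (elim x)
      show ?case
      proof
        assume x: "x \<in> ball 0 R"
        have a: "a x = \<alpha>0 (norm x)" "\<bar>a x\<bar> \<le> Ka" using elim x by auto
        have "lo (norm x) \<le> a x" using elim x by (auto simp: lo_def annulus_def)
        then show "a x = \<alpha> (norm x)" using a by (auto simp: \<alpha>_def K_def)
      qed
    qed
    then show ?thesis by (simp add: AE_restrict_space_iff)
  qed
  have bm: "f \<in> borel_measurable borel \<Longrightarrow> f \<in> borel_measurable ?M" for f :: "'a \<Rightarrow> real"
    by (intro measurable_restrict_space1 measurable_completion) simp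
  have neg: "integral {0..R} (\<lambda>s. s ^ (DIM('a) - 1) * \<alpha> s) < 0"
  proof -
    have "integral\<^sup>L ?M a = integral\<^sup>L ?M (\<lambda>x. \<alpha> (norm x))"
      by (rule integral_cong_AE[OF am bm ae]) (use \<alpha>m in measurable)
    also have "\<dots> = \<omega> * integral {0..R} (\<lambda>s. s ^ (DIM('a) - 1) * \<alpha> s)"
      unfolding \<omega>_def by (rule integral_ball_norm[OF R \<alpha>m \<alpha>b])
    finally show ?thesis using assms(7) om by (simp add: mult_less_0_iff)
  qed
  have mass: "I = \<omega> * integral {R0..R} (\<lambda>s. s ^ (DIM('a) - 1) * \<alpha> s)"
  proof -
    \<comment> \<open>The integral over the annulus becomes one over the ball, where the radial
      integration formula applies.\<close>
    define h where "h r = (if r \<in> {R0..R} then \<alpha> r else 0)" for r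
    have hm: "h \<in> borel_measurable borel" unfolding h_def using \<alpha>m by measurable
    have hb: "\<bar>h r\<bar> \<le> K" for r using \<alpha>b[of r] by (auto simp: h_def)
    have "I = integral\<^sup>L lebesgue (\<lambda>x::'a. indicator (annulus R0 R) x *\<^sub>R max (a x) 0)"
      unfolding I_def using annS by (intro integral_restrict_space) simp
    also have "\<dots> = integral\<^sup>L lebesgue (\<lambda>x::'a. indicator (ball 0 R) x *\<^sub>R (indicator (annulus R0 R) x * max (a x) 0))"
      by (intro Bochner_Integration.integral_cong refl) (auto simp: annulus_def indicator_def)
    also have "\<dots> = integral\<^sup>L ?M (\<lambda>x. indicator (annulus R0 R) x * max (a x) 0)"
      by (rule integral_restrict_space[symmetric]) simp
    also have "\<dots> = integral\<^sup>L ?M (\<lambda>x. h (norm x))"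
    proof (rule integral_cong_AE)
      have "(indicator (annulus R0 R) :: 'a \<Rightarrow> real) \<in> borel_measurable ?M"
        using annS by (intro measurable_restrict_space1) simp
      then show "(\<lambda>x. indicator (annulus R0 R) x * max (a x) 0) \<in> borel_measurable ?M" using am by measurable
      show "(\<lambda>x::'a. h (norm x)) \<in> borel_measurable ?M" by (rule bm) (use hm in measurable)
      have "AE x in lebesgue. x \<in> ball (0::'a) R \<longrightarrow> a x = \<alpha> (norm x)" using ae by (simp add: AE_restrict_space_iff)
      with aA sph have "AE x in lebesgue. x \<in> ball (0::'a) R \<longrightarrow> indicator (annulus R0 R) x * max (a x) 0 = h (norm x)"
        by eventually_elim (auto simp: h_def annulus_def indicator_def)
      then show "AE x in ?M. indicator (annulus R0 R) x * max (a x) 0 = h (norm x)" by (simp add: AE_restrict_space_iff)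
    qed
    also have "\<dots> = \<omega> * integral {0..R} (\<lambda>s. s ^ (DIM('a) - 1) * h s)"
      unfolding \<omega>_def by (rule integral_ball_norm[OF R hm hb])
    also have "integral {0..R} (\<lambda>s. s ^ (DIM('a) - 1) * h s)
        = integral {0..R} (\<lambda>s. if s \<in> {R0..R} then s ^ (DIM('a) - 1) * \<alpha> s else 0)"
      by (intro Henstock_Kurzweil_Integration.integral_cong) (auto simp: h_def)
    also have "\<dots> = integral {R0..R} (\<lambda>s. s ^ (DIM('a) - 1) * \<alpha> s)"
    proof -
      have "{R0..R} \<inter> {0..R} = {R0..R}" using assms(3) by auto
      then show ?thesis by (simp only: Henstock_Kurzweil_Integration.integral_restrict_Int)
    qed
    finally show ?thesis .
  qed
  have "indefinite_weight DIM('a) R K \<alpha> q R0 M"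
  proof
    show "1 \<le> DIM('a)" by (simp add: Suc_leI)
    show "(1 - q) / (2 * q + real DIM('a) * (1 - q)) * M * R0 ^ DIM('a) < integral {R0..R} (\<lambda>s. s ^ (DIM('a) - 1) * \<alpha> s)"
    proof -
      have "\<omega> * ((1 - q) / (2 * q + real DIM('a) * (1 - q)) * M * R0 ^ DIM('a)) = A * M"
        by (simp add: A_def)
      also have "\<dots> < \<omega> * integral {R0..R} (\<lambda>s. s ^ (DIM('a) - 1) * \<alpha> s)" using AM mass by simp
      finally show ?thesis by (rule mult_left_less_imp_less) (use om in simp)
    qed
  qed (use R assms(1-4) \<alpha>m \<alpha>b Mpos neg in \<open>auto simp: \<alpha>_def lo_def\<close>)
  from radial_solution[OF this ae] obtain u where u: "u \<in> Pcirc R" "is_solution R a q u" .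
  show ?thesis
  proof (intro exI conjI allI impI ballI)
    show "u \<in> Pcirc R" "is_solution R a q u" by (fact u)+
    fix v x assume v: "v \<in> Pcirc R \<and> is_solution R a q v" and x: "x \<in> cball (0::'a) R"
    show "v x = u x"
      by (rule solution_unique[OF R assms(1,2,5,7) u _ _ x]) (use v in auto)
  qed
qed

end
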